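(* Let $m,n\geq 2$, let $\gamma$ be a trace-free Hermitian $(n+m)\times(n+m)$ matrix, let $g$ be the Fubini--Study metric on $G_m(\mathbb{C}^{n+m})$, let $f_\gamma$, $h_1$ and $h_2$ be the function and the symmetric $2$-tensors on $G_m(\mathbb{C}^{n+m})$ associated with $\gamma$ (defined in the context), and let $h_3=f_\gamma g$. Then $$\mathcal{D}_{\gamma} := n(1-m^{2})h_{1}+m(1-n^{2})h_{2}+(n^{2}-m^{2})h_{3}$$ is an infinitesimal Einstein deformation (EID) for the Fubini--Study metric on $G_{m}(\mathbb{C}^{n+m})$.
   Context: Infinitesimal Einstein deformation: let $(\mathcal{M},g)$ be a closed Einstein manifold with $\mathrm{Ric}(g)=\lambda g$, $\lambda>0$. A section $h$ of $s^2(T^*\mathcal{M})$ is an EID if $\mathrm{tr}_g(h)=0$, $\mathrm{div}(h)=0$ and $\Delta h+2\mathrm{Rm}(h)=0$, where $\Delta=\mathrm{tr}_g\nabla^2$ is the connection Laplacian and $\mathrm{Rm}$ is the curvature operator on symmetric $2$-tensors, with the sign normalised so that $\mathrm{Rm}(g)=\mathrm{Ric}(g)$. Setup. $\langle v_1,v_2\rangle=v_2^*v_1$ is the standard Hermitian inner product on $\mathbb{C}^{n+m}$. $\mathcal{U}\to G_m(\mathbb{C}^{n+m})$ is the tautological $m$-plane bundle, $\mathcal{U}^\perp$ its orthogonal complement in the trivial bundle; the holomorphic tangent bundle is identified (as a complex bundle) with $\mathcal{U}^*\otimes\mathcal{U}^\perp$. Let $g_1$, $g_2$ be the Hermitian metrics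 induced on $\mathcal{U}^*$ and $\mathcal{U}^\perp$. Sesquilinear forms $P_1$ on $\mathcal{U}^*$ and $P_2$ on $\mathcal{U}^\perp$ give a sesquilinear form $P_1\cdot P_2$ on $\mathcal{U}^*\otimes\mathcal{U}^\perp$ by $(P_1\cdot P_2)(a\otimes b,c\otimes d)=P_1(a,c)P_2(b,d)$. The Fubini--Study metric is $g=g_1\cdot g_2$. Local coordinates. On the dense open set of planes spanned by the columns of $\binom{\mathbb{I}_m}{W}$, $W=(w_{ij})\in\mathrm{Mat}^{n\times m}(\mathbb{C})$, the entries $w_I$, $I=(i_1,i_2)$, $1\le i_1\le n$, $1\le i_2\le m$, are holomorphic coordinates. With $\epsilon_k$ the standard basis of $\mathbb{C}^{n+m}$, $c_j=\epsilon_j+\sum_r w_{rj}\epsilon_{m+r}$ ($1\le j\le m$) is a frame of $\mathcal{U}$ and $q_j=-\sum_{r}\overline{w}_{jr}\epsilon_r+\epsilon_{m+j}$ ($1\le j\le n$) is a frame of $\mathcal{U}^\perp$. Put $U_{ij}=\langle c_i,c_j\rangle$, $Q_{ij}=\langle q_i,q_j\rangle$; $U^{-1},Q^{-1}$ are the inverse matrices. The tangent vector $\partial/\partial w_I$ corresponds to $c^*_{i_2}\otimes\sum_k Q^{-1}_{i_1k}q_k$, and $g_{I\bar J}=U^{-1}_{j_2i_2}Q^{-1}_{i_1j_1}$. Let $P_\gamma(v_1,v_2)=v_2^*\gamma v_1$, $M^{\mathcal{U}}_{ij}=P_\gamma(c_i,c_j)$ and $M^{\mathcal{Q}}_{ij}=P_\gamma(q_i,q_j)$.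 The function $f_\gamma$ is $f_\gamma(x)=\sum_{i=1}^m P_\gamma(\eta_i(x),\eta_i(x))$ for any orthonormal frame $\{\eta_i\}$ of $\mathcal{U}$. The form $h_1$ is the product of $g_1$ with the restriction of $P_\gamma$ to $\mathcal{U}^\perp$, and $h_2$ is the product of the form induced by $P_\gamma|_{\mathcal{U}}$ on $\mathcal{U}^*$ (via the Hermitian metric of $\mathcal{U}$) with $g_2$; in coordinates (summing over repeated indices) $$(h_1)_{I\bar J}=U^{-1}_{j_2i_2}Q^{-1}_{i_1k}Q^{-1}_{lj_1}M^{\mathcal{Q}}_{kl},\qquad (h_2)_{I\bar J}=U^{-1}_{j_2k}U^{-1}_{li_2}M^{\mathcal{U}}_{kl}Q^{-1}_{i_1j_1}.$$ A Hermitian form with components $h_{I\bar J}$ is identified with the real $J$-invariant symmetric $2$-tensor $h$ whose $\mathbb{C}$-linear extension satisfies $h(\partial_{w_I},\partial_{\overline{w}_J})=h_{I\bar J}$ (also for $g$; with this convention $\mathrm{Ric}(g)=(n+m)g$). *)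

theory Defs
  imports "HOL-Analysis.Analysis"
begin

section \<open>Smooth functions on open sets\<close>

primrec Ck_on :: "nat \<Rightarrow> ('a::euclidean_space \<Rightarrow> 'b::real_normed_vector) \<Rightarrow> 'a set \<Rightarrow> bool" where
  "Ck_on 0 f S \<longleftrightarrow> continuous_on S f"
| "Ck_on (Suc k) f S \<longleftrightarrow> (\<forall>x\<in>S. f differentiable (at x)) \<and>
     (\<forall>u. Ck_on k (\<lambda>x. frechet_derivative f (at x) u) S)"

definition smooth_on :: "('a::euclidean_space \<Rightarrow> 'b::real_normed_vector) \<Rightarrow> 'a set \<Rightarrow> bool" where
  "smooth_on f S \<longleftrightarrow> (\<forall>k. Ck_on k f S)"

section \<open>Manifolds given by an indexed atlas\<close>

text \<open>An atlas of a set \<open>M\<close> consists of an index set \<open>I\<close>, open coordinate domains \<open>D a\<close> in a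
  Euclidean space, and injective parametrisations \<open>\<phi> a\<close> (inverses of the coordinate maps).\<close>

definition overlap :: "('i \<Rightarrow> 'e set) \<Rightarrow> ('i \<Rightarrow> 'e \<Rightarrow> 'p) \<Rightarrow> 'i \<Rightarrow> 'i \<Rightarrow> 'e set" where
  "overlap D \<phi> a b = {x \<in> D a. \<phi> a x \<in> \<phi> b ` D b}"

definition transition :: "('i \<Rightarrow> 'e set) \<Rightarrow> ('i \<Rightarrow> 'e \<Rightarrow> 'p) \<Rightarrow> 'i \<Rightarrow> 'i \<Rightarrow> 'e \<Rightarrow> 'e" where
  "transition D \<phi> a b x = inv_into (D b) (\<phi> b) (\<phi> a x)"

definition smooth_atlas ::
  "'p set \<Rightarrow> 'i set \<Rightarrow> ('i \<Rightarrow> 'e::euclidean_space set) \<Rightarrow> ('i \<Rightarrow> 'e \<Rightarrow> 'p) \<Rightarrow> bool" where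
  "smooth_atlas M I D \<phi> \<longleftrightarrow>
     (\<Union>a\<in>I. \<phi> a ` D a) = M \<and>
     (\<forall>a\<in>I. open (D a) \<and> inj_on (\<phi> a) (D a)) \<and>
     (\<forall>a\<in>I. \<forall>b\<in>I. open (overlap D \<phi> a b) \<and> smooth_on (transition D \<phi> a b) (overlap D \<phi> a b))"

definition atlas_topology ::
  "'p set \<Rightarrow> 'i set \<Rightarrow> ('i \<Rightarrow> 'e::euclidean_space set) \<Rightarrow> ('i \<Rightarrow> 'e \<Rightarrow> 'p) \<Rightarrow> 'p topology" where
  "atlas_topology M I D \<phi> =
     topology (\<lambda>S. S \<subseteq> M \<and> (\<forall>a\<in>I. open {x \<in> D a. \<phi> a x \<in> S}))"

definition closed_manifold ::
  "'p set \<Rightarrow> 'i set \<Rightarrow> ('i \<Rightarrow> 'e::euclidean_space set) \<Rightarrow> ('i \<Rightarrow> 'e \<Rightarrow> 'p) \<Rightarrow> bool" where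
  "closed_manifold M I D \<phi> \<longleftrightarrow> smooth_atlas M I D \<phi> \<and>
     Hausdorff_space (atlas_topology M I D \<phi>) \<and> compact_space (atlas_topology M I D \<phi>)"

text \<open>A covariant 2-tensor field is the family of its local representatives: \<open>h a x u v\<close> is the
  value, at the point \<open>\<phi> a x\<close>, on the tangent vectors with coordinates \<open>u\<close>, \<open>v\<close> in the chart \<open>a\<close>.\<close>

type_synonym 'e tensor2 = "'e \<Rightarrow> 'e \<Rightarrow> 'e \<Rightarrow> real"

definition symmetric_tensor_field ::
  "'i set \<Rightarrow> ('i \<Rightarrow> 'e::euclidean_space set) \<Rightarrow> ('i \<Rightarrow> 'e \<Rightarrow> 'p) \<Rightarrow> ('i \<Rightarrow> 'e tensor2) \<Rightarrow> bool" where
  "symmetric_tensor_field I D \<phi> h \<longleftrightarrow>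
     (\<forall>a\<in>I. \<forall>x\<in>D a. bilinear (h a x) \<and> (\<forall>u v. h a x u v = h a x v u)) \<and>
     (\<forall>a\<in>I. \<forall>u v. smooth_on (\<lambda>x. h a x u v) (D a)) \<and>
     (\<forall>a\<in>I. \<forall>b\<in>I. \<forall>x\<in>overlap D \<phi> a b. \<forall>u v.
        h a x u v = h b (transition D \<phi> a b x)
          (frechet_derivative (transition D \<phi> a b) (at x) u)
          (frechet_derivative (transition D \<phi> a b) (at x) v))"

definition riemannian_metric ::
  "'i set \<Rightarrow> ('i \<Rightarrow> 'e::euclidean_space set) \<Rightarrow> ('i \<Rightarrow> 'e \<Rightarrow> 'p) \<Rightarrow> ('i \<Rightarrow> 'e tensor2) \<Rightarrow> bool" where
  "riemannian_metric I D \<phi> g \<longleftrightarrow> symmetric_tensor_field I D \<phi> g \<and>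
     (\<forall>a\<in>I. \<forall>x\<in>D a. \<forall>u. u \<noteq> 0 \<longrightarrow> g a x u u > 0)"

section \<open>Levi-Civita calculus in a chart\<close>

text \<open>Throughout, \<open>g\<close> and \<open>h\<close> are local representatives in one chart, and vectors stand for
  coordinate vector fields with constant coefficients. \<open>dir_deriv F u x\<close> is the derivative of \<open>F\<close>
  at \<open>x\<close> in the direction \<open>u\<close>.\<close>

abbreviation dir_deriv ::
  "('e::euclidean_space \<Rightarrow> 'b::real_normed_vector) \<Rightarrow> 'e \<Rightarrow> 'e \<Rightarrow> 'b" where
  "dir_deriv F u x \<equiv> frechet_derivative F (at x) u"

definition sharp :: "('e::euclidean_space) tensor2 \<Rightarrow> 'e \<Rightarrow> ('e \<Rightarrow> real) \<Rightarrow> 'e" where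
  "sharp g x \<alpha> = (THE v. \<forall>w. g x v w = \<alpha> w)"

text \<open>\<open>metric_trace g x B\<close> is \<open>g\<^sup>i\<^sup>j B\<^sub>i\<^sub>j\<close>, computed as the trace of the endomorphism obtained from
  \<open>B\<close> by raising its second index.\<close>

definition metric_trace :: "('e::euclidean_space) tensor2 \<Rightarrow> 'e \<Rightarrow> ('e \<Rightarrow> 'e \<Rightarrow> real) \<Rightarrow> real" where
  "metric_trace g x B = (\<Sum>i\<in>Basis. sharp g x (B i) \<bullet> i)"

definition christoffel :: "('e::euclidean_space) tensor2 \<Rightarrow> 'e \<Rightarrow> 'e \<Rightarrow> 'e \<Rightarrow> 'e" where
  "christoffel g x u v = sharp g x (\<lambda>w.
     (dir_deriv (\<lambda>y. g y v w) u x + dir_deriv (\<lambda>y. g y u w) v x - dir_deriv (\<lambda>y. g y u v) w x) / 2)"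

text \<open>\<open>nabla g h x u v w\<close> is \<open>(\<nabla>\<^sub>u h)(v, w)\<close>, and \<open>nabla2 g h x t u v w\<close> is \<open>(\<nabla>\<^sup>2 h)(t, u; v, w)\<close> with
  \<open>t\<close> the direction of the outer derivative.\<close>

definition nabla :: "('e::euclidean_space) tensor2 \<Rightarrow> 'e tensor2 \<Rightarrow> 'e \<Rightarrow> 'e \<Rightarrow> 'e \<Rightarrow> 'e \<Rightarrow> real" where
  "nabla g h x u v w = dir_deriv (\<lambda>y. h y v w) u x
     - h x (christoffel g x u v) w - h x v (christoffel g x u w)"

definition nabla2 ::
  "('e::euclidean_space) tensor2 \<Rightarrow> 'e tensor2 \<Rightarrow> 'e \<Rightarrow> 'e \<Rightarrow> 'e \<Rightarrow> 'e \<Rightarrow> 'e \<Rightarrow> real" where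
  "nabla2 g h x t u v w = dir_deriv (\<lambda>y. nabla g h y u v w) t x
     - nabla g h x (christoffel g x t u) v w
     - nabla g h x u (christoffel g x t v) w
     - nabla g h x u v (christoffel g x t w)"

definition divergence :: "('e::euclidean_space) tensor2 \<Rightarrow> 'e tensor2 \<Rightarrow> 'e \<Rightarrow> 'e \<Rightarrow> real" where
  "divergence g h x w = metric_trace g x (\<lambda>u v. nabla g h x u v w)"

definition connection_laplacian :: "('e::euclidean_space) tensor2 \<Rightarrow> 'e tensor2 \<Rightarrow> 'e tensor2" where
  "connection_laplacian g h x v w = metric_trace g x (\<lambda>t u. nabla2 g h x t u v w)"

definition riemann :: "('e::euclidean_space) tensor2 \<Rightarrow> 'e \<Rightarrow> 'e \<Rightarrow> 'e \<Rightarrow> 'e \<Rightarrow> 'e" where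
  "riemann g x u v w =
     dir_deriv (\<lambda>y. christoffel g y v w) u x - dir_deriv (\<lambda>y. christoffel g y u w) v x
     + christoffel g x u (christoffel g x v w) - christoffel g x v (christoffel g x u w)"

definition ricci :: "('e::euclidean_space) tensor2 \<Rightarrow> 'e tensor2" where
  "ricci g x v w = (\<Sum>i\<in>Basis. riemann g x i v w \<bullet> i)"

text \<open>In a \<open>g\<close>-orthonormal basis \<open>e\<close> this is \<open>Rm(h)(v, w) = \<Sum>\<^sub>a h(R(e\<^sub>a, v)w, e\<^sub>a)\<close>; the lemma
  below is the normalisation \<open>Rm(g) = Ric(g)\<close>.\<close>

definition curvature_op :: "('e::euclidean_space) tensor2 \<Rightarrow> 'e tensor2 \<Rightarrow> 'e tensor2" where
  "curvature_op g h x v w = metric_trace g x (\<lambda>a b. h x (riemann g x a v w) b)"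

lemma curvature_op_metric:
  assumes "bilinear (g x)" and pos: "\<And>u. u \<noteq> 0 \<Longrightarrow> g x u u > 0"
  shows "curvature_op g g x = ricci g x"
proof -
  have "sharp g x (g x z) = z" for z
    unfolding sharp_def
  proof (rule the_equality)
    fix v assume v: "\<forall>w. g x v w = g x z w"
    have "g x (v - z) (v - z) = 0"
      using v by (simp add: bilinear_lsub[OF assms(1)])
    with pos[of "v - z"] show "v = z" by auto
  qed simp
  then show ?thesis
    by (simp add: curvature_op_def metric_trace_def ricci_def fun_eq_iff)
qed

section \<open>Infinitesimal Einstein deformations\<close>

definition closed_einstein_manifold ::
  "'p set \<Rightarrow> 'i set \<Rightarrow> ('i \<Rightarrow> 'e::euclidean_space set) \<Rightarrow> ('i \<Rightarrow> 'e \<Rightarrow> 'p) \<Rightarrow> ('i \<Rightarrow> 'e tensor2) \<Rightarrow>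
    real \<Rightarrow> bool" where
  "closed_einstein_manifold M I D \<phi> g l \<longleftrightarrow>
     closed_manifold M I D \<phi> \<and> riemannian_metric I D \<phi> g \<and>
     (\<forall>a\<in>I. \<forall>x\<in>D a. \<forall>u v. ricci (g a) x u v = l * g a x u v)"

definition infinitesimal_einstein_deformation ::
  "'p set \<Rightarrow> 'i set \<Rightarrow> ('i \<Rightarrow> 'e::euclidean_space set) \<Rightarrow> ('i \<Rightarrow> 'e \<Rightarrow> 'p) \<Rightarrow> ('i \<Rightarrow> 'e tensor2) \<Rightarrow>
    ('i \<Rightarrow> 'e tensor2) \<Rightarrow> bool" where
  "infinitesimal_einstein_deformation M I D \<phi> g h \<longleftrightarrow>
     (\<exists>l>0. closed_einstein_manifold M I D \<phi> g l) \<and>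
     symmetric_tensor_field I D \<phi> h \<and>
     (\<forall>a\<in>I. \<forall>x\<in>D a.
        metric_trace (g a) x (h a x) = 0 \<and>
        (\<forall>w. divergence (g a) (h a) x w = 0) \<and>
        (\<forall>v w. connection_laplacian (g a) (h a) x v w + 2 * curvature_op (g a) (h a) x v w = 0))"

section \<open>Hermitian linear algebra\<close>

definition cadjoint :: "complex^'a^'b \<Rightarrow> complex^'b^'a" where
  "cadjoint A = (\<chi> i j. cnj (A $ j $ i))"

definition hermitian :: "complex^'a^'a \<Rightarrow> bool" where
  "hermitian A \<longleftrightarrow> cadjoint A = A"

definition unitary :: "complex^'a::finite^'a \<Rightarrow> bool" where
  "unitary A \<longleftrightarrow> cadjoint A ** A = mat 1"

definition hinner :: "complex^'a::finite \<Rightarrow> complex^'a \<Rightarrow> complex" where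
  "hinner v w = (\<Sum>k\<in>UNIV. v $ k * cnj (w $ k))"

definition P_form :: "complex^'a::finite^'a \<Rightarrow> complex^'a \<Rightarrow> complex^'a \<Rightarrow> complex" where
  "P_form \<gamma> v w = hinner (\<gamma> *v v) w"

section \<open>The Grassmannian, its charts and its tangent spaces\<close>

text \<open>\<open>C\<^sup>n\<^sup>+\<^sup>m\<close> is \<open>complex^('m + 'n)\<close>: the first \<open>m\<close> basis vectors are indexed by \<open>Inl\<close>, the last \<open>n\<close>
  ones by \<open>Inr\<close>. The matrix \<open>W \<in> Mat\<^sup>n\<^sup>\<times>\<^sup>m\<close> has type \<open>complex^'m^'n\<close>, which is a real Euclidean space;
  a vector \<open>u\<close> of this type stands for the real tangent vector with holomorphic part
  \<open>\<Sum>\<^sub>I u\<^sub>I \<partial>/\<partial>w\<^sub>I\<close>.\<close>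

definition grassmannian :: "(complex^('m::finite + 'n::finite)) set set" where
  "grassmannian = {V. vec.subspace V \<and> vec.dim V = CARD('m)}"

text \<open>For \<open>A = mat 1\<close> these are the frames \<open>c\<^sub>j\<close> and \<open>q\<^sub>j\<close> of the standard affine chart; the other
  charts are its translates under the unitary group, which together cover the Grassmannian.\<close>

definition c_frame :: "complex^('m + 'n)^('m + 'n) \<Rightarrow> complex^'m^'n \<Rightarrow> 'm::finite \<Rightarrow>
    complex^('m + 'n::finite)" where
  "c_frame A W j = A *v (axis (Inl j) 1 + (\<Sum>r\<in>UNIV. W $ r $ j *s axis (Inr r) 1))"

definition q_frame :: "complex^('m + 'n)^('m + 'n) \<Rightarrow> complex^'m^'n \<Rightarrow> 'n::finite \<Rightarrow>
    complex^('m::finite + 'n)" where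
  "q_frame A W j = A *v (- (\<Sum>r\<in>UNIV. cnj (W $ j $ r) *s axis (Inl r) 1) + axis (Inr j) 1)"

definition plane :: "complex^('m::finite + 'n::finite)^('m + 'n) \<Rightarrow> complex^'m^'n \<Rightarrow>
    (complex^('m + 'n)) set" where
  "plane A W = vec.span (range (c_frame A W))"

definition Q_gram :: "complex^('m::finite + 'n::finite)^('m + 'n) \<Rightarrow> complex^'m^'n \<Rightarrow> complex^'n^'n" where
  "Q_gram A W = (\<chi> i j. hinner (q_frame A W i) (q_frame A W j))"

definition c_coframe :: "complex^('m + 'n)^('m + 'n) \<Rightarrow> complex^'m^'n \<Rightarrow> 'm::finite \<Rightarrow>
    complex^('m + 'n::finite) \<Rightarrow> complex" where
  "c_coframe A W j v = vec.representation (range (c_frame A W)) v (c_frame A W j)"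

text \<open>An element of \<open>U\<^sup>* \<otimes> U\<^sup>\<bottom>\<close> at the plane \<open>V\<close> is encoded as a linear map from \<open>V\<close> to its orthogonal
  complement, \<open>a \<otimes> b\<close> being \<open>v \<mapsto> a(v) b\<close>; its values outside \<open>V\<close> are irrelevant. The vector
  \<open>\<partial>/\<partial>w\<^sub>i\<^sub>j\<close> is \<open>c\<^sub>j\<^sup>* \<otimes> \<Sum>\<^sub>k (Q\<^sup>-\<^sup>1)\<^sub>i\<^sub>k q\<^sub>k\<close>.\<close>

definition tangent :: "complex^('m::finite + 'n::finite)^('m + 'n) \<Rightarrow> complex^'m^'n \<Rightarrow> complex^'m^'n \<Rightarrow>
    complex^('m + 'n) \<Rightarrow> complex^('m + 'n)" where
  "tangent A W u v = (\<Sum>i\<in>UNIV. \<Sum>j\<in>UNIV. (u $ i $ j * c_coframe A W j v) *s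
     (\<Sum>k\<in>UNIV. matrix_inv (Q_gram A W) $ i $ k *s q_frame A W k))"

section \<open>The forms and the function attached to a Hermitian matrix\<close>

definition is_orthonormal_frame :: "(complex^'a::finite) set \<Rightarrow> ('m::finite \<Rightarrow> complex^'a) \<Rightarrow> bool" where
  "is_orthonormal_frame V \<eta> \<longleftrightarrow>
     (\<forall>i j. hinner (\<eta> i) (\<eta> j) = (if i = j then 1 else 0)) \<and> vec.span (range \<eta>) = V"

text \<open>The constructions below do not depend on the orthonormal frame chosen here.\<close>

definition orthonormal_frame :: "(complex^('m::finite + 'n::finite)) set \<Rightarrow> 'm \<Rightarrow> complex^('m + 'n)" where
  "orthonormal_frame V = (SOME \<eta>. is_orthonormal_frame V \<eta>)"

definition riesz_vector :: "(complex^'a::finite) set \<Rightarrow> (complex^'a \<Rightarrow> complex) \<Rightarrow> complex^'a" where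
  "riesz_vector V a = (THE w. w \<in> V \<and> (\<forall>v\<in>V. a v = hinner v w))"

text \<open>The form on the dual of \<open>V\<close> induced by \<open>P\<close>. The arguments are swapped because the
  identification of functionals with vectors is antilinear.\<close>

definition dual_form :: "(complex^'a::finite \<Rightarrow> complex^'a \<Rightarrow> complex) \<Rightarrow> (complex^'a) set \<Rightarrow>
    (complex^'a \<Rightarrow> complex) \<Rightarrow> (complex^'a \<Rightarrow> complex) \<Rightarrow> complex" where
  "dual_form P V a b = P (riesz_vector V b) (riesz_vector V a)"

text \<open>\<open>P1 \<cdot> P2\<close> on \<open>U\<^sup>* \<otimes> U\<^sup>\<bottom>\<close>, the sesquilinear form with
  \<open>(P1 \<cdot> P2)(a \<otimes> b, c \<otimes> d) = P1(a, c) P2(b, d)\<close>, evaluated through \<open>S = \<Sum>\<^sub>i \<eta>\<^sub>i\<^sup>* \<otimes> S(\<eta>\<^sub>i)\<close>.\<close>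

definition product_form :: "((complex^('m::finite + 'n::finite) \<Rightarrow> complex) \<Rightarrow>
      (complex^('m + 'n) \<Rightarrow> complex) \<Rightarrow> complex) \<Rightarrow>
    (complex^('m + 'n) \<Rightarrow> complex^('m + 'n) \<Rightarrow> complex) \<Rightarrow> (complex^('m + 'n)) set \<Rightarrow>
    (complex^('m + 'n) \<Rightarrow> complex^('m + 'n)) \<Rightarrow> (complex^('m + 'n) \<Rightarrow> complex^('m + 'n)) \<Rightarrow> complex" where
  "product_form P1 P2 V S T = (let \<eta> = orthonormal_frame V in
     \<Sum>i\<in>UNIV. \<Sum>j\<in>UNIV. P1 (\<lambda>v. hinner v (\<eta> i)) (\<lambda>v. hinner v (\<eta> j)) * P2 (S (\<eta> i)) (T (\<eta> j)))"

type_synonym ('m, 'n) hermitian_form_field = "(complex^('m + 'n)) set \<Rightarrow>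
    (complex^('m + 'n) \<Rightarrow> complex^('m + 'n)) \<Rightarrow> (complex^('m + 'n) \<Rightarrow> complex^('m + 'n)) \<Rightarrow> complex"

definition fubini_study :: "('m::finite, 'n::finite) hermitian_form_field" where
  "fubini_study V = product_form (dual_form hinner V) hinner V"

definition h1 :: "complex^('m + 'n)^('m + 'n) \<Rightarrow> ('m::finite, 'n::finite) hermitian_form_field" where
  "h1 \<gamma> V = product_form (dual_form hinner V) (P_form \<gamma>) V"

definition h2 :: "complex^('m + 'n)^('m + 'n) \<Rightarrow> ('m::finite, 'n::finite) hermitian_form_field" where
  "h2 \<gamma> V = product_form (dual_form (P_form \<gamma>) V) hinner V"

definition f_fun :: "complex^('m::finite + 'n::finite)^('m + 'n) \<Rightarrow> (complex^('m + 'n)) set \<Rightarrow> complex" where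
  "f_fun \<gamma> V = (\<Sum>i\<in>UNIV. P_form \<gamma> (orthonormal_frame V i) (orthonormal_frame V i))"

definition h3 :: "complex^('m + 'n)^('m + 'n) \<Rightarrow> ('m::finite, 'n::finite) hermitian_form_field" where
  "h3 \<gamma> V S T = f_fun \<gamma> V * fubini_study V S T"

definition deformation :: "complex^('m + 'n)^('m + 'n) \<Rightarrow> ('m::finite, 'n::finite) hermitian_form_field" where
  "deformation \<gamma> V S T = (let m = of_nat CARD('m); n = of_nat CARD('n) in
     n * (1 - m\<^sup>2) * h1 \<gamma> V S T + m * (1 - n\<^sup>2) * h2 \<gamma> V S T + (n\<^sup>2 - m\<^sup>2) * h3 \<gamma> V S T)"

text \<open>The real \<open>J\<close>-invariant symmetric tensor \<open>h\<close> whose complex-linear extension satisfies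
  \<open>h(\<partial>/\<partial>w\<^sub>I, \<partial>/\<partial>\<bar>w\<^sub>J) = h\<^sub>I\<^sub>J\<close>: for the real vectors \<open>u\<close> and \<open>v\<close> with holomorphic parts \<open>\<Sum>\<^sub>I u\<^sub>I \<partial>/\<partial>w\<^sub>I\<close>
  and \<open>\<Sum>\<^sub>J v\<^sub>J \<partial>/\<partial>w\<^sub>J\<close> it gives \<open>2 Re \<Sum>\<^sub>I\<^sub>J h\<^sub>I\<^sub>J u\<^sub>I cnj(v\<^sub>J)\<close>.\<close>

definition real_tensor :: "('m::finite, 'n::finite) hermitian_form_field \<Rightarrow>
    complex^('m + 'n)^('m + 'n) \<Rightarrow> (complex^'m^'n) tensor2" where
  "real_tensor H A W u v = 2 * Re (H (plane A W) (tangent A W u) (tangent A W v))"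

end

theory Submission
  imports Defs
begin

text \<open>In the chart of a unitary matrix \<open>A\<close> the plane with coordinate \<open>W\<close> is spanned by the columns of
\<open>C = A (1; W)\<close> and its orthogonal complement by those of \<open>K = A (-W\<^sup>*; 1)\<close>. A coordinate vector
\<open>X\<close> becomes the square matrix \<open>T\<^sub>X = K (K\<^sup>* K)\<^sup>-\<^sup>1 X (C\<^sup>* C)\<^sup>-\<^sup>1 C\<^sup>*\<close>, which maps the plane to its
complement and kills the complement. With \<open>P\<close> the orthogonal projection onto the plane, the tensors
in question are traces of words in these matrices:
\<open>g(v, w) = 2 Re tr(T\<^sub>v T\<^sub>w\<^sup>*)\<close>, \<open>h\<^sub>1(v, w) = 2 Re tr(T\<^sub>v T\<^sub>w\<^sup>* \<gamma>)\<close>,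
\<open>h\<^sub>2(v, w) = 2 Re tr(T\<^sub>w\<^sup>* T\<^sub>v \<gamma>)\<close> and \<open>h\<^sub>3 = tr(P \<gamma>) g\<close>.

Two rules then give all covariant derivatives at an arbitrary point of the chart. First,
\<open>T\<^sub>v T\<^sub>w = 0\<close>. Second (\<open>has_derivative_tan_op\<close>), the derivative of \<open>T\<^sub>v\<close> in the direction \<open>X\<close> is
\<open>T\<close> applied to the Christoffel term plus the commutator \<open>[T\<^sub>v, T\<^sub>X\<^sup>*]\<close>; so \<open>\<nabla>\<^sub>X\<close> acts on a word by
replacing one letter \<open>T\<^sub>v\<close> at a time by this commutator. In particular \<open>\<nabla>g = 0\<close>, the curvature is a
sum of words of length three (\<open>riemann_fs_metric\<close>), and \<open>P\<close> has derivative \<open>T\<^sub>X + T\<^sub>X\<^sup>*\<close>.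
Contracting \<open>X\<close> over an orthonormal basis turns \<open>T\<^sub>X M T\<^sub>X\<^sup>*\<close> into \<open>tr(P M) (1 - P)\<close> and
\<open>T\<^sub>X\<^sup>* M T\<^sub>X\<close> into \<open>tr((1 - P) M) P\<close>, and kills \<open>T\<^sub>X M T\<^sub>X\<close>.

Let \<open>a = tr(P \<gamma>)\<close>, so that \<open>tr((1 - P) \<gamma>) = -a\<close> as \<open>\<gamma>\<close> has trace zero, and put
\<open>\<tau>(w) = Re tr(T\<^sub>w\<^sup>* \<gamma>)\<close>. The rules give \<open>Ric = (m + n) g\<close> and, for \<open>h\<^sub>1, h\<^sub>2, h\<^sub>3\<close> in this order,
the traces \<open>-2ma, 2na, 2mna\<close>, the divergences \<open>-2n\<tau>, 2m\<tau>, 2\<tau>\<close>, and the Laplacians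
\<open>2a g - 2m h\<^sub>1\<close>, \<open>-2a g - 2n h\<^sub>2\<close>, \<open>-2(m + n) h\<^sub>3\<close>, which are cancelled one by one by
\<open>2 Rm(h\<^sub>i)\<close>. Hence a combination of the \<open>h\<^sub>i\<close> satisfies the equations as soon as its coefficients
are orthogonal to \<open>(-m, n, mn)\<close> and \<open>(-n, m, 1)\<close>, and the coefficients of the theorem are the cross
product of these two vectors.

It remains to see that these objects live on the closed manifold. \<open>T\<^sub>X\<close> is the off-diagonal part of the
derivative of \<open>P\<close>, which depends only on the plane, so every tensor built from \<open>T\<close> and \<open>P\<close> is
compatible with the coordinate changes (\<open>tan_op_transition\<close>). The map from a plane to \<open>P\<close> separates
points, and the unitary group maps onto the Grassmannian, whence the latter is Hausdorff and compact.\<close>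

section \<open>Matrix calculus\<close>

lemma bounded_bilinear_matrix_mult:
  "bounded_bilinear ((**) :: complex^'b^'a \<Rightarrow> complex^'c^'b \<Rightarrow> complex^'c^'a)"
  unfolding bilinear_conv_bounded_bilinear[symmetric] bilinear_def
  by (auto intro!: linearI simp: vec_eq_iff matrix_matrix_mult_def sum.distrib algebra_simps
      scaleR_sum_right)

lemmas matrix_mult_left_distrib =
  bounded_bilinear.add_left[OF bounded_bilinear_matrix_mult]
  bounded_bilinear.diff_left[OF bounded_bilinear_matrix_mult]
  bounded_bilinear.minus_left[OF bounded_bilinear_matrix_mult]

lemmas matrix_mult_right_distrib =
  bounded_bilinear.add_right[OF bounded_bilinear_matrix_mult]
  bounded_bilinear.diff_right[OF bounded_bilinear_matrix_mult]
  bounded_bilinear.minus_right[OF bounded_bilinear_matrix_mult]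

lemmas matrix_mult_scaleR =
  bounded_bilinear.scaleR_left[OF bounded_bilinear_matrix_mult]
  bounded_bilinear.scaleR_right[OF bounded_bilinear_matrix_mult]

lemmas matrix_mult_expand =
  matrix_mult_left_distrib matrix_mult_right_distrib matrix_mult_scaleR matrix_mul_assoc

lemma bounded_linear_cadjoint: "bounded_linear (cadjoint :: complex^'a^'b \<Rightarrow> _)"
  unfolding linear_conv_bounded_linear[symmetric]
  by (auto intro!: linearI simp: cadjoint_def vec_eq_iff)

lemmas cadjoint_linear [simp] =
  linear_add[OF bounded_linear.linear[OF bounded_linear_cadjoint]]
  linear_diff[OF bounded_linear.linear[OF bounded_linear_cadjoint]]
  linear_neg[OF bounded_linear.linear[OF bounded_linear_cadjoint]]
  linear_0[OF bounded_linear.linear[OF bounded_linear_cadjoint]]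
  linear_cmul[OF bounded_linear.linear[OF bounded_linear_cadjoint]]

lemma cadjoint_cadjoint [simp]: "cadjoint (cadjoint A) = A"
  by (simp add: cadjoint_def vec_eq_iff)

lemma cadjoint_mat_1 [simp]: "cadjoint (mat 1) = mat 1"
  by (auto simp: cadjoint_def vec_eq_iff mat_def)

lemma cadjoint_mult: "cadjoint (A ** B) = cadjoint B ** cadjoint A"
  by (simp add: cadjoint_def vec_eq_iff matrix_matrix_mult_def mult.commute)

lemma trace_cadjoint: "trace (cadjoint A) = cnj (trace A)"
  by (simp add: trace_def cadjoint_def)

lemma
  fixes A :: "complex^'a^'a"
  assumes "det A \<noteq> 0"
  shows matrix_inv_right: "A ** matrix_inv A = mat 1"
    and matrix_inv_left: "matrix_inv A ** A = mat 1"
proof -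
  have "\<exists>B. A ** B = mat 1 \<and> B ** A = mat 1"
    using assms by (simp add: invertible_det_nz[symmetric] invertible_def)
  from someI_ex[OF this] show "A ** matrix_inv A = mat 1" "matrix_inv A ** A = mat 1"
    by (simp_all add: matrix_inv_def)
qed

lemma matrix_inv_unique:
  fixes A B :: "complex^'a^'a"
  assumes "A ** B = mat 1"
  shows "matrix_inv A = B"
proof -
  have "det A \<noteq> 0"
    using assms invertible_right_inverse invertible_det_nz by blast
  then have "matrix_inv A ** A = mat 1"
    by (rule matrix_inv_left)
  then show ?thesis
    by (metis assms matrix_mul_assoc matrix_mul_lid matrix_mul_rid)
qed

text \<open>Only the continuity of the inverse is taken from this formula; its derivative and its smoothness then
follow from algebra.\<close>

lemma matrix_inv_eq_cramer:
  fixes A :: "complex^'a^'a"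
  assumes "det A \<noteq> 0"
  shows "matrix_inv A $ k $ l =
    det (\<chi> i j. if j = k then axis l 1 $ i else A $ i $ j) / det A"
proof -
  have "A ** matrix_inv A = mat 1"
    using assms by (simp add: matrix_inv_right)
  then have "A *v column l (matrix_inv A) = axis l 1"
    by (auto simp: vec_eq_iff column_def matrix_vector_mult_def matrix_matrix_mult_def
        mat_def axis_def)
  then show ?thesis
    using cramer[OF assms, of "column l (matrix_inv A)" "axis l 1"]
    by (simp add: vec_eq_iff column_def)
qed

lemma continuous_on_det:
  fixes F :: "'e::topological_space \<Rightarrow> complex^'a^'a"
  assumes "continuous_on S F"
  shows "continuous_on S (\<lambda>x. det (F x))"
  unfolding det_def by (intro continuous_intros assms)

lemma continuous_on_matrix_inv:
  fixes F :: "'e::topological_space \<Rightarrow> complex^'a^'a"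
  assumes "continuous_on S F" and nz: "\<And>x. x \<in> S \<Longrightarrow> det (F x) \<noteq> 0"
  shows "continuous_on S (\<lambda>x. matrix_inv (F x))"
proof -
  have "continuous_on S (\<lambda>x. \<chi> k l. det (\<chi> i j. if j = k then axis l 1 $ i else F x $ i $ j) / det (F x))"
  proof (intro continuous_intros continuous_on_det assms nz continuous_on_vec_lambda)
    fix i j k and l :: 'a
    show "continuous_on S (\<lambda>x. if j = k then axis l 1 $ i else F x $ i $ j)"
      by (cases "j = k") (auto intro!: continuous_intros assms)
  qed (simp add: nz)
  moreover have "matrix_inv (F x) = (\<chi> k l. det (\<chi> i j. if j = k then axis l 1 $ i else F x $ i $ j) / det (F x))"
    if "x \<in> S" for x
    using nz[OF that] by (simp add: vec_eq_iff matrix_inv_eq_cramer)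
  ultimately show ?thesis
    by (simp cong: continuous_on_cong)
qed

lemma open_det_nonzero: "open {A :: complex^'a^'a. det A \<noteq> 0}"
proof -
  have "open ((det :: complex^'a^'a \<Rightarrow> complex) -` (- {0}))"
    by (intro open_vimage continuous_on_det continuous_on_id) auto
  then show ?thesis
    by (simp add: vimage_def)
qed

text \<open>The remainder of the first-order expansion of the inverse at \<open>A\<close> factors as
  \<open>- (X\<^sup>-\<^sup>1 - A\<^sup>-\<^sup>1) (X - A) A\<^sup>-\<^sup>1\<close>, so differentiability follows from continuity.\<close>

lemma has_derivative_matrix_inv:
  fixes A :: "complex^'a^'a"
  assumes nz: "det A \<noteq> 0"
  shows "(matrix_inv has_derivative (\<lambda>H. - (matrix_inv A ** H ** matrix_inv A))) (at A)"
proof -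
  let ?I = "matrix_inv A"
  obtain c where c: "\<And>(X::complex^'a^'a) Y :: complex^'a^'a. norm (X ** Y) \<le> norm X * norm Y * c" and "c > 0"
    using bounded_bilinear.pos_bounded[OF bounded_bilinear_matrix_mult] by blast
  define r where "r X = matrix_inv X - ?I - - (?I ** (X - A) ** ?I)" for X
  have ev: "\<forall>\<^sub>F X in at A. X \<in> {X. det X \<noteq> 0}"
    using nz open_det_nonzero by (intro eventually_at_in_open') auto
  have "isCont matrix_inv A"
    using continuous_on_matrix_inv[OF continuous_on_id, of "{X. det X \<noteq> 0}"] nz open_det_nonzero
      continuous_on_eq_continuous_at by blast
  then have "((\<lambda>X. matrix_inv X - ?I) \<longlongrightarrow> 0) (at A)"
    by (simp add: isCont_def LIM_zero)
  then have "((\<lambda>X. norm (matrix_inv X - ?I) * c * (norm ?I * c)) \<longlongrightarrow> norm (0::complex^'a^'a) * c * (norm ?I * c)) (at A)"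
    by (intro tendsto_intros)
  then have lim: "((\<lambda>X. norm (matrix_inv X - ?I) * c * (norm ?I * c)) \<longlongrightarrow> 0) (at A)"
    by simp
  have bound: "norm (r X) / norm (X - A) \<le> norm (matrix_inv X - ?I) * c * (norm ?I * c)"
    if "X \<in> {X. det X \<noteq> 0}" for X
  proof -
    have 1: "matrix_inv X ** X = mat 1" "X ** matrix_inv X = mat 1" "A ** ?I = mat 1" "?I ** A = mat 1"
      using that nz by (simp_all add: matrix_inv_left matrix_inv_right)
    have 2: "matrix_inv X ** A ** ?I = matrix_inv X"
      by (metis 1(3) matrix_mul_assoc matrix_mul_rid)
    have "r X = - ((matrix_inv X - ?I) ** (X - A) ** ?I)"
      unfolding r_def matrix_mult_expand 1 2 by simp
    then have "norm (r X) \<le> norm ((matrix_inv X - ?I) ** (X - A)) * norm ?I * c"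
      using c by simp
    also have "\<dots> \<le> (norm (matrix_inv X - ?I) * norm (X - A) * c) * norm ?I * c"
      using c \<open>c > 0\<close> by (intro mult_right_mono) auto
    finally show ?thesis
      by (cases "X = A") (auto simp: field_simps r_def)
  qed
  have "((\<lambda>X. norm (r X) / norm (X - A)) \<longlongrightarrow> 0) (at A)"
  proof (rule tendsto_sandwich[OF _ _ tendsto_const lim])
    show "\<forall>\<^sub>F X in at A. 0 \<le> norm (r X) / norm (X - A)" by simp
    show "\<forall>\<^sub>F X in at A. norm (r X) / norm (X - A) \<le> norm (matrix_inv X - ?I) * c * (norm ?I * c)"
      using ev by eventually_elim (rule bound)
  qed
  moreover have "bounded_linear (\<lambda>H. - (?I ** H ** ?I))"
    by (rule bounded_linear_minus[OF bounded_linear_compose[OF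
        bounded_bilinear.bounded_linear_left[OF bounded_bilinear_matrix_mult]
        bounded_bilinear.bounded_linear_right[OF bounded_bilinear_matrix_mult]]])
  ultimately show ?thesis
    by (simp add: has_derivative_iff_norm r_def)
qed

lemmas has_derivative_matrix_mult = bounded_bilinear.FDERIV[OF bounded_bilinear_matrix_mult]

lemmas has_derivative_cadjoint = bounded_linear.has_derivative[OF bounded_linear_cadjoint]

section \<open>Smooth functions\<close>

lemma dir_deriv_eq: "(f has_derivative f') (at x) \<Longrightarrow> dir_deriv f u x = f' u"
  by (metis frechet_derivative_at)

lemma smooth_on_iff:
  "smooth_on f S \<longleftrightarrow> (\<forall>x\<in>S. f differentiable (at x)) \<and> (\<forall>u. smooth_on (\<lambda>x. dir_deriv f u x) S)"
proof (intro iffI conjI allI)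
  assume L: "smooth_on f S"
  then have "Ck_on (Suc k) f S" for k
    unfolding smooth_on_def by blast
  then show "\<forall>x\<in>S. f differentiable (at x)" "smooth_on (\<lambda>x. dir_deriv f u x) S" for u
    by (auto simp: smooth_on_def)
next
  assume R: "(\<forall>x\<in>S. f differentiable (at x)) \<and> (\<forall>u. smooth_on (\<lambda>x. dir_deriv f u x) S)"
  have "Ck_on k f S" for k
  proof (cases k)
    case 0
    with R show ?thesis
      by (auto intro!: continuous_at_imp_continuous_on differentiable_imp_continuous_within)
  next
    case (Suc j)
    with R show ?thesis by (auto simp: smooth_on_def)
  qed
  then show "smooth_on f S" by (simp add: smooth_on_def)
qed

lemma Ck_on_Suc_imp: "Ck_on (Suc k) f S \<Longrightarrow> Ck_on k f S"
proof (induction k arbitrary: f)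
  case 0
  then show ?case
    by (auto intro!: continuous_at_imp_continuous_on differentiable_imp_continuous_within)
next
  case (Suc k)
  then have "\<forall>x\<in>S. f differentiable (at x)" and "Ck_on (Suc k) (\<lambda>x. frechet_derivative f (at x) u) S" for u
    unfolding Ck_on.simps(2)[of "Suc k"] by blast+
  then show ?case
    by (subst Ck_on.simps(2)) (blast intro: Suc.IH)
qed

lemma Ck_on_cong:
  assumes "open S" and "\<And>x. x \<in> S \<Longrightarrow> f x = g x" and "Ck_on k f S"
  shows "Ck_on k g S"
  using assms(2,3)
proof (induction k arbitrary: f g)
  case 0
  then show ?case by (simp cong: continuous_on_cong)
next
  case (Suc k)
  have der: "(g has_derivative frechet_derivative f (at x)) (at x)" if "x \<in> S" for x
  proof (rule has_derivative_transform_within_open[OF _ \<open>open S\<close> that])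
    show "(f has_derivative frechet_derivative f (at x)) (at x)"
      using Suc.prems(2) that frechet_derivative_works by simp blast
  qed (rule Suc.prems(1))
  show ?case
    unfolding Ck_on.simps
  proof (intro conjI ballI allI)
    fix u
    have "frechet_derivative f (at x) u = frechet_derivative g (at x) u" if "x \<in> S" for x
      using frechet_derivative_at[OF der[OF that]] by simp
    then show "Ck_on k (\<lambda>x. frechet_derivative g (at x) u) S"
      using Suc.IH[of "\<lambda>x. frechet_derivative f (at x) u"] Suc.prems(2) by auto
  qed (use der in \<open>auto simp: differentiable_def\<close>)
qed

lemma Ck_on_Suc_I:
  assumes "open S" and "\<And>x. x \<in> S \<Longrightarrow> (f has_derivative f' x) (at x)"
    and "\<And>u. Ck_on k (\<lambda>x. f' x u) S"
  shows "Ck_on (Suc k) f S"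
  unfolding Ck_on.simps
proof (intro conjI ballI allI)
  fix u
  show "Ck_on k (\<lambda>x. frechet_derivative f (at x) u) S"
    by (rule Ck_on_cong[OF assms(1) _ assms(3)[of u]]) (simp add: dir_deriv_eq[OF assms(2)])
qed (use assms in \<open>auto simp: differentiable_def\<close>)

lemma Ck_on_const: "open S \<Longrightarrow> Ck_on k (\<lambda>x. c) S"
proof (induction k arbitrary: c)
  case (Suc k)
  then show ?case
    by (intro Ck_on_Suc_I[where f' = "\<lambda>x u. 0"]) auto
qed auto

lemma Ck_on_add:
  assumes "open S"
  shows "Ck_on k f S \<Longrightarrow> Ck_on k g S \<Longrightarrow> Ck_on k (\<lambda>x. f x + g x) S"
proof (induction k arbitrary: f g)
  case (Suc k)
  then show ?case
    by (intro Ck_on_Suc_I[OF assms, where f' = "\<lambda>x u. frechet_derivative f (at x) u + frechet_derivative g (at x) u"])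
      (auto intro!: has_derivative_add simp: frechet_derivative_works[symmetric])
qed (auto intro: continuous_intros)

lemma Ck_on_bounded_linear:
  assumes "open S" and L: "bounded_linear L"
  shows "Ck_on k f S \<Longrightarrow> Ck_on k (\<lambda>x. L (f x)) S"
proof (induction k arbitrary: f)
  case 0
  then show ?case by (auto intro: bounded_linear.continuous_on[OF L])
next
  case (Suc k)
  then show ?case
    by (intro Ck_on_Suc_I[OF assms(1), where f' = "\<lambda>x u. L (frechet_derivative f (at x) u)"])
      (auto intro!: bounded_linear.has_derivative[OF L] simp: frechet_derivative_works[symmetric])
qed

lemma Ck_on_bounded_bilinear:
  assumes "open S" and B: "bounded_bilinear B"
  shows "Ck_on k f S \<Longrightarrow> Ck_on k g S \<Longrightarrow> Ck_on k (\<lambda>x. B (f x) (g x)) S"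
proof (induction k arbitrary: f g)
  case 0
  then show ?case by (auto intro: bounded_bilinear.continuous_on[OF B])
next
  case (Suc k)
  then have "Ck_on k f S" "Ck_on k g S"
    by (auto intro: Ck_on_Suc_imp simp del: Ck_on.simps)
  with Suc show ?case
    by (intro Ck_on_Suc_I[OF assms(1), where f' = "\<lambda>x u. B (f x) (frechet_derivative g (at x) u)
            + B (frechet_derivative f (at x) u) (g x)"] Ck_on_add assms)
      (auto intro!: bounded_bilinear.FDERIV[OF B] simp: frechet_derivative_works[symmetric])
qed

text \<open>The derivative of the inverse is a polynomial in the inverse and in the derivative of the given
matrix, so the order of differentiability can be raised step by step.\<close>

lemma Ck_on_matrix_inv:
  fixes F :: "'e::euclidean_space \<Rightarrow> complex^'a^'a"
  assumes "open S" and nz: "\<And>x. x \<in> S \<Longrightarrow> det (F x) \<noteq> 0"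
  shows "Ck_on k F S \<Longrightarrow> Ck_on k (\<lambda>x. matrix_inv (F x)) S"
proof (induction k)
  case 0
  then show ?case by (simp add: continuous_on_matrix_inv nz)
next
  case (Suc k)
  have "Ck_on k (\<lambda>x. matrix_inv (F x)) S"
    using Suc by (auto intro: Ck_on_Suc_imp simp del: Ck_on.simps)
  with Suc show ?case
    by (intro Ck_on_Suc_I[OF assms(1), where f' = "\<lambda>x u. - (matrix_inv (F x) **
          frechet_derivative F (at x) u ** matrix_inv (F x))"] assms
          Ck_on_bounded_linear[OF _ bounded_linear_minus[OF bounded_linear_ident]]
          Ck_on_bounded_bilinear[OF _ bounded_bilinear_matrix_mult])
      (auto intro!: has_derivative_compose[OF _ has_derivative_matrix_inv] nz
        simp: frechet_derivative_works[symmetric])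
qed

lemma smooth_on_const: "open S \<Longrightarrow> smooth_on (\<lambda>x. c) S"
  by (simp add: smooth_on_def Ck_on_const)

lemma smooth_on_ident: "open S \<Longrightarrow> smooth_on (\<lambda>x. x) S"
proof -
  assume S: "open S"
  have "Ck_on k (\<lambda>x. x) S" for k
    by (cases k) (auto simp: S Ck_on_const)
  then show ?thesis by (simp add: smooth_on_def)
qed

lemma smooth_on_add:
  "open S \<Longrightarrow> smooth_on f S \<Longrightarrow> smooth_on g S \<Longrightarrow> smooth_on (\<lambda>x. f x + g x) S"
  by (simp add: smooth_on_def Ck_on_add)

lemma smooth_on_bounded_linear:
  "bounded_linear L \<Longrightarrow> open S \<Longrightarrow> smooth_on f S \<Longrightarrow> smooth_on (\<lambda>x. L (f x)) S"
  by (simp add: smooth_on_def Ck_on_bounded_linear)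

lemma smooth_on_bounded_bilinear:
  "bounded_bilinear B \<Longrightarrow> open S \<Longrightarrow> smooth_on f S \<Longrightarrow> smooth_on g S \<Longrightarrow>
    smooth_on (\<lambda>x. B (f x) (g x)) S"
  by (simp add: smooth_on_def Ck_on_bounded_bilinear)

lemma smooth_on_cong:
  "open S \<Longrightarrow> (\<And>x. x \<in> S \<Longrightarrow> f x = g x) \<Longrightarrow> smooth_on f S \<Longrightarrow> smooth_on g S"
  unfolding smooth_on_def using Ck_on_cong by blast

lemma smooth_on_matrix_inv:
  fixes F :: "'e::euclidean_space \<Rightarrow> complex^'a^'a"
  shows "open S \<Longrightarrow> (\<And>x. x \<in> S \<Longrightarrow> det (F x) \<noteq> 0) \<Longrightarrow> smooth_on F S \<Longrightarrow>
    smooth_on (\<lambda>x. matrix_inv (F x)) S"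
  by (simp add: smooth_on_def Ck_on_matrix_inv)

lemmas smooth_on_matrix_mult = smooth_on_bounded_bilinear[OF bounded_bilinear_matrix_mult]

lemmas smooth_on_cadjoint = smooth_on_bounded_linear[OF bounded_linear_cadjoint]

section \<open>Frames over an affine chart\<close>

lemma sum_UNIV_Plus:
  "(\<Sum>k\<in>(UNIV :: ('m::finite + 'n::finite) set). f k) = (\<Sum>i\<in>UNIV. f (Inl i)) + (\<Sum>r\<in>UNIV. f (Inr r))"
  unfolding UNIV_Plus_UNIV[symmetric] by (subst sum.Plus) auto

definition vstack :: "complex^'k^'m \<Rightarrow> complex^'k^'n \<Rightarrow> complex^'k^('m::finite + 'n::finite)" where
  "vstack X Y = (\<chi> i. case i of Inl a \<Rightarrow> X $ a | Inr b \<Rightarrow> Y $ b)"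

definition upper :: "complex^'k^('m::finite + 'n::finite) \<Rightarrow> complex^'k^'m" where
  "upper M = (\<chi> i. M $ Inl i)"

definition lower :: "complex^'k^('m::finite + 'n::finite) \<Rightarrow> complex^'k^'n" where
  "lower M = (\<chi> i. M $ Inr i)"

lemma vstack_nth [simp]: "vstack X Y $ Inl a = X $ a" "vstack X Y $ Inr b = Y $ b"
  by (simp_all add: vstack_def)

lemma vstack_upper_lower: "vstack (upper M) (lower M) = M"
  by (auto simp: vec_eq_iff vstack_def upper_def lower_def split: sum.split)

lemma upper_vstack [simp]: "upper (vstack X Y) = X"
  and lower_vstack [simp]: "lower (vstack X Y) = Y"
  by (simp_all add: vec_eq_iff upper_def lower_def)

lemma vstack_eqI: "upper M = upper N \<Longrightarrow> lower M = lower N \<Longrightarrow> M = N"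
  by (metis vstack_upper_lower)

lemma upper_mult: "upper (M ** Z) = upper M ** Z"
  and lower_mult: "lower (M ** Z) = lower M ** Z"
  by (simp_all add: vec_eq_iff upper_def lower_def matrix_matrix_mult_def)

lemma vstack_mult: "vstack X Y ** Z = vstack (X ** Z) (Y ** Z)"
  by (rule vstack_eqI) (simp_all add: upper_mult lower_mult)

lemma cadjoint_vstack_mult:
  "cadjoint (vstack X Y) ** vstack X' Y' = cadjoint X ** X' + cadjoint Y ** Y'"
  by (simp add: vec_eq_iff matrix_matrix_mult_def cadjoint_def sum_UNIV_Plus)

lemma bounded_linear_upper: "bounded_linear (upper :: complex^'k^('m::finite + 'n::finite) \<Rightarrow> _)"
  and bounded_linear_lower: "bounded_linear (lower :: complex^'k^('m::finite + 'n::finite) \<Rightarrow> _)"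
  unfolding linear_conv_bounded_linear[symmetric]
  by (auto intro!: linearI simp: upper_def lower_def vec_eq_iff)

lemma upper_lower_add [simp]:
  "upper (M + N) = upper M + upper N" "lower (M + N) = lower M + lower N"
  by (simp_all add: vec_eq_iff upper_def lower_def)

lemma vstack_add: "vstack X Y + vstack X' Y' = vstack (X + X') (Y + Y')"
  by (rule vstack_eqI) simp_all

lemma bounded_linear_vstack_0:
  "bounded_linear (\<lambda>Y. vstack 0 Y :: complex^'k^('m::finite + 'n::finite))"
  "bounded_linear (\<lambda>X. vstack X 0 :: complex^'k^('m::finite + 'n::finite))"
  unfolding linear_conv_bounded_linear[symmetric]
  by (auto intro!: linearI vstack_eqI simp: upper_def lower_def vec_eq_iff)

text \<open>The quadratic form of the matrix at \<open>x\<close> is \<open>\<bar>x\<bar>\<^sup>2 + \<bar>W x\<bar>\<^sup>2\<close>.\<close>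

lemma det_one_plus_cadjoint_mult:
  fixes W :: "complex^'m^'n"
  shows "det (mat 1 + cadjoint W ** W) \<noteq> 0"
proof -
  have "x = 0" if "(mat 1 + cadjoint W ** W) *v x = 0" for x
  proof -
    define y where "y = W *v x"
    have "(\<Sum>i\<in>UNIV. cnj (x $ i) * ((mat 1 + cadjoint W ** W) *v x) $ i)
      = (\<Sum>i\<in>UNIV. cnj (x $ i) * x $ i) + (\<Sum>i\<in>UNIV. cnj (x $ i) * (cadjoint W *v y) $ i)"
      by (simp add: y_def matrix_vector_mult_add_rdistrib matrix_vector_mul_assoc
          sum.distrib algebra_simps)
    also have "(\<Sum>i\<in>UNIV. cnj (x $ i) * (cadjoint W *v y) $ i) = (\<Sum>r\<in>UNIV. cnj (y $ r) * y $ r)"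
      unfolding y_def
      by (simp add: matrix_vector_mult_def cadjoint_def sum_distrib_left sum_distrib_right mult_ac)
        (subst sum.swap, simp add: sum_distrib_left sum_distrib_right mult_ac)
    also have "(\<Sum>i\<in>UNIV. cnj (x $ i) * x $ i) + (\<Sum>r\<in>UNIV. cnj (y $ r) * y $ r)
       = of_real ((\<Sum>i\<in>UNIV. (cmod (x $ i))\<^sup>2) + (\<Sum>r\<in>UNIV. (cmod (y $ r))\<^sup>2))"
      by (simp add: complex_norm_square mult.commute flip: of_real_power)
    finally have "(\<Sum>i\<in>UNIV. (cmod (x $ i))\<^sup>2) + (\<Sum>r\<in>UNIV. (cmod (y $ r))\<^sup>2) = 0"
      using that by (simp flip: of_real_add)
    moreover have "(\<Sum>i\<in>UNIV. (cmod (x $ i))\<^sup>2) \<ge> 0" "(\<Sum>r\<in>UNIV. (cmod (y $ r))\<^sup>2) \<ge> 0"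
      by (simp_all add: sum_nonneg)
    ultimately have "(\<Sum>i\<in>UNIV. (cmod (x $ i))\<^sup>2) = 0"
      by linarith
    then show ?thesis
      by (simp add: sum_nonneg_eq_0_iff vec_eq_iff)
  qed
  then show ?thesis
    by (metis invertible_det_nz invertible_left_inverse matrix_left_invertible_ker)
qed

text \<open>\<open>frameC\<close> and \<open>frameK\<close> have as columns the frames of the plane and of its complement, and \<open>dualC\<close>
and \<open>dualK\<close> have as columns the dual frames of the same two spaces with respect to the Hermitian
inner product.\<close>

definition frameC :: "complex^('m + 'n)^('m + 'n) \<Rightarrow> complex^'m^'n \<Rightarrow> complex^'m::finite^('m + 'n::finite)" where
  "frameC A W = A ** vstack (mat 1) W"

definition frameK :: "complex^('m + 'n)^('m + 'n) \<Rightarrow> complex^'m^'n \<Rightarrow> complex^'n::finite^('m::finite + 'n)" where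
  "frameK A W = A ** vstack (- cadjoint W) (mat 1)"

definition gramC_inv :: "complex^'m^'n \<Rightarrow> complex^'m^'m" where
  "gramC_inv W = matrix_inv (mat 1 + cadjoint W ** W)"

definition gramK_inv :: "complex^'m^'n \<Rightarrow> complex^'n^'n" where
  "gramK_inv W = matrix_inv (mat 1 + W ** cadjoint W)"

definition dualC :: "complex^('m + 'n)^('m + 'n) \<Rightarrow> complex^'m^'n \<Rightarrow> complex^'m::finite^('m + 'n::finite)" where
  "dualC A W = frameC A W ** gramC_inv W"

definition dualK :: "complex^('m + 'n)^('m + 'n) \<Rightarrow> complex^'m^'n \<Rightarrow> complex^'n::finite^('m::finite + 'n)" where
  "dualK A W = frameK A W ** gramK_inv W"

text \<open>The connection forms of both bundles, and with them the Christoffel symbols, are products of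
  this matrix with the coordinate differentials.\<close>

definition slope :: "complex^'m^'n \<Rightarrow> complex^'n^'m" where
  "slope W = gramC_inv W ** cadjoint W"

lemma gramC_inv:
  shows gramC_inv_left: "gramC_inv W + gramC_inv W ** cadjoint W ** W = mat 1"
    and gramC_inv_right: "gramC_inv W + cadjoint W ** W ** gramC_inv W = mat 1"
  using matrix_inv_left[OF det_one_plus_cadjoint_mult[of W]]
    matrix_inv_right[OF det_one_plus_cadjoint_mult[of W]]
  by (simp_all add: gramC_inv_def matrix_mult_expand)

lemma gramK_inv:
  shows gramK_inv_left: "gramK_inv W + gramK_inv W ** W ** cadjoint W = mat 1"
    and gramK_inv_right: "gramK_inv W + W ** cadjoint W ** gramK_inv W = mat 1"
  using matrix_inv_left[OF det_one_plus_cadjoint_mult[of "cadjoint W"]]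
    matrix_inv_right[OF det_one_plus_cadjoint_mult[of "cadjoint W"]]
  by (simp_all add: gramK_inv_def matrix_mult_expand)

lemma cadjoint_matrix_inv:
  fixes A :: "complex^'a^'a"
  assumes "det A \<noteq> 0" "cadjoint A = A"
  shows "cadjoint (matrix_inv A) = matrix_inv A"
proof -
  have "A ** cadjoint (matrix_inv A) = cadjoint (matrix_inv A ** A)"
    by (simp add: cadjoint_mult assms)
  also have "\<dots> = mat 1"
    using assms by (simp add: matrix_inv_left)
  finally show ?thesis
    by (rule matrix_inv_unique[symmetric])
qed

lemma cadjoint_gramC_inv [simp]: "cadjoint (gramC_inv W) = gramC_inv W"
  unfolding gramC_inv_def
  by (intro cadjoint_matrix_inv det_one_plus_cadjoint_mult) (simp add: cadjoint_mult)

lemma cadjoint_gramK_inv [simp]: "cadjoint (gramK_inv W) = gramK_inv W"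
  unfolding gramK_inv_def
  using det_one_plus_cadjoint_mult[of "cadjoint W"]
  by (intro cadjoint_matrix_inv) (simp_all add: cadjoint_mult)

text \<open>The push-through identity. It makes the connection terms of the two bundles match.\<close>

lemma slope_eq: "slope W = cadjoint W ** gramK_inv W"
proof -
  have "gramC_inv W ** cadjoint W
    = gramC_inv W ** cadjoint W ** (gramK_inv W + W ** cadjoint W ** gramK_inv W)"
    by (simp add: gramK_inv_right)
  also have "\<dots> = (gramC_inv W + gramC_inv W ** cadjoint W ** W) ** cadjoint W ** gramK_inv W"
    by (simp add: matrix_mult_expand)
  also have "\<dots> = cadjoint W ** gramK_inv W"
    by (simp add: gramC_inv_left)
  finally show ?thesis
    by (simp add: slope_def)
qed

lemma cadjoint_slope:
  "cadjoint (slope W) = W ** gramC_inv W" "cadjoint (slope W) = gramK_inv W ** W"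
  by (simp add: slope_def cadjoint_mult) (simp add: slope_eq cadjoint_mult)

lemma unitary_cancel:
  assumes "unitary A"
  shows "cadjoint X ** cadjoint A ** A ** Y = cadjoint X ** Y"
  using assms by (metis unitary_def matrix_mul_assoc matrix_mul_rid)

lemma unitary_right: "unitary A \<Longrightarrow> A ** cadjoint A = mat 1"
  by (simp add: unitary_def matrix_left_right_inverse)

context
  fixes A :: "complex^('m::finite + 'n::finite)^('m + 'n)"
  assumes A: "unitary A"
begin

lemma gram_frames:
  "cadjoint (frameC A W) ** frameC A W = mat 1 + cadjoint W ** W"
  "cadjoint (frameK A W) ** frameK A W = mat 1 + W ** cadjoint W"
  "cadjoint (frameK A W) ** frameC A W = 0"
  "cadjoint (frameC A W) ** frameK A W = 0"
  by (simp_all add: frameC_def frameK_def cadjoint_mult matrix_mul_assoc unitary_cancel[OF A]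
      cadjoint_vstack_mult matrix_mult_expand)

lemma frame_dual:
  "cadjoint (dualC A W) ** frameC A W = mat 1"
  "cadjoint (frameC A W) ** dualC A W = mat 1"
  "cadjoint (dualK A W) ** frameK A W = mat 1"
  "cadjoint (frameK A W) ** dualK A W = mat 1"
  by (simp_all add: dualC_def dualK_def cadjoint_mult matrix_mul_assoc gram_frames
      matrix_mul_assoc[symmetric, of "gramC_inv W"] matrix_mul_assoc[symmetric, of "gramK_inv W"])
    (simp_all add: matrix_mult_expand gramC_inv gramK_inv)

lemma dual_dual:
  "cadjoint (dualC A W) ** dualC A W = gramC_inv W"
  "cadjoint (dualK A W) ** dualK A W = gramK_inv W"
  "cadjoint (dualC A W) ** dualK A W = 0"
  "cadjoint (dualK A W) ** dualC A W = 0"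
proof -
  show "cadjoint (dualC A W) ** dualC A W = gramC_inv W" "cadjoint (dualK A W) ** dualK A W = gramK_inv W"
    by (subst (2) dualC_def dualK_def, simp add: matrix_mul_assoc frame_dual)+
  show "cadjoint (dualC A W) ** dualK A W = 0" "cadjoint (dualK A W) ** dualC A W = 0"
    by (simp_all add: dualC_def dualK_def cadjoint_mult matrix_mul_assoc gram_frames
      matrix_mul_assoc[symmetric, of "gramC_inv W"] matrix_mul_assoc[symmetric, of "gramK_inv W"])
qed

text \<open>The two orthogonal projections add up to the identity; this is what allows derivatives of the
frames to be split into tangential and normal parts.\<close>

lemma frames_complete:
  "dualC A W ** cadjoint (frameC A W) + dualK A W ** cadjoint (frameK A W) = mat 1"
proof -
  let ?u = "gramC_inv W" and ?q = "gramK_inv W" and ?W = "cadjoint W"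
  define E where "E = vstack (mat 1) W ** ?u ** cadjoint (vstack (mat 1) W)
    + vstack (- ?W) (mat 1) ** ?q ** cadjoint (vstack (- ?W) (mat 1))"
  have "E ** vstack X Y = vstack X Y" for X :: "complex^('m + 'n)^'m" and Y :: "complex^('m + 'n)^'n"
  proof -
    have "E ** vstack X Y = vstack (mat 1) W ** (?u ** (X + ?W ** Y)) + vstack (- ?W) (mat 1) ** (?q ** (Y - W ** X))"
      unfolding E_def matrix_mult_left_distrib
      by (simp only: matrix_mul_assoc[symmetric] cadjoint_vstack_mult) (simp add: matrix_mult_left_distrib)
    also have "\<dots> = vstack (?u ** X + (?u ** ?W) ** Y - (?W ** ?q) ** Y + (?W ** ?q) ** W ** X)
       ((W ** ?u) ** X + W ** (?u ** ?W) ** Y + ?q ** Y - (?q ** W) ** X)"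
      by (simp add: vstack_mult vstack_add matrix_mult_expand algebra_simps)
    also have "\<dots> = vstack ((?u + ?u ** ?W ** W) ** X) ((?q + W ** ?W ** ?q) ** Y)"
      unfolding slope_def[symmetric] slope_eq[symmetric] cadjoint_slope[symmetric]
      unfolding slope_eq matrix_mult_left_distrib
      by (simp add: slope_eq[symmetric] slope_def matrix_mul_assoc)
         (simp add: slope_eq[unfolded slope_def] matrix_mul_assoc[symmetric] add.commute)
    also have "\<dots> = vstack X Y"
      by (simp add: gramC_inv gramK_inv)
    finally show ?thesis .
  qed
  from this[of "upper (mat 1)" "lower (mat 1)"] have "E = mat 1"
    by (simp add: vstack_upper_lower)
  have "dualC A W ** cadjoint (frameC A W) + dualK A W ** cadjoint (frameK A W) = A ** E ** cadjoint A"
    by (simp add: E_def dualC_def dualK_def frameC_def frameK_def cadjoint_mult matrix_mult_expand)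
  also have "\<dots> = mat 1"
    by (simp add: \<open>E = mat 1\<close> unitary_right[OF A])
  finally show ?thesis .
qed

lemma frame_transform:
  "cadjoint (frameC A W) ** (A ** vstack X Y) = X + cadjoint W ** Y"
  "cadjoint (frameK A W) ** (A ** vstack X Y) = Y - W ** X"
  by (simp_all add: frameC_def frameK_def cadjoint_mult matrix_mul_assoc unitary_cancel[OF A]
      cadjoint_vstack_mult matrix_mult_left_distrib)

text \<open>The constant vector \<open>A (0; X)\<close> is resolved into its parts in the plane and in the complement.\<close>

lemma has_derivative_frameC:
  "(frameC A has_derivative (\<lambda>X. frameC A W ** slope W ** X + dualK A W ** X)) (at W)"
proof -
  have split: "A ** vstack 0 X = frameC A W ** slope W ** X + dualK A W ** X" for X :: "complex^'m^'n"
  proof -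
    have "A ** vstack 0 X
      = (dualC A W ** cadjoint (frameC A W) + dualK A W ** cadjoint (frameK A W)) ** (A ** vstack 0 X)"
      by (simp only: frames_complete matrix_mul_lid)
    also have "\<dots> = dualC A W ** (cadjoint (frameC A W) ** (A ** vstack 0 X))
        + dualK A W ** (cadjoint (frameK A W) ** (A ** vstack 0 X))"
      by (simp only: matrix_mult_left_distrib matrix_mul_assoc)
    also have "\<dots> = dualC A W ** (cadjoint W ** X) + dualK A W ** X"
      by (simp add: frame_transform)
    finally show ?thesis
      by (simp add: dualC_def slope_def matrix_mul_assoc)
  qed
  have "frameC A = (\<lambda>W. A ** (vstack (mat 1) 0 + vstack 0 W))"
    by (auto simp: frameC_def vstack_add)
  moreover have "((\<lambda>W. A ** (vstack (mat 1) 0 + vstack 0 W)) has_derivative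
      (\<lambda>X. A ** (0 + vstack 0 X) + 0 ** (vstack (mat 1) 0 + vstack 0 W))) (at W)"
    by (intro has_derivative_matrix_mult has_derivative_add has_derivative_const
        bounded_linear_imp_has_derivative bounded_linear_vstack_0)
  ultimately show ?thesis
    by (simp add: split)
qed

lemma has_derivative_frameK:
  "(frameK A has_derivative (\<lambda>X. frameK A W ** cadjoint (slope W) ** cadjoint X - dualC A W ** cadjoint X)) (at W)"
proof -
  have split: "A ** vstack (- Y) 0 = dualK A W ** W ** Y - dualC A W ** Y" for Y :: "complex^'n^'m"
  proof -
    have "A ** vstack (- Y) 0
      = (dualC A W ** cadjoint (frameC A W) + dualK A W ** cadjoint (frameK A W)) ** (A ** vstack (- Y) 0)"
      by (simp only: frames_complete matrix_mul_lid)
    also have "\<dots> = dualC A W ** (cadjoint (frameC A W) ** (A ** vstack (- Y) 0))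
        + dualK A W ** (cadjoint (frameK A W) ** (A ** vstack (- Y) 0))"
      by (simp only: matrix_mult_left_distrib matrix_mul_assoc)
    also have "\<dots> = dualC A W ** - Y + dualK A W ** (W ** Y)"
      by (simp only: frame_transform) (simp add: matrix_mult_expand)
    finally show ?thesis
      by (simp add: matrix_mult_expand)
  qed
  have "frameK A = (\<lambda>W. A ** (vstack (- cadjoint W) 0 + vstack 0 (mat 1)))"
    by (auto simp: frameK_def vstack_add)
  moreover have "((\<lambda>W. A ** (vstack (- cadjoint W) 0 + vstack 0 (mat 1))) has_derivative
      (\<lambda>X. A ** (vstack (- cadjoint X) 0 + 0) + 0 ** (vstack (- cadjoint W) 0 + vstack 0 (mat 1)))) (at W)"
    by (intro has_derivative_matrix_mult has_derivative_add has_derivative_const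
        bounded_linear.has_derivative[OF bounded_linear_vstack_0(2)] has_derivative_minus has_derivative_cadjoint
        has_derivative_ident)
  ultimately show ?thesis
    by (simp add: split dualK_def cadjoint_slope(2) matrix_mul_assoc)
qed

end

lemma has_derivative_gramC_inv:
  "(gramC_inv has_derivative
     (\<lambda>X. - (gramC_inv W ** cadjoint X ** cadjoint (slope W)) - slope W ** X ** gramC_inv W)) (at W)"
proof -
  have "((\<lambda>W. mat 1 + cadjoint W ** W) has_derivative (\<lambda>X. 0 + (cadjoint W ** X + cadjoint X ** W))) (at W)"
    by (intro has_derivative_add has_derivative_matrix_mult has_derivative_cadjoint has_derivative_ident has_derivative_const)
  note D = has_derivative_compose[OF this has_derivative_matrix_inv[OF det_one_plus_cadjoint_mult]]
  show ?thesis
    by (rule has_derivative_eq_rhs[OF D[unfolded gramC_inv_def[symmetric]]])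
      (simp add: slope_def cadjoint_mult matrix_mult_expand fun_eq_iff)
qed

lemma has_derivative_gramK_inv:
  "(gramK_inv has_derivative
     (\<lambda>X. - (gramK_inv W ** X ** slope W) - cadjoint (slope W) ** cadjoint X ** gramK_inv W)) (at W)"
proof -
  have "((\<lambda>W. mat 1 + W ** cadjoint W) has_derivative (\<lambda>X. 0 + (W ** cadjoint X + X ** cadjoint W))) (at W)"
    by (intro has_derivative_add has_derivative_matrix_mult has_derivative_cadjoint has_derivative_ident has_derivative_const)
  note D = has_derivative_compose[OF this has_derivative_matrix_inv]
  show ?thesis
    by (rule has_derivative_eq_rhs[OF D[unfolded gramK_inv_def[symmetric]]])
      (use det_one_plus_cadjoint_mult[of "cadjoint W"] in
        \<open>simp_all add: slope_eq cadjoint_mult matrix_mult_expand fun_eq_iff\<close>)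
qed

lemma has_derivative_slope:
  "(slope has_derivative (\<lambda>X. gramC_inv W ** cadjoint X ** gramK_inv W - slope W ** X ** slope W)) (at W)"
proof -
  have [simp]: "mat 1 - cadjoint (slope W) ** cadjoint W = gramK_inv W"
    using gramK_inv_left[of W] by (simp add: cadjoint_slope(2) algebra_simps)
  have D: "((\<lambda>W. gramC_inv W ** cadjoint W) has_derivative (\<lambda>X. gramC_inv W ** cadjoint X
     + (- (gramC_inv W ** cadjoint X ** cadjoint (slope W)) - slope W ** X ** gramC_inv W) ** cadjoint W)) (at W)"
    by (intro has_derivative_matrix_mult has_derivative_gramC_inv has_derivative_cadjoint has_derivative_ident)
  have "gramC_inv W ** cadjoint X
     + (- (gramC_inv W ** cadjoint X ** cadjoint (slope W)) - slope W ** X ** gramC_inv W) ** cadjoint W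
    = gramC_inv W ** cadjoint X ** (mat 1 - cadjoint (slope W) ** cadjoint W) - slope W ** X ** slope W" for X
    unfolding matrix_mult_left_distrib matrix_mult_right_distrib
    by (simp add: slope_def matrix_mul_assoc)
  then have "gramC_inv W ** cadjoint X
     + (- (gramC_inv W ** cadjoint X ** cadjoint (slope W)) - slope W ** X ** gramC_inv W) ** cadjoint W
    = gramC_inv W ** cadjoint X ** gramK_inv W - slope W ** X ** slope W" for X
    by simp
  then show ?thesis
    using has_derivative_eq_rhs[OF D] by (simp add: slope_def[abs_def, symmetric])
qed

section \<open>Tangent vectors as matrices and their covariant derivative\<close>

text \<open>The tangent vector with coordinates \<open>X\<close>, an element of the homomorphisms from the plane to its
complement, extended by zero to a square matrix. Products of such matrices with each other and with
\<open>\<gamma>\<close> are then always defined.\<close>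

definition tan_op :: "complex^('m + 'n)^('m + 'n) \<Rightarrow> complex^'m^'n \<Rightarrow> complex^'m^'n \<Rightarrow>
    complex^('m::finite + 'n::finite)^('m + 'n)" where
  "tan_op A W X = dualK A W ** X ** cadjoint (dualC A W)"

definition proj :: "complex^('m + 'n)^('m + 'n) \<Rightarrow> complex^'m^'n \<Rightarrow>
    complex^('m::finite + 'n::finite)^('m + 'n)" where
  "proj A W = dualC A W ** cadjoint (frameC A W)"

text \<open>The Christoffel symbols of the metric; \<open>christoffel_fs_metric\<close> identifies them.\<close>

definition chris :: "complex^'m^'n \<Rightarrow> complex^'m^'n \<Rightarrow> complex^'m^'n \<Rightarrow> complex^'m^'n" where
  "chris W X Y = - (X ** slope W ** Y + Y ** slope W ** X)"

lemma bounded_linear_tan_op: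
  "bounded_linear (tan_op A W :: complex^'m::finite^'n::finite \<Rightarrow> _)"
  unfolding tan_op_def[abs_def]
  by (rule bounded_linear_compose[OF
      bounded_bilinear.bounded_linear_left[OF bounded_bilinear_matrix_mult]
      bounded_bilinear.bounded_linear_right[OF bounded_bilinear_matrix_mult]])

lemmas tan_op_linear =
  linear_add[OF bounded_linear.linear[OF bounded_linear_tan_op]]
  linear_diff[OF bounded_linear.linear[OF bounded_linear_tan_op]]
  linear_neg[OF bounded_linear.linear[OF bounded_linear_tan_op]]
  linear_0[OF bounded_linear.linear[OF bounded_linear_tan_op]]
  linear_cmul[OF bounded_linear.linear[OF bounded_linear_tan_op]]

lemma cadjoint_tan_op: "cadjoint (tan_op A W X) = dualC A W ** cadjoint X ** cadjoint (dualK A W)"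
  by (simp add: tan_op_def cadjoint_mult matrix_mul_assoc)

lemma proj_eq: "proj A W = frameC A W ** cadjoint (dualC A W)"
  by (simp add: proj_def dualC_def cadjoint_mult matrix_mul_assoc)

lemma cadjoint_proj [simp]: "cadjoint (proj A W) = proj A W"
  by (subst proj_def) (simp add: proj_eq cadjoint_mult)

lemma chris_commute: "chris W X Y = chris W Y X"
  by (simp add: chris_def add.commute)

context
  fixes A :: "complex^('m::finite + 'n::finite)^('m + 'n)"
  assumes A: "unitary A"
begin

lemma has_derivative_dualC:
  "(dualC A has_derivative (\<lambda>X. dualK A W ** X ** gramC_inv W
      - dualC A W ** cadjoint X ** cadjoint (slope W))) (at W)"
  unfolding dualC_def[abs_def]
  by (rule has_derivative_eq_rhs, rule has_derivative_matrix_mult,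
      rule has_derivative_frameC[OF A], rule has_derivative_gramC_inv)
    (simp add: fun_eq_iff matrix_mult_expand)

lemma has_derivative_dualK:
  "(dualK A has_derivative (\<lambda>X. - (dualC A W ** cadjoint X ** gramK_inv W)
      - dualK A W ** X ** slope W)) (at W)"
  unfolding dualK_def[abs_def]
  by (rule has_derivative_eq_rhs, rule has_derivative_matrix_mult,
      rule has_derivative_frameK[OF A], rule has_derivative_gramK_inv)
    (simp add: fun_eq_iff matrix_mult_expand)

lemma has_derivative_proj:
  "(proj A has_derivative (\<lambda>X. tan_op A W X + cadjoint (tan_op A W X))) (at W)"
proof -
  have [simp]: "gramC_inv W ** cadjoint (frameC A W) = cadjoint (dualC A W)"
    by (simp add: dualC_def cadjoint_mult)
  have "(proj A has_derivative (\<lambda>X.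
      dualC A W ** cadjoint (frameC A W ** slope W ** X + dualK A W ** X)
      + (dualK A W ** X ** gramC_inv W - dualC A W ** cadjoint X ** cadjoint (slope W))
        ** cadjoint (frameC A W))) (at W)"
    unfolding proj_def[abs_def]
    by (intro has_derivative_matrix_mult has_derivative_dualC has_derivative_cadjoint
        has_derivative_frameC[OF A])
  then show ?thesis
    by (rule has_derivative_eq_rhs)
      (simp add: fun_eq_iff tan_op_def cadjoint_mult matrix_mult_expand
        matrix_mul_assoc[symmetric, of _ "gramC_inv W"])
qed

text \<open>The chart enters only through the term with the Christoffel symbols; what remains is the
  commutator of the two tangent vectors.\<close>

lemma has_derivative_tan_op:
  "((\<lambda>W. tan_op A W v) has_derivative (\<lambda>X. tan_op A W (chris W X v)
      + (tan_op A W v ** cadjoint (tan_op A W X) - cadjoint (tan_op A W X) ** tan_op A W v))) (at W)"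
proof -
  have "((\<lambda>W. tan_op A W v) has_derivative (\<lambda>X.
      dualK A W ** v ** cadjoint (dualK A W ** X ** gramC_inv W
        - dualC A W ** cadjoint X ** cadjoint (slope W))
      + (dualK A W ** 0 + (- (dualC A W ** cadjoint X ** gramK_inv W) - dualK A W ** X ** slope W) ** v)
        ** cadjoint (dualC A W))) (at W)"
    unfolding tan_op_def
    by (intro has_derivative_matrix_mult has_derivative_dualC has_derivative_dualK
        has_derivative_cadjoint has_derivative_const)
  then show ?thesis
  proof (rule has_derivative_eq_rhs, intro ext)
    fix X
    have 1: "tan_op A W v ** cadjoint (tan_op A W X)
      = dualK A W ** v ** gramC_inv W ** cadjoint X ** cadjoint (dualK A W)"
      unfolding cadjoint_tan_op unfolding tan_op_def
      by (simp add: dual_dual[OF A, symmetric] matrix_mul_assoc)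
    have 2: "cadjoint (tan_op A W X) ** tan_op A W v
      = dualC A W ** cadjoint X ** gramK_inv W ** v ** cadjoint (dualC A W)"
      unfolding cadjoint_tan_op unfolding tan_op_def
      by (simp add: dual_dual[OF A, symmetric] matrix_mul_assoc)
    show "dualK A W ** v ** cadjoint (dualK A W ** X ** gramC_inv W
        - dualC A W ** cadjoint X ** cadjoint (slope W))
      + (dualK A W ** 0 + (- (dualC A W ** cadjoint X ** gramK_inv W) - dualK A W ** X ** slope W) ** v)
        ** cadjoint (dualC A W) = tan_op A W (chris W X v)
      + (tan_op A W v ** cadjoint (tan_op A W X) - cadjoint (tan_op A W X) ** tan_op A W v)"
      unfolding 1 2 by (simp add: tan_op_def chris_def cadjoint_mult matrix_mult_expand)
  qed
qed

lemma tan_op_mult_0 [simp]: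
  "tan_op A W X ** tan_op A W Y = 0"
  "M ** tan_op A W X ** tan_op A W Y = 0"
  "cadjoint (tan_op A W X) ** cadjoint (tan_op A W Y) = 0"
  "M ** cadjoint (tan_op A W X) ** cadjoint (tan_op A W Y) = 0"
proof -
  show 1: "tan_op A W X ** tan_op A W Y = 0" for X Y
  proof -
    have "tan_op A W X ** tan_op A W Y
      = dualK A W ** X ** (cadjoint (dualC A W) ** dualK A W) ** Y ** cadjoint (dualC A W)"
      by (simp add: tan_op_def matrix_mul_assoc)
    then show ?thesis
      by (simp only: dual_dual[OF A]) simp
  qed
  show 2: "cadjoint (tan_op A W X) ** cadjoint (tan_op A W Y) = 0" for X Y
    by (simp add: 1 flip: cadjoint_mult)
  show "M ** tan_op A W X ** tan_op A W Y = 0"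
    "M ** cadjoint (tan_op A W X) ** cadjoint (tan_op A W Y) = 0"
    by (simp_all add: 1 2 flip: matrix_mul_assoc)
qed

lemma proj_tan_op [simp]:
  "tan_op A W X ** proj A W = tan_op A W X"
  "proj A W ** tan_op A W X = 0"
  "cadjoint (tan_op A W X) ** proj A W = 0"
  "proj A W ** cadjoint (tan_op A W X) = cadjoint (tan_op A W X)"
proof -
  have "tan_op A W X ** proj A W
    = dualK A W ** X ** (cadjoint (dualC A W) ** frameC A W) ** cadjoint (dualC A W)"
    by (simp add: tan_op_def proj_eq matrix_mul_assoc)
  then show 1: "tan_op A W X ** proj A W = tan_op A W X"
    by (simp only: frame_dual[OF A]) (simp add: tan_op_def)
  have "proj A W ** tan_op A W X
    = frameC A W ** (cadjoint (dualC A W) ** dualK A W) ** X ** cadjoint (dualC A W)"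
    by (simp add: tan_op_def proj_eq matrix_mul_assoc)
  then show 2: "proj A W ** tan_op A W X = 0"
    by (simp only: dual_dual[OF A]) simp
  show "cadjoint (tan_op A W X) ** proj A W = 0"
    by (metis 2 cadjoint_mult cadjoint_proj cadjoint_linear(4))
  show "proj A W ** cadjoint (tan_op A W X) = cadjoint (tan_op A W X)"
    by (metis 1 cadjoint_mult cadjoint_proj)
qed

lemma one_minus_proj: "mat 1 - proj A W = dualK A W ** cadjoint (frameK A W)"
  using frames_complete[OF A, of W] by (simp add: proj_def algebra_simps)

lemma trace_proj: "trace (proj A W) = of_nat CARD('m)"
  unfolding proj_def by (subst trace_mul_sym) (simp add: frame_dual[OF A] trace_I)

lemma trace_one_minus_proj: "trace (mat 1 - proj A W) = of_nat CARD('n)"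
  unfolding one_minus_proj by (subst trace_mul_sym) (simp add: frame_dual[OF A] trace_I)

lemma frames_recover: "cadjoint (frameK A W) ** tan_op A W X ** frameC A W = X"
proof -
  have "cadjoint (frameK A W) ** tan_op A W X ** frameC A W
    = (cadjoint (frameK A W) ** dualK A W) ** X ** (cadjoint (dualC A W) ** frameC A W)"
    by (simp add: tan_op_def matrix_mul_assoc)
  then show ?thesis
    by (simp only: frame_dual[OF A]) simp
qed

end

section \<open>The real trace form\<close>

definition reTr :: "complex^'a^'a::finite \<Rightarrow> real" where
  "reTr X = Re (trace X)"

lemma bounded_linear_reTr: "bounded_linear (reTr :: complex^'a^'a \<Rightarrow> real)"
  unfolding linear_conv_bounded_linear[symmetric]
  by (auto intro!: linearI simp: reTr_def trace_def sum.distrib sum_distrib_left)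

lemmas reTr_linear [simp] =
  linear_add[OF bounded_linear.linear[OF bounded_linear_reTr]]
  linear_diff[OF bounded_linear.linear[OF bounded_linear_reTr]]
  linear_neg[OF bounded_linear.linear[OF bounded_linear_reTr]]
  linear_0[OF bounded_linear.linear[OF bounded_linear_reTr]]
  linear_cmul[OF bounded_linear.linear[OF bounded_linear_reTr]]

lemmas has_derivative_reTr = bounded_linear.has_derivative[OF bounded_linear_reTr]

lemma reTr_mult_commute: "reTr (X ** Y) = reTr (Y ** X)"
  unfolding reTr_def by (subst trace_mul_sym) (rule refl)

lemma reTr_cadjoint [simp]: "reTr (cadjoint X) = reTr X"
  by (simp add: reTr_def trace_cadjoint)

lemma inner_eq_reTr: "X \<bullet> Y = reTr (X ** cadjoint Y)"
  by (simp add: reTr_def trace_def inner_vec_def matrix_matrix_mult_def cadjoint_def inner_complex_def)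

lemma sum_Basis_vec:
  "(\<Sum>j\<in>(Basis :: ('a::euclidean_space^'n) set). f j) = (\<Sum>i\<in>UNIV. \<Sum>b\<in>Basis. f (axis i b))"
proof -
  have B: "Basis = (\<lambda>(i, b). axis i b) ` ((UNIV :: 'n set) \<times> (Basis :: 'a set))"
    by (auto simp: Basis_vec_def)
  have "inj_on (\<lambda>(i, b). axis i b) ((UNIV :: 'n set) \<times> (Basis :: 'a set))"
    by (auto simp: inj_on_def axis_eq_axis nonzero_Basis)
  from sum.reindex[OF this, of f] have "(\<Sum>j\<in>(Basis :: ('a^'n) set). f j)
      = (\<Sum>(i, b)\<in>(UNIV :: 'n set) \<times> (Basis :: 'a set). f (axis i b))"
    unfolding B by (simp add: comp_def split_def)
  then show ?thesis
    by (simp add: sum.cartesian_product)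
qed

lemma axis_axis_mult:
  fixes X :: "complex^'c^'m::finite"
  shows "(axis r (axis s b) ** X) $ a $ c = (if a = r then b * X $ s $ c else 0)"
proof -
  have "(\<Sum>k\<in>UNIV. axis r (axis s b) $ a $ k * X $ k $ c)
      = (\<Sum>k\<in>UNIV. if k = s then (if a = r then b * X $ s $ c else 0) else 0)"
    by (rule sum.cong) (auto simp: axis_def)
  then show ?thesis
    by (simp add: matrix_matrix_mult_def)
qed

lemma mult_axis_axis:
  fixes X :: "complex^'n^'c"
  shows "(X ** axis r (axis s b)) $ a $ c = (if c = s then X $ a $ r * b else 0)"
proof -
  have "(\<Sum>k\<in>UNIV. X $ a $ k * axis r (axis s b) $ k $ c)
      = (\<Sum>k\<in>UNIV. if k = r then (if c = s then X $ a $ r * b else 0) else 0)"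
    by (rule sum.cong) (auto simp: axis_def)
  then show ?thesis
    by (simp add: matrix_matrix_mult_def)
qed

lemma cadjoint_axis_axis: "cadjoint (axis r (axis s b)) = axis s (axis r (cnj b))"
  by (auto simp: vec_eq_iff cadjoint_def axis_def)

lemma sum_Basis_sandwich:
  fixes X :: "complex^'m^'m"
  shows "(\<Sum>j\<in>(Basis :: (complex^'m^'n) set). j ** X ** cadjoint j) = mat (2 * trace X)"
proof -
  have 1: "(axis r (axis s b) ** X ** cadjoint (axis r (axis s b))) $ a $ c
      = (if a = r \<and> c = r then b * cnj b * X $ s $ s else 0)"
    for r a c :: 'n and s b
    by (simp add: mult_axis_axis axis_axis_mult cadjoint_axis_axis)
  have "(\<Sum>j\<in>(Basis :: (complex^'m^'n) set). j ** X ** cadjoint j) $ a $ c = mat (2 * trace X) $ a $ c" for a c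
  proof -
    have "(\<Sum>j\<in>(Basis :: (complex^'m^'n) set). j ** X ** cadjoint j) $ a $ c
        = (\<Sum>r\<in>UNIV. \<Sum>s\<in>UNIV. if r = a then (if a = c then 2 * X $ s $ s else 0) else 0)"
      by (auto simp: sum_Basis_vec 1 Basis_complex_def intro!: sum.cong)
    also have "\<dots> = (\<Sum>r\<in>UNIV. if r = a then (\<Sum>s\<in>UNIV. if a = c then 2 * X $ s $ s else 0) else 0)"
      by (rule sum.cong) auto
    finally show ?thesis
      by (simp add: mat_def trace_def sum_distrib_left)
  qed
  then show ?thesis
    by (simp add: vec_eq_iff)
qed

text \<open>The basis vectors \<open>e\<close> and \<open>\<i> e\<close> give opposite summands.\<close>

lemma sum_Basis_sandwich_holomorphic:
  fixes X :: "complex^'n^'m"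
  shows "(\<Sum>j\<in>(Basis :: (complex^'m^'n) set). j ** X ** j) = 0"
proof -
  have 1: "(axis r (axis s b) ** X ** axis r (axis s b)) $ a $ c
      = (if a = r \<and> c = s then b * b * X $ s $ r else 0)"
    for r a :: 'n and s c :: 'm and b
    by (simp add: mult_axis_axis axis_axis_mult)
  show ?thesis
    by (auto simp: vec_eq_iff sum_Basis_vec 1 Basis_complex_def intro!: sum.neutral)
qed

section \<open>The metric in a chart\<close>

definition fs_metric :: "complex^('m::finite + 'n::finite)^('m + 'n) \<Rightarrow> (complex^'m^'n) tensor2" where
  "fs_metric A W u v = 2 * reTr (tan_op A W u ** cadjoint (tan_op A W v))"

text \<open>The vector that represents the functional \<open>\<lambda>v. X \<bullet> v\<close> with respect to the metric.\<close>

definition raise :: "complex^'m^'n \<Rightarrow> complex^'m^'n \<Rightarrow> complex^'m^'n" where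
  "raise W X = (1/2) *\<^sub>R ((mat 1 + W ** cadjoint W) ** X ** (mat 1 + cadjoint W ** W))"

text \<open>The metric trace as a sum over a basis; the scalar \<open>c\<close> is recorded together with bilinearity
  so that traces of linear combinations can be assembled from those of the summands.\<close>

definition has_trace :: "complex^'m^'n \<Rightarrow> (complex^'m^'n \<Rightarrow> complex^'m^'n \<Rightarrow> real) \<Rightarrow> real \<Rightarrow> bool" where
  "has_trace W B c \<longleftrightarrow> bilinear B \<and> (\<Sum>j\<in>Basis. B (raise W j) j) = c"

lemma bilinearI:
  assumes "\<And>x y z. B (x + y) z = B x z + B y z" "\<And>r x y. B (r *\<^sub>R x) y = r *\<^sub>R B x y"
    and "\<And>x y z. B x (y + z) = B x y + B x z" "\<And>r x y. B x (r *\<^sub>R y) = r *\<^sub>R B x y"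
  shows "bilinear B"
  unfolding bilinear_def using assms by (auto intro!: linearI)

lemma has_trace_add:
  "has_trace W B c \<Longrightarrow> has_trace W B' c' \<Longrightarrow> has_trace W (\<lambda>u v. B u v + B' u v) (c + c')"
  by (auto simp: has_trace_def sum.distrib bilinear_ladd bilinear_lmul bilinear_radd bilinear_rmul
      algebra_simps intro!: bilinearI)

lemma has_trace_cmul:
  "has_trace W B c \<Longrightarrow> has_trace W (\<lambda>u v. r * B u v) (r * c)"
  by (auto simp: has_trace_def sum_distrib_left bilinear_ladd bilinear_lmul bilinear_radd bilinear_rmul
      algebra_simps intro!: bilinearI)

lemma has_trace_diff:
  "has_trace W B c \<Longrightarrow> has_trace W B' c' \<Longrightarrow> has_trace W (\<lambda>u v. B u v - B' u v) (c - c')"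
  using has_trace_add[of W B c "\<lambda>u v. (-1) * B' u v" "(-1) * c'"] has_trace_cmul[of W B' c' "-1"] by simp

lemma has_trace_minus:
  "has_trace W B c \<Longrightarrow> has_trace W (\<lambda>u v. - B u v) (- c)"
  using has_trace_cmul[of W B c "-1"] by simp

lemma fs_metric_commute: "fs_metric A W u v = fs_metric A W v u"
  unfolding fs_metric_def by (subst reTr_cadjoint[symmetric]) (simp add: cadjoint_mult del: reTr_cadjoint)

lemma bilinear_reTr_sandwich:
  assumes "linear F" "linear G"
  shows "bilinear (\<lambda>u v. reTr (F u ** M ** G v ** N))"
  using assms by (auto simp: bilinear_def matrix_mult_expand linear_add linear_cmul intro!: linearI)

lemma linear_tan_op: "linear (tan_op A W)" "linear (\<lambda>u. cadjoint (tan_op A W u))"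
  by (auto intro!: linearI simp: tan_op_linear)

lemma linear_sandwich:
  "linear (\<lambda>X :: complex^'b^'a. M ** X ** N)"
  by (auto intro!: linearI simp: matrix_mult_expand)

context
  fixes A :: "complex^('m::finite + 'n::finite)^('m + 'n)"
  assumes A: "unitary A"
begin

lemma fs_metric_eq_inner: "fs_metric A W u v = (2 *\<^sub>R (gramK_inv W ** u ** gramC_inv W)) \<bullet> v"
proof -
  have "reTr (tan_op A W u ** cadjoint (tan_op A W v))
    = reTr (dualK A W ** (u ** (cadjoint (dualC A W) ** dualC A W) ** cadjoint v ** cadjoint (dualK A W)))"
    unfolding cadjoint_tan_op unfolding tan_op_def by (simp add: matrix_mul_assoc)
  also have "\<dots> = reTr (u ** gramC_inv W ** cadjoint v ** (cadjoint (dualK A W) ** dualK A W))"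
    by (subst reTr_mult_commute) (simp only: dual_dual[OF A] matrix_mul_assoc[symmetric])
  also have "\<dots> = reTr (gramK_inv W ** (u ** gramC_inv W ** cadjoint v))"
    by (subst reTr_mult_commute) (simp only: dual_dual[OF A] matrix_mul_assoc[symmetric])
  finally show ?thesis
    by (simp add: fs_metric_def inner_eq_reTr matrix_mul_assoc matrix_mult_scaleR)
qed

lemma fs_metric_raise: "fs_metric A W (raise W X) v = X \<bullet> v"
proof -
  have "gramK_inv W ** ((mat 1 + W ** cadjoint W) ** X ** (mat 1 + cadjoint W ** W)) ** gramC_inv W
    = (gramK_inv W ** (mat 1 + W ** cadjoint W)) ** X ** ((mat 1 + cadjoint W ** W) ** gramC_inv W)"
    by (simp only: matrix_mul_assoc)
  also have "gramK_inv W ** (mat 1 + W ** cadjoint W) = mat 1"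
    using gramK_inv_left[of W] by (simp add: matrix_mult_expand)
  also have "(mat 1 + cadjoint W ** W) ** gramC_inv W = mat 1"
    using gramC_inv_right[of W] by (simp add: matrix_mult_expand)
  finally show ?thesis
    by (simp add: fs_metric_eq_inner raise_def matrix_mult_scaleR)
qed

lemma fs_metric_nondegenerate:
  assumes "\<And>v. fs_metric A W u v = fs_metric A W u' v"
  shows "u = u'"
proof -
  have eq: "gramK_inv W ** u ** gramC_inv W = gramK_inv W ** u' ** gramC_inv W"
    using assms unfolding fs_metric_eq_inner by (metis vector_eq_rdot scaleR_cancel_left zero_neq_numeral)
  have "X = (mat 1 + W ** cadjoint W) ** (gramK_inv W ** X ** gramC_inv W) ** (mat 1 + cadjoint W ** W)" for X
  proof -
    have "(mat 1 + W ** cadjoint W) ** (gramK_inv W ** X ** gramC_inv W) ** (mat 1 + cadjoint W ** W)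
      = ((mat 1 + W ** cadjoint W) ** gramK_inv W) ** X ** (gramC_inv W ** (mat 1 + cadjoint W ** W))"
      by (simp only: matrix_mul_assoc)
    also have "(mat 1 + W ** cadjoint W) ** gramK_inv W = mat 1"
      using gramK_inv_right[of W] by (simp add: matrix_mult_expand)
    also have "gramC_inv W ** (mat 1 + cadjoint W ** W) = mat 1"
      using gramC_inv_left[of W] by (simp add: matrix_mult_expand)
    finally show ?thesis by simp
  qed
  from this[of u] this[of u'] eq show ?thesis by metis
qed

lemma sharp_eqI:
  assumes "\<And>v. fs_metric A W u v = \<alpha> v"
  shows "sharp (fs_metric A) W \<alpha> = u"
  unfolding sharp_def
proof (rule the_equality)
  fix w
  assume "\<forall>v. fs_metric A W w v = \<alpha> v"
  then show "w = u"
    by (intro fs_metric_nondegenerate[of W]) (simp add: assms)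
qed (simp add: assms)

text \<open>Raising an index sends a functional \<open>\<alpha>\<close> to \<open>\<Sum>\<^sub>j \<alpha>(j) raise(j)\<close>, so the metric trace becomes an
explicit finite sum.\<close>

lemma metric_trace_eq:
  assumes "has_trace W B c"
  shows "metric_trace (fs_metric A) W B = c"
proof -
  have B: "bilinear B" and c: "(\<Sum>j\<in>Basis. B (raise W j) j) = c"
    using assms by (auto simp: has_trace_def)
  have lin_raise: "linear (raise W)"
    unfolding raise_def by (intro linear_compose_scale_right linear_sandwich)
  have "sharp (fs_metric A) W (B i) = (\<Sum>j\<in>Basis. B i j *\<^sub>R raise W j)" for i
  proof (rule sharp_eqI)
    fix v
    have lin: "linear (B i)"
      using B by (simp add: bilinear_def)
    have "(\<Sum>j\<in>Basis. B i j *\<^sub>R raise W j) = raise W (\<Sum>j\<in>Basis. B i j *\<^sub>R j)"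
      by (simp add: linear_sum[OF lin_raise] linear_cmul[OF lin_raise])
    then have "fs_metric A W (\<Sum>j\<in>Basis. B i j *\<^sub>R raise W j) v = (\<Sum>j\<in>Basis. B i j *\<^sub>R j) \<bullet> v"
      by (simp only: fs_metric_raise)
    also have "\<dots> = B i (\<Sum>j\<in>Basis. (v \<bullet> j) *\<^sub>R j)"
      by (simp add: linear_sum[OF lin] linear_cmul[OF lin] inner_sum_left inner_commute[of v] mult.commute)
    finally show "fs_metric A W (\<Sum>j\<in>Basis. B i j *\<^sub>R raise W j) v = B i v"
      by (simp add: euclidean_representation)
  qed
  then have "metric_trace (fs_metric A) W B = (\<Sum>i\<in>Basis. \<Sum>j\<in>Basis. B i j * (raise W j \<bullet> i))"
    by (simp add: metric_trace_def inner_sum_left)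
  also have "\<dots> = (\<Sum>j\<in>Basis. \<Sum>i\<in>Basis. B i j * (raise W j \<bullet> i))"
    by (rule sum.swap)
  also have "\<dots> = (\<Sum>j\<in>Basis. B (\<Sum>i\<in>Basis. (raise W j \<bullet> i) *\<^sub>R i) j)"
    using B by (simp add: bilinear_def linear_sum[of "\<lambda>x. B x _"] linear_cmul[of "\<lambda>x. B x _"] mult.commute)
  finally show ?thesis
    using c by (simp add: euclidean_representation)
qed

lemma tan_op_raise: "tan_op A W (raise W X) = (1/2) *\<^sub>R (frameK A W ** X ** cadjoint (frameC A W))"
proof -
  have "tan_op A W (raise W X) = (1/2) *\<^sub>R (frameK A W ** (gramK_inv W ** (mat 1 + W ** cadjoint W)) ** X
      ** ((mat 1 + cadjoint W ** W) ** gramC_inv W) ** cadjoint (frameC A W))"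
    by (simp add: tan_op_def raise_def dualK_def dualC_def cadjoint_mult matrix_mult_scaleR matrix_mul_assoc)
  also have "gramK_inv W ** (mat 1 + W ** cadjoint W) = mat 1"
    using gramK_inv_left[of W] by (simp add: matrix_mult_expand)
  also have "(mat 1 + cadjoint W ** W) ** gramC_inv W = mat 1"
    using gramC_inv_right[of W] by (simp add: matrix_mult_expand)
  finally show ?thesis by simp
qed

text \<open>Contraction of two tangent vectors separated by a matrix. Vectors of opposite type contract
  to the two projections; vectors of equal type cancel, since the contributions of \<open>e\<close> and \<open>\<i> e\<close>
  are opposite.\<close>

lemma has_trace_tan_cadjoint:
  "has_trace W (\<lambda>u v. reTr (tan_op A W u ** M ** cadjoint (tan_op A W v) ** N))
     (Re (trace (proj A W ** M) * trace ((mat 1 - proj A W) ** N)))"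
  unfolding has_trace_def
proof (intro conjI bilinear_reTr_sandwich linear_tan_op)
  have "(\<Sum>j\<in>Basis. reTr (tan_op A W (raise W j) ** M ** cadjoint (tan_op A W j) ** N))
    = (\<Sum>j\<in>Basis. reTr ((1/2) *\<^sub>R (frameK A W ** (j ** (cadjoint (frameC A W) ** M ** dualC A W) ** cadjoint j)
        ** (cadjoint (dualK A W) ** N))))"
    unfolding tan_op_raise cadjoint_tan_op by (simp add: matrix_mult_scaleR matrix_mul_assoc)
  also have "\<dots> = reTr ((1/2) *\<^sub>R (frameK A W ** (\<Sum>j\<in>Basis. j ** (cadjoint (frameC A W) ** M ** dualC A W) ** cadjoint j)
        ** (cadjoint (dualK A W) ** N)))"
    by (rule linear_sum[symmetric, of "\<lambda>X. reTr ((1/2) *\<^sub>R (frameK A W ** X ** (cadjoint (dualK A W) ** N)))"])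
      (auto intro!: linearI simp: matrix_mult_expand)
  also have "\<dots> = reTr ((1/2) *\<^sub>R (frameK A W ** mat (2 * trace (cadjoint (frameC A W) ** M ** dualC A W)) ** (cadjoint (dualK A W) ** N)))"
    by (simp only: sum_Basis_sandwich)
  also have "trace (cadjoint (frameC A W) ** M ** dualC A W) = trace (proj A W ** M)"
    unfolding proj_def by (subst trace_mul_sym) (simp add: matrix_mul_assoc)
  also have "frameK A W ** mat (2 * trace (proj A W ** M)) ** (cadjoint (dualK A W) ** N)
     = mat (2 * trace (proj A W ** M)) ** ((mat 1 - proj A W) ** N)"
  proof -
    have "frameK A W ** cadjoint (dualK A W) = mat 1 - proj A W"
      unfolding one_minus_proj[OF A] by (simp add: dualK_def cadjoint_mult matrix_mul_assoc)
    moreover have "X ** mat c = mat c ** X" for X :: "complex^'n^('m + 'n)" and c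
      by (simp add: vec_eq_iff matrix_matrix_mult_def mat_def if_distrib if_distribR sum.delta sum.delta' mult.commute cong: if_cong)
    ultimately show ?thesis
      by (metis matrix_mul_assoc)
  qed
  also have "reTr ((1/2) *\<^sub>R (mat (2 * c) ** X)) = Re (c * trace X)" for c and X :: "complex^('m + 'n)^('m + 'n)"
    by (simp add: reTr_def trace_def matrix_matrix_mult_def mat_def if_distrib if_distribR sum.delta
        sum_distrib_left Re_sum mult.assoc cong: if_cong)
  finally show "(\<Sum>j\<in>Basis. reTr (tan_op A W (raise W j) ** M ** cadjoint (tan_op A W j) ** N))
     = Re (trace (proj A W ** M) * trace ((mat 1 - proj A W) ** N))" .
qed

lemma has_trace_cadjoint_tan:
  "has_trace W (\<lambda>u v. reTr (cadjoint (tan_op A W u) ** M ** tan_op A W v ** N))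
     (Re (trace ((mat 1 - proj A W) ** M) * trace (proj A W ** N)))"
  unfolding has_trace_def
proof (intro conjI bilinear_reTr_sandwich linear_tan_op)
  have "reTr (cadjoint (tan_op A W u) ** M ** tan_op A W v ** N)
    = reTr (tan_op A W u ** cadjoint N ** cadjoint (tan_op A W v) ** cadjoint M)" for u v
  proof -
    have "reTr (cadjoint (tan_op A W u) ** M ** tan_op A W v ** N)
      = reTr (cadjoint (cadjoint (tan_op A W u) ** M ** tan_op A W v ** N))" by simp
    also have "\<dots> = reTr (cadjoint N ** cadjoint (tan_op A W v) ** cadjoint M ** tan_op A W u)"
      by (simp add: cadjoint_mult matrix_mul_assoc del: reTr_cadjoint)
    also have "\<dots> = reTr (tan_op A W u ** (cadjoint N ** cadjoint (tan_op A W v) ** cadjoint M))"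
      by (rule reTr_mult_commute)
    finally show ?thesis by (simp add: matrix_mul_assoc)
  qed
  then have "(\<Sum>j\<in>Basis. reTr (cadjoint (tan_op A W (raise W j)) ** M ** tan_op A W j ** N))
    = Re (trace (proj A W ** cadjoint N) * trace ((mat 1 - proj A W) ** cadjoint M))"
    using has_trace_tan_cadjoint[of W "cadjoint N" "cadjoint M"] by (simp add: has_trace_def)
  moreover have "trace (X ** cadjoint Y) = cnj (trace (cadjoint X ** Y))" for X Y :: "complex^('m + 'n)^('m + 'n)"
    by (metis cadjoint_cadjoint cadjoint_mult trace_cadjoint trace_mul_sym)
  ultimately show "(\<Sum>j\<in>Basis. reTr (cadjoint (tan_op A W (raise W j)) ** M ** tan_op A W j ** N))
    = Re (trace ((mat 1 - proj A W) ** M) * trace (proj A W ** N))"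
    by (simp add: mult.commute algebra_simps)
qed

lemma has_trace_tan_tan:
  "has_trace W (\<lambda>u v. reTr (tan_op A W u ** M ** tan_op A W v ** N)) 0"
  unfolding has_trace_def
proof (intro conjI bilinear_reTr_sandwich linear_tan_op)
  have "(\<Sum>j\<in>Basis. reTr (tan_op A W (raise W j) ** M ** tan_op A W j ** N))
    = (\<Sum>j\<in>Basis. reTr ((1/2) *\<^sub>R (frameK A W ** (j ** (cadjoint (frameC A W) ** M ** dualK A W) ** j)
        ** (cadjoint (dualC A W) ** N))))"
    unfolding tan_op_raise unfolding tan_op_def by (simp add: matrix_mult_scaleR matrix_mul_assoc)
  also have "\<dots> = reTr ((1/2) *\<^sub>R (frameK A W ** (\<Sum>j\<in>Basis. j ** (cadjoint (frameC A W) ** M ** dualK A W) ** j)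
        ** (cadjoint (dualC A W) ** N)))"
    by (rule linear_sum[symmetric, of "\<lambda>X. reTr ((1/2) *\<^sub>R (frameK A W ** X ** (cadjoint (dualC A W) ** N)))"])
      (auto intro!: linearI simp: matrix_mult_expand)
  also have "\<dots> = 0"
    by (simp only: sum_Basis_sandwich_holomorphic) simp
  finally show "(\<Sum>j\<in>Basis. reTr (tan_op A W (raise W j) ** M ** tan_op A W j ** N)) = 0" .
qed

lemma has_trace_cadjoint_cadjoint:
  "has_trace W (\<lambda>u v. reTr (cadjoint (tan_op A W u) ** M ** cadjoint (tan_op A W v) ** N)) 0"
  unfolding has_trace_def
proof (intro conjI bilinear_reTr_sandwich linear_tan_op)
  have "reTr (cadjoint (tan_op A W u) ** M ** cadjoint (tan_op A W v) ** N)
    = reTr (tan_op A W u ** cadjoint N ** tan_op A W v ** cadjoint M)" for u v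
  proof -
    have "reTr (cadjoint (tan_op A W u) ** M ** cadjoint (tan_op A W v) ** N)
      = reTr (cadjoint (cadjoint (tan_op A W u) ** M ** cadjoint (tan_op A W v) ** N))" by simp
    also have "\<dots> = reTr (cadjoint N ** tan_op A W v ** cadjoint M ** tan_op A W u)"
      by (simp add: cadjoint_mult matrix_mul_assoc del: reTr_cadjoint)
    also have "\<dots> = reTr (tan_op A W u ** (cadjoint N ** tan_op A W v ** cadjoint M))"
      by (rule reTr_mult_commute)
    finally show ?thesis by (simp add: matrix_mul_assoc)
  qed
  then show "(\<Sum>j\<in>Basis. reTr (cadjoint (tan_op A W (raise W j)) ** M ** cadjoint (tan_op A W j) ** N)) = 0"
    using has_trace_tan_tan[of W "cadjoint N" "cadjoint M"] by (simp add: has_trace_def)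
qed

end

section \<open>The three tensors\<close>

text \<open>These are \<open>h\<^sub>1\<close>, \<open>h\<^sub>2\<close>, \<open>h\<^sub>3\<close> in the chart of \<open>A\<close>; the identification with the tautological
description is made in \<open>real_tensor_deformation\<close>.\<close>

definition form1 :: "complex^('m::finite + 'n::finite)^('m + 'n) \<Rightarrow> complex^('m + 'n)^('m + 'n) \<Rightarrow> (complex^'m^'n) tensor2" where
  "form1 A \<gamma> W v w = 2 * reTr (tan_op A W v ** cadjoint (tan_op A W w) ** \<gamma>)"

definition form2 :: "complex^('m::finite + 'n::finite)^('m + 'n) \<Rightarrow> complex^('m + 'n)^('m + 'n) \<Rightarrow> (complex^'m^'n) tensor2" where
  "form2 A \<gamma> W v w = 2 * reTr (cadjoint (tan_op A W w) ** tan_op A W v ** \<gamma>)"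

definition form3 :: "complex^('m::finite + 'n::finite)^('m + 'n) \<Rightarrow> complex^('m + 'n)^('m + 'n) \<Rightarrow> (complex^'m^'n) tensor2" where
  "form3 A \<gamma> W v w = reTr (proj A W ** \<gamma>) * fs_metric A W v w"

section \<open>Covariant derivatives and curvature\<close>

text \<open>Here and in the next definition the Christoffel symbols appear explicitly, so that \<open>nabla\<close> and
\<open>nabla2\<close> can be read off from ordinary derivatives, one word in the tangent matrices at a time.\<close>

definition covariant_derivative1 ::
  "(complex^'m^'n \<Rightarrow> complex^'m^'n \<Rightarrow> complex^'m^'n \<Rightarrow> real) \<Rightarrow>
   (complex^'m^'n \<Rightarrow> complex^'m^'n \<Rightarrow> complex^'m^'n \<Rightarrow> complex^'m^'n \<Rightarrow> real) \<Rightarrow> bool" where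
  "covariant_derivative1 F N \<longleftrightarrow> (\<forall>W v w. ((\<lambda>W. F W v w) has_derivative
     (\<lambda>u. N W u v w + F W (chris W u v) w + F W v (chris W u w))) (at W))"

definition covariant_derivative2 ::
  "(complex^'m^'n \<Rightarrow> complex^'m^'n \<Rightarrow> complex^'m^'n \<Rightarrow> complex^'m^'n \<Rightarrow> real) \<Rightarrow>
   (complex^'m^'n \<Rightarrow> complex^'m^'n \<Rightarrow> complex^'m^'n \<Rightarrow> complex^'m^'n \<Rightarrow> complex^'m^'n \<Rightarrow> real) \<Rightarrow>
   bool" where
  "covariant_derivative2 N L \<longleftrightarrow> (\<forall>W u v w. ((\<lambda>W. N W u v w) has_derivative
     (\<lambda>t. L W t u v w + N W (chris W t u) v w + N W u (chris W t v) w + N W u v (chris W t w))) (at W))"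

lemma covariant_derivative1_linear:
  assumes "covariant_derivative1 F N" "covariant_derivative1 F' N'"
  shows "covariant_derivative1 (\<lambda>W v w. a * F W v w + b * F' W v w)
    (\<lambda>W u v w. a * N W u v w + b * N' W u v w)"
  unfolding covariant_derivative1_def
proof (intro allI)
  fix W v w
  show "((\<lambda>W. a * F W v w + b * F' W v w) has_derivative (\<lambda>u. a * N W u v w + b * N' W u v w
    + (a * F W (chris W u v) w + b * F' W (chris W u v) w)
    + (a * F W v (chris W u w) + b * F' W v (chris W u w)))) (at W)"
    by (rule has_derivative_eq_rhs, rule has_derivative_add,
        rule has_derivative_mult_right[OF assms(1)[unfolded covariant_derivative1_def, rule_format]],
        rule has_derivative_mult_right[OF assms(2)[unfolded covariant_derivative1_def, rule_format]])
      (simp add: algebra_simps)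
qed

lemma covariant_derivative2_linear:
  assumes "covariant_derivative2 N L" "covariant_derivative2 N' L'"
  shows "covariant_derivative2 (\<lambda>W u v w. a * N W u v w + b * N' W u v w)
    (\<lambda>W t u v w. a * L W t u v w + b * L' W t u v w)"
  unfolding covariant_derivative2_def
proof (intro allI)
  fix W u v w
  show "((\<lambda>W. a * N W u v w + b * N' W u v w) has_derivative (\<lambda>t. a * L W t u v w + b * L' W t u v w
    + (a * N W (chris W t u) v w + b * N' W (chris W t u) v w)
    + (a * N W u (chris W t v) w + b * N' W u (chris W t v) w)
    + (a * N W u v (chris W t w) + b * N' W u v (chris W t w)))) (at W)"
    by (rule has_derivative_eq_rhs, rule has_derivative_add,
        rule has_derivative_mult_right[OF assms(1)[unfolded covariant_derivative2_def, rule_format]],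
        rule has_derivative_mult_right[OF assms(2)[unfolded covariant_derivative2_def, rule_format]])
      (simp add: algebra_simps)
qed

context
  fixes A :: "complex^('m::finite + 'n::finite)^('m + 'n)"
  assumes A: "unitary A"
begin

lemma cyclic_0:
  "reTr (cadjoint (tan_op A W u) ** M ** cadjoint (tan_op A W v)) = 0"
  "reTr (tan_op A W u ** M ** tan_op A W v) = 0"
  by (subst reTr_mult_commute, simp add: matrix_mul_assoc tan_op_mult_0[OF A])+

text \<open>Replacing a letter of \<open>T\<^sub>v T\<^sub>w\<^sup>*\<close> by its commutator produces words in which, up to cyclic rotation,
two letters of the same type are adjacent; their traces vanish.\<close>

lemma covariant_derivative1_fs_metric: "covariant_derivative1 (fs_metric A) (\<lambda>W u v w. 0)"
  unfolding covariant_derivative1_def fs_metric_def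
proof (intro allI)
  fix W v w
  show "((\<lambda>W. 2 * reTr (tan_op A W v ** cadjoint (tan_op A W w))) has_derivative
    (\<lambda>u. 0 + 2 * reTr (tan_op A W (chris W u v) ** cadjoint (tan_op A W w))
      + 2 * reTr (tan_op A W v ** cadjoint (tan_op A W (chris W u w))))) (at W)"
    by (rule has_derivative_eq_rhs,
        (rule has_derivative_mult_right has_derivative_reTr has_derivative_matrix_mult
          has_derivative_cadjoint has_derivative_tan_op[OF A])+)
      (simp add: fun_eq_iff cadjoint_mult matrix_mult_expand tan_op_mult_0[OF A] cyclic_0)
qed

text \<open>The connection with symbols \<open>chris\<close> is symmetric and preserves the metric, which is Koszul's
characterisation.\<close>

lemma christoffel_fs_metric: "christoffel (fs_metric A) W u v = chris W u v"
  unfolding christoffel_def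
proof (rule sharp_eqI[OF A])
  fix w
  have D: "dir_deriv (\<lambda>y. fs_metric A y v w) u W
      = fs_metric A W (chris W u v) w + fs_metric A W v (chris W u w)" for u v w
    using covariant_derivative1_fs_metric by (subst dir_deriv_eq) (auto simp: covariant_derivative1_def)
  show "fs_metric A W (chris W u v) w = (dir_deriv (\<lambda>y. fs_metric A y v w) u W
      + dir_deriv (\<lambda>y. fs_metric A y u w) v W - dir_deriv (\<lambda>y. fs_metric A y u v) w W) / 2"
    by (simp add: D chris_commute[of W v u] chris_commute[of W w] fs_metric_commute[of A W v])
qed

lemma nabla_eq:
  assumes "covariant_derivative1 F N"
  shows "nabla (fs_metric A) F W u v w = N W u v w"
  using dir_deriv_eq[OF assms[unfolded covariant_derivative1_def, rule_format, of v w W], of u]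
  by (simp add: nabla_def christoffel_fs_metric)

lemma nabla2_eq:
  assumes "covariant_derivative1 F N" "covariant_derivative2 N L"
  shows "nabla2 (fs_metric A) F W t u v w = L W t u v w"
  using dir_deriv_eq[OF assms(2)[unfolded covariant_derivative2_def, rule_format, of u v w W], of t]
  by (simp add: nabla2_def christoffel_fs_metric nabla_eq[OF assms(1)])

text \<open>The terms quadratic in the connection matrix cancel against its derivative, except for the part
\<open>(C\<^sup>* C)\<^sup>-\<^sup>1 X\<^sup>* (K\<^sup>* K)\<^sup>-\<^sup>1\<close>, and a product with this matrix in the middle is a word of length
three.\<close>

lemma riemann_fs_metric:
  "tan_op A W (riemann (fs_metric A) W u v w) =
     - (tan_op A W v ** cadjoint (tan_op A W u) ** tan_op A W w)
     - tan_op A W w ** cadjoint (tan_op A W u) ** tan_op A W v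
     + tan_op A W u ** cadjoint (tan_op A W v) ** tan_op A W w
     + tan_op A W w ** cadjoint (tan_op A W v) ** tan_op A W u"
proof -
  let ?d = "\<lambda>X. gramC_inv W ** cadjoint X ** gramK_inv W"
  have D: "dir_deriv (\<lambda>y. christoffel (fs_metric A) y v w) u W
    = - (v ** (?d u - slope W ** u ** slope W) ** w + w ** (?d u - slope W ** u ** slope W) ** v)" for u v w
  proof (rule dir_deriv_eq)
    show "((\<lambda>y. christoffel (fs_metric A) y v w) has_derivative
      (\<lambda>u. - (v ** (?d u - slope W ** u ** slope W) ** w + w ** (?d u - slope W ** u ** slope W) ** v))) (at W)"
      unfolding christoffel_fs_metric chris_def
      by (rule has_derivative_eq_rhs,
          (rule has_derivative_minus has_derivative_add has_derivative_matrix_mult has_derivative_const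
            has_derivative_slope)+)
        (simp add: matrix_mult_expand)
  qed
  have "riemann (fs_metric A) W u v w = - (v ** ?d u ** w) - w ** ?d u ** v + u ** ?d v ** w + w ** ?d v ** u"
    unfolding riemann_def D unfolding christoffel_fs_metric chris_def
    by (simp add: matrix_mult_expand)
  moreover have "tan_op A W (x ** ?d y ** z) = tan_op A W x ** cadjoint (tan_op A W y) ** tan_op A W z" for x y z
    unfolding cadjoint_tan_op unfolding tan_op_def
    by (simp add: dual_dual[OF A, symmetric] matrix_mul_assoc)
  ultimately show ?thesis
    by (simp add: tan_op_linear)
qed

text \<open>In the first and second derivatives below only those words survive in which the letters \<open>T\<close> and
\<open>T\<^sup>*\<close> alternate.\<close>

lemma covariant_derivative_form1:
  "covariant_derivative1 (form1 A \<gamma>) (\<lambda>W u v w. - 2 * reTr (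
     cadjoint (tan_op A W u) ** tan_op A W v ** cadjoint (tan_op A W w) ** \<gamma>
     + tan_op A W v ** cadjoint (tan_op A W w) ** tan_op A W u ** \<gamma>))"
  unfolding covariant_derivative1_def form1_def
  by (intro allI, rule has_derivative_eq_rhs,
      (rule has_derivative_mult_right has_derivative_reTr has_derivative_matrix_mult has_derivative_const
        has_derivative_cadjoint has_derivative_tan_op[OF A])+)
    (simp add: fun_eq_iff cadjoint_mult matrix_mult_expand tan_op_mult_0[OF A])

lemma covariant_derivative2_form1:
  "covariant_derivative2 (\<lambda>W u v w. - 2 * reTr (
     cadjoint (tan_op A W u) ** tan_op A W v ** cadjoint (tan_op A W w) ** \<gamma>
     + tan_op A W v ** cadjoint (tan_op A W w) ** tan_op A W u ** \<gamma>))
   (\<lambda>W t u v w. - 2 * reTr (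
     tan_op A W t ** cadjoint (tan_op A W u) ** tan_op A W v ** cadjoint (tan_op A W w) ** \<gamma>
     - cadjoint (tan_op A W u) ** tan_op A W v ** cadjoint (tan_op A W w) ** tan_op A W t ** \<gamma>
     - cadjoint (tan_op A W t) ** tan_op A W v ** cadjoint (tan_op A W w) ** tan_op A W u ** \<gamma>
     + tan_op A W v ** cadjoint (tan_op A W w) ** tan_op A W u ** cadjoint (tan_op A W t) ** \<gamma>))"
  unfolding covariant_derivative2_def
  by (intro allI, rule has_derivative_eq_rhs,
      (rule has_derivative_mult_right has_derivative_reTr has_derivative_add has_derivative_matrix_mult
        has_derivative_const has_derivative_cadjoint has_derivative_tan_op[OF A])+)
    (simp add: fun_eq_iff cadjoint_mult matrix_mult_expand tan_op_mult_0[OF A])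

lemma covariant_derivative_form2:
  "covariant_derivative1 (form2 A \<gamma>) (\<lambda>W u v w. 2 * reTr (
     tan_op A W u ** cadjoint (tan_op A W w) ** tan_op A W v ** \<gamma>
     + cadjoint (tan_op A W w) ** tan_op A W v ** cadjoint (tan_op A W u) ** \<gamma>))"
  unfolding covariant_derivative1_def form2_def
  by (intro allI, rule has_derivative_eq_rhs,
      (rule has_derivative_mult_right has_derivative_reTr has_derivative_matrix_mult has_derivative_const
        has_derivative_cadjoint has_derivative_tan_op[OF A])+)
    (simp add: fun_eq_iff cadjoint_mult matrix_mult_expand tan_op_mult_0[OF A])

lemma covariant_derivative2_form2:
  "covariant_derivative2 (\<lambda>W u v w. 2 * reTr (
     tan_op A W u ** cadjoint (tan_op A W w) ** tan_op A W v ** \<gamma>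
     + cadjoint (tan_op A W w) ** tan_op A W v ** cadjoint (tan_op A W u) ** \<gamma>))
   (\<lambda>W t u v w. 2 * reTr (
     - (cadjoint (tan_op A W t) ** tan_op A W u ** cadjoint (tan_op A W w) ** tan_op A W v ** \<gamma>)
     + tan_op A W u ** cadjoint (tan_op A W w) ** tan_op A W v ** cadjoint (tan_op A W t) ** \<gamma>
     + tan_op A W t ** cadjoint (tan_op A W w) ** tan_op A W v ** cadjoint (tan_op A W u) ** \<gamma>
     - cadjoint (tan_op A W w) ** tan_op A W v ** cadjoint (tan_op A W u) ** tan_op A W t ** \<gamma>))"
  unfolding covariant_derivative2_def
  by (intro allI, rule has_derivative_eq_rhs,
      (rule has_derivative_mult_right has_derivative_reTr has_derivative_add has_derivative_matrix_mult
        has_derivative_const has_derivative_cadjoint has_derivative_tan_op[OF A])+)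
    (simp add: fun_eq_iff cadjoint_mult matrix_mult_expand tan_op_mult_0[OF A])

lemma covariant_derivative_form3:
  "covariant_derivative1 (form3 A \<gamma>) (\<lambda>W u v w.
     reTr (tan_op A W u ** \<gamma> + cadjoint (tan_op A W u) ** \<gamma>) * fs_metric A W v w)"
  unfolding covariant_derivative1_def form3_def
proof (intro allI)
  fix W v w
  have "((\<lambda>W. reTr (proj A W ** \<gamma>)) has_derivative
      (\<lambda>u. reTr (proj A W ** 0 + (tan_op A W u + cadjoint (tan_op A W u)) ** \<gamma>))) (at W)"
    by (intro has_derivative_reTr has_derivative_matrix_mult has_derivative_proj[OF A] has_derivative_const)
  from has_derivative_mult[OF this covariant_derivative1_fs_metric[unfolded covariant_derivative1_def, rule_format]]
  show "((\<lambda>W. reTr (proj A W ** \<gamma>) * fs_metric A W v w) has_derivative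
     (\<lambda>u. reTr (tan_op A W u ** \<gamma> + cadjoint (tan_op A W u) ** \<gamma>) * fs_metric A W v w
       + reTr (proj A W ** \<gamma>) * fs_metric A W (chris W u v) w
       + reTr (proj A W ** \<gamma>) * fs_metric A W v (chris W u w))) (at W)"
    by (rule has_derivative_eq_rhs) (simp add: fun_eq_iff matrix_mult_expand algebra_simps)
qed

lemma covariant_derivative2_form3:
  "covariant_derivative2 (\<lambda>W u v w.
     reTr (tan_op A W u ** \<gamma> + cadjoint (tan_op A W u) ** \<gamma>) * fs_metric A W v w)
   (\<lambda>W t u v w. reTr (
       tan_op A W u ** cadjoint (tan_op A W t) ** \<gamma> - cadjoint (tan_op A W t) ** tan_op A W u ** \<gamma>
     + tan_op A W t ** cadjoint (tan_op A W u) ** \<gamma> - cadjoint (tan_op A W u) ** tan_op A W t ** \<gamma>)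
     * fs_metric A W v w)"
  unfolding covariant_derivative2_def
proof (intro allI)
  fix W u v w
  have "((\<lambda>W. reTr (tan_op A W u ** \<gamma> + cadjoint (tan_op A W u) ** \<gamma>)) has_derivative
      (\<lambda>t. reTr (
       tan_op A W u ** cadjoint (tan_op A W t) ** \<gamma> - cadjoint (tan_op A W t) ** tan_op A W u ** \<gamma>
     + tan_op A W t ** cadjoint (tan_op A W u) ** \<gamma> - cadjoint (tan_op A W u) ** tan_op A W t ** \<gamma>
     + tan_op A W (chris W t u) ** \<gamma> + cadjoint (tan_op A W (chris W t u)) ** \<gamma>))) (at W)"
    by (rule has_derivative_eq_rhs,
        (rule has_derivative_reTr has_derivative_add has_derivative_matrix_mult
          has_derivative_const has_derivative_cadjoint has_derivative_tan_op[OF A])+)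
      (simp add: fun_eq_iff cadjoint_mult matrix_mult_expand)
  from has_derivative_mult[OF this covariant_derivative1_fs_metric[unfolded covariant_derivative1_def, rule_format]]
  show "((\<lambda>W. reTr (tan_op A W u ** \<gamma> + cadjoint (tan_op A W u) ** \<gamma>) * fs_metric A W v w) has_derivative
     (\<lambda>t. reTr (
       tan_op A W u ** cadjoint (tan_op A W t) ** \<gamma> - cadjoint (tan_op A W t) ** tan_op A W u ** \<gamma>
     + tan_op A W t ** cadjoint (tan_op A W u) ** \<gamma> - cadjoint (tan_op A W u) ** tan_op A W t ** \<gamma>)
     * fs_metric A W v w
     + reTr (tan_op A W (chris W t u) ** \<gamma> + cadjoint (tan_op A W (chris W t u)) ** \<gamma>) * fs_metric A W v w
     + reTr (tan_op A W u ** \<gamma> + cadjoint (tan_op A W u) ** \<gamma>) * fs_metric A W (chris W t v) w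
     + reTr (tan_op A W u ** \<gamma> + cadjoint (tan_op A W u) ** \<gamma>) * fs_metric A W v (chris W t w))) (at W)"
    by (rule has_derivative_eq_rhs) (simp add: fun_eq_iff algebra_simps)
qed

end

section \<open>Contractions\<close>

lemma has_trace_cong:
  assumes "has_trace W B c" "\<And>u v. B' u v = B u v" "c' = c"
  shows "has_trace W B' c'"
proof -
  have "B' = B" using assms(2) by auto
  then show ?thesis using assms by simp
qed

lemma trace_tan_cadjoint_commute:
  "Re (trace (cadjoint (tan_op A W w) ** tan_op A W v)) = fs_metric A W v w / 2"
  "Re (trace (tan_op A W v ** cadjoint (tan_op A W w))) = fs_metric A W v w / 2"
  unfolding fs_metric_def reTr_def by (subst trace_mul_sym, simp)+

lemma form1_mat_1: "form1 A (mat 1) = fs_metric A"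
  by (simp add: fun_eq_iff form1_def fs_metric_def)

lemma reTr_cyclic:
  assumes "X = Y ** Z" "X' = Z ** Y"
  shows "reTr X = reTr X'"
  unfolding assms by (rule reTr_mult_commute)

context
  fixes A :: "complex^('m::finite + 'n::finite)^('m + 'n)"
  assumes A: "unitary A"
begin

lemma one_minus_proj_tan_op:
  "(mat 1 - proj A W) ** tan_op A W X = tan_op A W X"
  "(mat 1 - proj A W) ** cadjoint (tan_op A W X) = 0"
  "cadjoint (tan_op A W X) ** (mat 1 - proj A W) = cadjoint (tan_op A W X)"
  by (simp_all add: matrix_mult_left_distrib matrix_mult_right_distrib proj_tan_op[OF A])

lemma trace_form1:
  "has_trace W (form1 A \<gamma> W) (2 * real CARD('m) * Re (trace ((mat 1 - proj A W) ** \<gamma>)))"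
  using has_trace_cmul[OF has_trace_tan_cadjoint[OF A, of W "mat 1" \<gamma>], of 2]
  by (simp add: form1_def[abs_def] trace_proj[OF A] mult.assoc)

lemma trace_form2:
  "has_trace W (form2 A \<gamma> W) (2 * real CARD('n) * Re (trace (proj A W ** \<gamma>)))"
  by (rule has_trace_cong[OF has_trace_cmul[OF has_trace_tan_cadjoint[OF A, of W \<gamma> "mat 1"], of 2]])
    (auto intro!: reTr_cyclic[OF _ refl] simp: matrix_mul_assoc trace_one_minus_proj[OF A] form2_def)

lemma trace_fs_metric: "has_trace W (fs_metric A W) (2 * real CARD('m) * real CARD('n))"
  using trace_form1[of W "mat 1"] by (simp add: form1_mat_1 trace_one_minus_proj[OF A])

lemma trace_form3:
  "has_trace W (form3 A \<gamma> W) (2 * real CARD('m) * real CARD('n) * Re (trace (proj A W ** \<gamma>)))"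
  using has_trace_cmul[OF trace_fs_metric, of W "reTr (proj A W ** \<gamma>)"]
  by (simp add: form3_def[abs_def] reTr_def mult_ac)

text \<open>The expressions contracted in the following lemmas are the covariant derivatives found above. Each
word is rotated cyclically, where necessary, so that one of the contracted letters comes first.\<close>

lemma divergence_form1:
  "has_trace W (\<lambda>u v. - 2 * reTr (
     cadjoint (tan_op A W u) ** tan_op A W v ** cadjoint (tan_op A W w) ** \<gamma>
     + tan_op A W v ** cadjoint (tan_op A W w) ** tan_op A W u ** \<gamma>))
   (- 2 * real CARD('n) * reTr (cadjoint (tan_op A W w) ** \<gamma>))"
proof -
  have 1: "has_trace W (\<lambda>u v. reTr (cadjoint (tan_op A W u) ** tan_op A W v ** cadjoint (tan_op A W w) ** \<gamma>))
      (real CARD('n) * reTr (cadjoint (tan_op A W w) ** \<gamma>))"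
    by (rule has_trace_cong[OF has_trace_cadjoint_tan[OF A, of W "mat 1" "cadjoint (tan_op A W w) ** \<gamma>"]])
      (simp_all add: matrix_mul_assoc trace_one_minus_proj[OF A] proj_tan_op[OF A] reTr_def)
  have 2: "has_trace W (\<lambda>u v. reTr (tan_op A W v ** cadjoint (tan_op A W w) ** tan_op A W u ** \<gamma>)) 0"
    by (rule has_trace_cong[OF has_trace_tan_tan[OF A, of W \<gamma> "cadjoint (tan_op A W w)"]])
      (auto intro!: reTr_cyclic[of _ "tan_op A W _ ** cadjoint (tan_op A W w)" "tan_op A W _ ** \<gamma>"] simp: matrix_mul_assoc)
  show ?thesis
    by (rule has_trace_cong[OF has_trace_cmul[OF has_trace_add[OF 1 2], of "-2"]]) auto
qed

lemma divergence_form2: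
  "has_trace W (\<lambda>u v. 2 * reTr (
     tan_op A W u ** cadjoint (tan_op A W w) ** tan_op A W v ** \<gamma>
     + cadjoint (tan_op A W w) ** tan_op A W v ** cadjoint (tan_op A W u) ** \<gamma>))
   (2 * real CARD('m) * reTr (cadjoint (tan_op A W w) ** \<gamma>))"
proof -
  have "trace ((mat 1 - proj A W) ** (\<gamma> ** cadjoint (tan_op A W w))) = trace (cadjoint (tan_op A W w) ** \<gamma>)"
    by (subst trace_mul_sym, subst matrix_mul_assoc[symmetric], subst one_minus_proj_tan_op, rule trace_mul_sym)
  then have 1: "has_trace W (\<lambda>u v. reTr (cadjoint (tan_op A W w) ** tan_op A W v ** cadjoint (tan_op A W u) ** \<gamma>))
      (real CARD('m) * reTr (cadjoint (tan_op A W w) ** \<gamma>))"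
    by (intro has_trace_cong[OF has_trace_cadjoint_tan[OF A, of W "\<gamma> ** cadjoint (tan_op A W w)" "mat 1"]])
      (auto intro!: reTr_cyclic[of _ "cadjoint (tan_op A W w) ** tan_op A W _" "cadjoint (tan_op A W _) ** \<gamma>"]
        simp: matrix_mul_assoc trace_proj[OF A] reTr_def[symmetric])
  have 2: "has_trace W (\<lambda>u v. reTr (tan_op A W u ** cadjoint (tan_op A W w) ** tan_op A W v ** \<gamma>)) 0"
    by (rule has_trace_tan_tan[OF A])
  show ?thesis
    by (rule has_trace_cong[OF has_trace_cmul[OF has_trace_add[OF 2 1], of "2"]]) auto
qed

text \<open>The expansion of \<open>w\<close> in a basis, written with the metric instead of the inner product. It evaluates
the divergence of a function times the metric.\<close>

lemma sum_fs_metric_raise: "(\<Sum>j\<in>Basis. fs_metric A W w j *\<^sub>R raise W j) = w"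
proof (rule fs_metric_nondegenerate[OF A])
  fix v
  have lin: "linear (\<lambda>u. fs_metric A W u v)" "linear (fs_metric A W w)"
    by (auto intro!: linearI simp: fs_metric_def tan_op_linear matrix_mult_expand algebra_simps)
  have "fs_metric A W (\<Sum>j\<in>Basis. fs_metric A W w j *\<^sub>R raise W j) v
    = (\<Sum>j\<in>Basis. fs_metric A W w j * (j \<bullet> v))"
    by (simp add: linear_sum[OF lin(1)] linear_cmul[OF lin(1)] fs_metric_raise[OF A])
  also have "\<dots> = fs_metric A W w (\<Sum>j\<in>Basis. (v \<bullet> j) *\<^sub>R j)"
    by (simp add: linear_sum[OF lin(2)] linear_cmul[OF lin(2)] inner_commute[of v] mult.commute)
  finally show "fs_metric A W (\<Sum>j\<in>Basis. fs_metric A W w j *\<^sub>R raise W j) v = fs_metric A W w v"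
    by (simp add: euclidean_representation)
qed

lemma divergence_form3:
  assumes "hermitian \<gamma>"
  shows "has_trace W (\<lambda>u v. reTr (tan_op A W u ** \<gamma> + cadjoint (tan_op A W u) ** \<gamma>) * fs_metric A W v w)
   (2 * reTr (cadjoint (tan_op A W w) ** \<gamma>))"
proof -
  define \<alpha> where "\<alpha> u = reTr (tan_op A W u ** \<gamma> + cadjoint (tan_op A W u) ** \<gamma>)" for u
  have lin: "linear \<alpha>"
    by (auto intro!: linearI simp: \<alpha>_def tan_op_linear matrix_mult_expand algebra_simps)
  have "reTr (tan_op A W w ** \<gamma>) = reTr (\<gamma> ** cadjoint (tan_op A W w))"
    using assms by (subst reTr_cadjoint[symmetric]) (simp add: cadjoint_mult hermitian_def del: reTr_cadjoint)
  then have w: "\<alpha> w = 2 * reTr (cadjoint (tan_op A W w) ** \<gamma>)"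
    by (simp add: \<alpha>_def reTr_mult_commute[of \<gamma>])
  have "bilinear (\<lambda>u v. \<alpha> u * fs_metric A W v w)"
    by (rule bilinearI)
      (auto simp: linear_add[OF lin] linear_cmul[OF lin] fs_metric_def tan_op_linear matrix_mult_expand algebra_simps)
  moreover have "(\<Sum>j\<in>Basis. \<alpha> (raise W j) * fs_metric A W j w) = \<alpha> (\<Sum>j\<in>Basis. fs_metric A W w j *\<^sub>R raise W j)"
    by (simp add: linear_sum[OF lin] linear_cmul[OF lin] fs_metric_commute[of A W w] mult.commute)
  ultimately show ?thesis
    unfolding sum_fs_metric_raise w[symmetric] by (simp add: has_trace_def \<alpha>_def)
qed

lemma laplacian_form1:
  "has_trace W (\<lambda>t u. - 2 * reTr (
     tan_op A W t ** cadjoint (tan_op A W u) ** tan_op A W v ** cadjoint (tan_op A W w) ** \<gamma>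
     - cadjoint (tan_op A W u) ** tan_op A W v ** cadjoint (tan_op A W w) ** tan_op A W t ** \<gamma>
     - cadjoint (tan_op A W t) ** tan_op A W v ** cadjoint (tan_op A W w) ** tan_op A W u ** \<gamma>
     + tan_op A W v ** cadjoint (tan_op A W w) ** tan_op A W u ** cadjoint (tan_op A W t) ** \<gamma>))
   (4 * Re (trace (proj A W ** \<gamma>) * trace (tan_op A W v ** cadjoint (tan_op A W w)))
     - 2 * real CARD('m) * form1 A \<gamma> W v w)"
proof -
  let ?H = "tan_op A W v ** cadjoint (tan_op A W w)"
  have 1: "has_trace W (\<lambda>t u. reTr (tan_op A W t ** cadjoint (tan_op A W u) ** tan_op A W v ** cadjoint (tan_op A W w) ** \<gamma>))
      (real CARD('m) * (form1 A \<gamma> W v w / 2))"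
    by (rule has_trace_cong[OF has_trace_tan_cadjoint[OF A, of W "mat 1" "?H ** \<gamma>"]])
      (simp_all add: matrix_mul_assoc trace_proj[OF A] one_minus_proj_tan_op reTr_def form1_def)
  have 2: "has_trace W (\<lambda>t u. reTr (cadjoint (tan_op A W u) ** tan_op A W v ** cadjoint (tan_op A W w) ** tan_op A W t ** \<gamma>))
      (Re (trace (proj A W ** \<gamma>) * trace ?H))"
    by (rule has_trace_cong[OF has_trace_tan_cadjoint[OF A, of W \<gamma> ?H]])
      (auto intro!: reTr_cyclic[of _ "cadjoint (tan_op A W _) ** ?H" "tan_op A W _ ** \<gamma>"]
        simp: matrix_mul_assoc one_minus_proj_tan_op)
  have 3: "has_trace W (\<lambda>t u. reTr (cadjoint (tan_op A W t) ** tan_op A W v ** cadjoint (tan_op A W w) ** tan_op A W u ** \<gamma>))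
      (Re (trace (proj A W ** \<gamma>) * trace ?H))"
    by (rule has_trace_cong[OF has_trace_cadjoint_tan[OF A, of W ?H \<gamma>]])
      (simp_all add: matrix_mul_assoc one_minus_proj_tan_op mult.commute)
  have "trace ((mat 1 - proj A W) ** (\<gamma> ** ?H)) = trace (?H ** \<gamma>)"
    by (subst trace_mul_sym, simp only: matrix_mul_assoc[symmetric] one_minus_proj_tan_op)
      (subst trace_mul_sym, simp add: matrix_mul_assoc)
  then have 4: "has_trace W (\<lambda>t u. reTr (tan_op A W v ** cadjoint (tan_op A W w) ** tan_op A W u ** cadjoint (tan_op A W t) ** \<gamma>))
      (real CARD('m) * (form1 A \<gamma> W v w / 2))"
    by (intro has_trace_cong[OF has_trace_cadjoint_tan[OF A, of W "\<gamma> ** ?H" "mat 1"]])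
      (auto intro!: reTr_cyclic[of _ "?H ** tan_op A W _" "cadjoint (tan_op A W _) ** \<gamma>"]
        simp: matrix_mul_assoc trace_proj[OF A] reTr_def[symmetric] form1_def)
  show ?thesis
    by (rule has_trace_cong[OF has_trace_cmul[OF has_trace_add[OF has_trace_diff[OF has_trace_diff[OF 1 2] 3] 4], of "-2"]])
      (auto simp: algebra_simps)
qed

lemma laplacian_form2:
  "has_trace W (\<lambda>t u. 2 * reTr (
     - (cadjoint (tan_op A W t) ** tan_op A W u ** cadjoint (tan_op A W w) ** tan_op A W v ** \<gamma>)
     + tan_op A W u ** cadjoint (tan_op A W w) ** tan_op A W v ** cadjoint (tan_op A W t) ** \<gamma>
     + tan_op A W t ** cadjoint (tan_op A W w) ** tan_op A W v ** cadjoint (tan_op A W u) ** \<gamma>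
     - cadjoint (tan_op A W w) ** tan_op A W v ** cadjoint (tan_op A W u) ** tan_op A W t ** \<gamma>))
   (4 * Re (trace ((mat 1 - proj A W) ** \<gamma>) * trace (cadjoint (tan_op A W w) ** tan_op A W v))
     - 2 * real CARD('n) * form2 A \<gamma> W v w)"
proof -
  let ?H = "cadjoint (tan_op A W w) ** tan_op A W v"
  have 1: "has_trace W (\<lambda>t u. reTr (cadjoint (tan_op A W t) ** tan_op A W u ** cadjoint (tan_op A W w) ** tan_op A W v ** \<gamma>))
      (real CARD('n) * (form2 A \<gamma> W v w / 2))"
    by (rule has_trace_cong[OF has_trace_cadjoint_tan[OF A, of W "mat 1" "?H ** \<gamma>"]])
      (simp_all add: matrix_mul_assoc trace_one_minus_proj[OF A] proj_tan_op[OF A] reTr_def form2_def)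
  have 2: "has_trace W (\<lambda>t u. reTr (tan_op A W u ** cadjoint (tan_op A W w) ** tan_op A W v ** cadjoint (tan_op A W t) ** \<gamma>))
      (Re (trace ((mat 1 - proj A W) ** \<gamma>) * trace ?H))"
    by (rule has_trace_cong[OF has_trace_cadjoint_tan[OF A, of W \<gamma> ?H]])
      (auto intro!: reTr_cyclic[of _ "tan_op A W _ ** ?H" "cadjoint (tan_op A W _) ** \<gamma>"]
        simp: matrix_mul_assoc proj_tan_op[OF A])
  have 3: "has_trace W (\<lambda>t u. reTr (tan_op A W t ** cadjoint (tan_op A W w) ** tan_op A W v ** cadjoint (tan_op A W u) ** \<gamma>))
      (Re (trace ((mat 1 - proj A W) ** \<gamma>) * trace ?H))"
    by (rule has_trace_cong[OF has_trace_tan_cadjoint[OF A, of W ?H \<gamma>]])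
      (simp_all add: matrix_mul_assoc proj_tan_op[OF A] mult.commute)
  have "trace (proj A W ** (\<gamma> ** ?H)) = trace (?H ** \<gamma>)"
    by (subst trace_mul_sym, simp only: matrix_mul_assoc[symmetric] proj_tan_op[OF A])
      (subst trace_mul_sym, simp add: matrix_mul_assoc)
  then have 4: "has_trace W (\<lambda>t u. reTr (cadjoint (tan_op A W w) ** tan_op A W v ** cadjoint (tan_op A W u) ** tan_op A W t ** \<gamma>))
      (real CARD('n) * (form2 A \<gamma> W v w / 2))"
    by (intro has_trace_cong[OF has_trace_tan_cadjoint[OF A, of W "\<gamma> ** ?H" "mat 1"]])
      (auto intro!: reTr_cyclic[of _ "?H ** cadjoint (tan_op A W _)" "tan_op A W _ ** \<gamma>"]
        simp: matrix_mul_assoc trace_one_minus_proj[OF A] reTr_def[symmetric] form2_def)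
  show ?thesis
    by (rule has_trace_cong[OF has_trace_cmul[OF has_trace_diff[OF has_trace_add[OF has_trace_add[OF
      has_trace_minus[OF 1] 2] 3] 4], of "2"]]) (auto simp: algebra_simps)
qed

lemma laplacian_form3:
  "has_trace W (\<lambda>t u. reTr (
       tan_op A W u ** cadjoint (tan_op A W t) ** \<gamma> - cadjoint (tan_op A W t) ** tan_op A W u ** \<gamma>
     + tan_op A W t ** cadjoint (tan_op A W u) ** \<gamma> - cadjoint (tan_op A W u) ** tan_op A W t ** \<gamma>)
     * fs_metric A W v w)
   (2 * (real CARD('m) * Re (trace ((mat 1 - proj A W) ** \<gamma>)) - real CARD('n) * Re (trace (proj A W ** \<gamma>)))
     * fs_metric A W v w)"
proof -
  have 1: "has_trace W (\<lambda>t u. reTr (tan_op A W u ** cadjoint (tan_op A W t) ** \<gamma>))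
      (real CARD('m) * Re (trace ((mat 1 - proj A W) ** \<gamma>)))"
    by (rule has_trace_cong[OF has_trace_cadjoint_tan[OF A, of W \<gamma> "mat 1"]])
      (auto intro!: reTr_cyclic[of _ "tan_op A W _" "cadjoint (tan_op A W _) ** \<gamma>"]
        simp: matrix_mul_assoc trace_proj[OF A])
  have 2: "has_trace W (\<lambda>t u. reTr (cadjoint (tan_op A W t) ** tan_op A W u ** \<gamma>))
      (real CARD('n) * Re (trace (proj A W ** \<gamma>)))"
    by (rule has_trace_cong[OF has_trace_cadjoint_tan[OF A, of W "mat 1" \<gamma>]])
      (simp_all add: matrix_mul_assoc trace_one_minus_proj[OF A])
  have 3: "has_trace W (\<lambda>t u. reTr (tan_op A W t ** cadjoint (tan_op A W u) ** \<gamma>))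
      (real CARD('m) * Re (trace ((mat 1 - proj A W) ** \<gamma>)))"
    by (rule has_trace_cong[OF has_trace_tan_cadjoint[OF A, of W "mat 1" \<gamma>]])
      (simp_all add: matrix_mul_assoc trace_proj[OF A])
  have 4: "has_trace W (\<lambda>t u. reTr (cadjoint (tan_op A W u) ** tan_op A W t ** \<gamma>))
      (real CARD('n) * Re (trace (proj A W ** \<gamma>)))"
    by (rule has_trace_cong[OF has_trace_tan_cadjoint[OF A, of W \<gamma> "mat 1"]])
      (auto intro!: reTr_cyclic[of _ "cadjoint (tan_op A W _)" "tan_op A W _ ** \<gamma>"]
        simp: matrix_mul_assoc trace_one_minus_proj[OF A])
  show ?thesis
    by (rule has_trace_cong[OF has_trace_cmul[OF has_trace_diff[OF has_trace_add[OF has_trace_diff[OF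
      1 2] 3] 4], of "fs_metric A W v w"]]) (auto simp: algebra_simps)
qed

text \<open>For \<open>\<gamma> = 1\<close> this is the computation of the Ricci curvature.\<close>

lemma curvature_form1:
  "has_trace W (\<lambda>a b. form1 A \<gamma> W (riemann (fs_metric A) W a v w) b)
    (2 * Re (trace (cadjoint (tan_op A W v) ** tan_op A W w) * trace ((mat 1 - proj A W) ** \<gamma>))
      + real CARD('m) * form1 A \<gamma> W w v)"
proof -
  let ?T = "tan_op A W"
  have 1: "has_trace W (\<lambda>a b. reTr (?T v ** cadjoint (?T a) ** ?T w ** cadjoint (?T b) ** \<gamma>)) 0" for v w
    by (rule has_trace_cong[OF has_trace_cadjoint_cadjoint[OF A, of W "?T w" "\<gamma> ** ?T v"]])
      (auto intro!: reTr_cyclic[of _ "?T v" "cadjoint (?T _) ** ?T w ** cadjoint (?T _) ** \<gamma>"]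
        simp: matrix_mul_assoc)
  have 2: "has_trace W (\<lambda>a b. reTr (?T a ** cadjoint (?T v) ** ?T w ** cadjoint (?T b) ** \<gamma>))
      (Re (trace (cadjoint (?T v) ** ?T w) * trace ((mat 1 - proj A W) ** \<gamma>)))"
    by (rule has_trace_cong[OF has_trace_tan_cadjoint[OF A, of W "cadjoint (?T v) ** ?T w" \<gamma>]])
      (simp_all add: matrix_mul_assoc proj_tan_op[OF A])
  have "trace ((mat 1 - proj A W) ** (\<gamma> ** ?T w ** cadjoint (?T v))) = trace (?T w ** cadjoint (?T v) ** \<gamma>)"
    by (subst trace_mul_sym, simp only: matrix_mul_assoc[symmetric] one_minus_proj_tan_op)
      (subst trace_mul_sym, simp add: matrix_mul_assoc)
  then have 3: "has_trace W (\<lambda>a b. reTr (?T w ** cadjoint (?T v) ** ?T a ** cadjoint (?T b) ** \<gamma>))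
      (real CARD('m) * (form1 A \<gamma> W w v / 2))"
    by (intro has_trace_cong[OF has_trace_tan_cadjoint[OF A, of W "mat 1" "\<gamma> ** ?T w ** cadjoint (?T v)"]])
      (auto intro!: reTr_cyclic[of _ "?T w ** cadjoint (?T v)" "?T _ ** cadjoint (?T _) ** \<gamma>"]
        simp: matrix_mul_assoc trace_proj[OF A] reTr_def[symmetric] form1_def)
  show ?thesis
    by (rule has_trace_cong[OF has_trace_cmul[OF has_trace_add[OF has_trace_add[OF has_trace_diff[OF
      has_trace_minus[OF 1[of v w]] 1[of w v]] 2] 3], of 2]])
      (auto simp: algebra_simps form1_def riemann_fs_metric[OF A] matrix_mult_expand)
qed

lemma curvature_form2:
  "has_trace W (\<lambda>a b. form2 A \<gamma> W (riemann (fs_metric A) W a v w) b)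
    (2 * Re (trace (tan_op A W w ** cadjoint (tan_op A W v)) * trace (proj A W ** \<gamma>))
      + real CARD('n) * form2 A \<gamma> W w v)"
proof -
  let ?T = "tan_op A W"
  have 1: "has_trace W (\<lambda>a b. reTr (cadjoint (?T b) ** ?T v ** cadjoint (?T a) ** ?T w ** \<gamma>)) 0" for v w
    by (rule has_trace_cong[OF has_trace_cadjoint_cadjoint[OF A, of W "?T w ** \<gamma>" "?T v"]])
      (auto intro!: reTr_cyclic[of _ "cadjoint (?T _) ** ?T v" "cadjoint (?T _) ** ?T w ** \<gamma>"]
        simp: matrix_mul_assoc)
  have 2: "has_trace W (\<lambda>a b. reTr (cadjoint (?T b) ** ?T a ** cadjoint (?T v) ** ?T w ** \<gamma>))
      (real CARD('n) * (form2 A \<gamma> W w v / 2))"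
    by (rule has_trace_cong[OF has_trace_tan_cadjoint[OF A, of W "cadjoint (?T v) ** ?T w ** \<gamma>" "mat 1"]])
      (auto intro!: reTr_cyclic[of _ "cadjoint (?T _)" "?T _ ** cadjoint (?T v) ** ?T w ** \<gamma>"]
        simp: matrix_mul_assoc proj_tan_op[OF A] trace_one_minus_proj[OF A] reTr_def[symmetric] form2_def)
  have 3: "has_trace W (\<lambda>a b. reTr (cadjoint (?T b) ** ?T w ** cadjoint (?T v) ** ?T a ** \<gamma>))
      (Re (trace (?T w ** cadjoint (?T v)) * trace (proj A W ** \<gamma>)))"
    by (rule has_trace_cong[OF has_trace_tan_cadjoint[OF A, of W \<gamma> "?T w ** cadjoint (?T v)"]])
      (auto intro!: reTr_cyclic[of _ "cadjoint (?T _) ** ?T w ** cadjoint (?T v)" "?T _ ** \<gamma>"]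
        simp: matrix_mul_assoc one_minus_proj_tan_op mult.commute)
  show ?thesis
    by (rule has_trace_cong[OF has_trace_cmul[OF has_trace_add[OF has_trace_add[OF has_trace_diff[OF
      has_trace_minus[OF 1[of v w]] 1[of w v]] 2] 3], of 2]])
      (auto simp: algebra_simps form2_def riemann_fs_metric[OF A] matrix_mult_expand)
qed

lemma curvature_fs_metric:
  "has_trace W (\<lambda>a b. fs_metric A W (riemann (fs_metric A) W a v w) b)
    ((real CARD('n) + real CARD('m)) * fs_metric A W v w)"
  by (rule has_trace_cong[OF curvature_form1[of W "mat 1" v w]])
    (simp_all add: form1_mat_1 trace_one_minus_proj[OF A] trace_tan_cadjoint_commute
      fs_metric_commute[of A W w v] algebra_simps)

end

section \<open>The deformation equations in a chart\<close>

text \<open>The bracketing is that of two successive binary linear combinations, which is how the covariant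
derivatives are assembled.\<close>

definition deform :: "complex^('m::finite + 'n::finite)^('m + 'n) \<Rightarrow> complex^('m + 'n)^('m + 'n) \<Rightarrow> (complex^'m^'n) tensor2" where
  "deform A \<gamma> W v w = real CARD('n) * (1 - (real CARD('m))\<^sup>2) * form1 A \<gamma> W v w
    + (real CARD('m) * (1 - (real CARD('n))\<^sup>2) * form2 A \<gamma> W v w
      + ((real CARD('n))\<^sup>2 - (real CARD('m))\<^sup>2) * form3 A \<gamma> W v w)"

text \<open>\<open>f\<^sub>\<gamma>\<close> is real. Hence \<open>h\<^sub>3\<close> is a real multiple of the metric, and real parts may be taken factor by
factor.\<close>

lemma hermitian_trace_mult:
  assumes "cadjoint X = X" "hermitian \<gamma>"
  shows "trace (X ** \<gamma>) = of_real (Re (trace (X ** \<gamma>)))"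
proof -
  have "cnj (trace (X ** \<gamma>)) = trace (\<gamma> ** X)"
    using assms by (simp add: trace_cadjoint[symmetric] cadjoint_mult hermitian_def)
  then have "cnj (trace (X ** \<gamma>)) = trace (X ** \<gamma>)"
    by (simp only: trace_mul_sym[of \<gamma>])
  then show ?thesis
    by (metis Reals_cnj_iff of_real_Re)
qed

lemma form1_commute:
  assumes "hermitian \<gamma>"
  shows "form1 A \<gamma> W u v = form1 A \<gamma> W v u"
  unfolding form1_def using assms
  by (subst reTr_cadjoint[symmetric], simp add: cadjoint_mult hermitian_def del: reTr_cadjoint)
    (subst reTr_mult_commute, simp add: matrix_mul_assoc)

lemma form2_commute:
  assumes "hermitian \<gamma>"
  shows "form2 A \<gamma> W u v = form2 A \<gamma> W v u"
  unfolding form2_def using assms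
  by (subst reTr_cadjoint[symmetric], simp add: cadjoint_mult hermitian_def del: reTr_cadjoint)
    (subst reTr_mult_commute, simp add: matrix_mul_assoc)

context
  fixes A \<gamma> :: "complex^('m::finite + 'n::finite)^('m + 'n)"
  assumes A: "unitary A" and \<gamma>: "hermitian \<gamma>" and tr: "trace \<gamma> = 0"
begin

lemma trace_proj_real: "trace (proj A W ** \<gamma>) = of_real (reTr (proj A W ** \<gamma>))"
  unfolding reTr_def by (rule hermitian_trace_mult) (simp_all add: \<gamma>)

lemma trace_one_minus_proj_real:
  "trace ((mat 1 - proj A W) ** \<gamma>) = - of_real (reTr (proj A W ** \<gamma>))"
  by (simp add: matrix_mult_left_distrib trace_sub trace_proj_real tr)

lemmas covariant_derivative1_deform =
  covariant_derivative1_linear[where a = "real CARD('n) * (1 - (real CARD('m))\<^sup>2)" and b = 1,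
    OF covariant_derivative_form1[OF A, of \<gamma>]
      covariant_derivative1_linear[where a = "real CARD('m) * (1 - (real CARD('n))\<^sup>2)"
        and b = "(real CARD('n))\<^sup>2 - (real CARD('m))\<^sup>2",
        OF covariant_derivative_form2[OF A, of \<gamma>] covariant_derivative_form3[OF A, of \<gamma>]],
    unfolded mult_1, folded deform_def]

lemmas covariant_derivative2_deform =
  covariant_derivative2_linear[where a = "real CARD('n) * (1 - (real CARD('m))\<^sup>2)" and b = 1,
    OF covariant_derivative2_form1[OF A, of \<gamma>]
      covariant_derivative2_linear[where a = "real CARD('m) * (1 - (real CARD('n))\<^sup>2)"
        and b = "(real CARD('n))\<^sup>2 - (real CARD('m))\<^sup>2",
        OF covariant_derivative2_form2[OF A, of \<gamma>] covariant_derivative2_form3[OF A, of \<gamma>]],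
    unfolded mult_1]

lemma metric_trace_deform: "metric_trace (fs_metric A) W (deform A \<gamma> W) = 0"
proof (rule metric_trace_eq[OF A])
  show "has_trace W (deform A \<gamma> W) 0"
    unfolding deform_def
    by (rule has_trace_cong[OF has_trace_add[OF has_trace_cmul[OF trace_form1[OF A]]
      has_trace_add[OF has_trace_cmul[OF trace_form2[OF A]] has_trace_cmul[OF trace_form3[OF A]]]] refl])
      (simp add: trace_proj_real trace_one_minus_proj_real algebra_simps power2_eq_square)
qed

lemma divergence_deform: "divergence (fs_metric A) (deform A \<gamma>) W w = 0"
  unfolding divergence_def
proof (rule metric_trace_eq[OF A])
  show "has_trace W (\<lambda>u v. nabla (fs_metric A) (deform A \<gamma>) W u v w) 0"
    unfolding nabla_eq[OF A covariant_derivative1_deform]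
    by (rule has_trace_cong[OF has_trace_add[OF has_trace_cmul[OF divergence_form1[OF A]]
      has_trace_add[OF has_trace_cmul[OF divergence_form2[OF A]]
        has_trace_cmul[OF divergence_form3[OF A \<gamma>]]]] refl])
      (simp add: algebra_simps power2_eq_square)
qed

lemma laplacian_deform:
  "connection_laplacian (fs_metric A) (deform A \<gamma>) W v w
     + 2 * curvature_op (fs_metric A) (deform A \<gamma>) W v w = 0"
proof -
  let ?a = "reTr (proj A W ** \<gamma>)"
  let ?m = "real CARD('m)" and ?n = "real CARD('n)"
  let ?c1 = "?n * (1 - ?m\<^sup>2)" and ?c2 = "?m * (1 - ?n\<^sup>2)" and ?c3 = "?n\<^sup>2 - ?m\<^sup>2"
  have "connection_laplacian (fs_metric A) (deform A \<gamma>) W v w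
    = ?c1 * (2 * ?a * fs_metric A W v w - 2 * ?m * form1 A \<gamma> W v w)
      + (?c2 * (- 2 * ?a * fs_metric A W v w - 2 * ?n * form2 A \<gamma> W v w)
       + ?c3 * (- 2 * (?m + ?n) * ?a * fs_metric A W v w))"
    unfolding connection_laplacian_def
  proof (rule metric_trace_eq[OF A])
    show "has_trace W (\<lambda>t u. nabla2 (fs_metric A) (deform A \<gamma>) W t u v w)
     (?c1 * (2 * ?a * fs_metric A W v w - 2 * ?m * form1 A \<gamma> W v w)
      + (?c2 * (- 2 * ?a * fs_metric A W v w - 2 * ?n * form2 A \<gamma> W v w)
       + ?c3 * (- 2 * (?m + ?n) * ?a * fs_metric A W v w)))"
      unfolding nabla2_eq[OF A covariant_derivative1_deform covariant_derivative2_deform]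
      by (rule has_trace_cong[OF has_trace_add[OF has_trace_cmul[OF laplacian_form1[OF A]]
        has_trace_add[OF has_trace_cmul[OF laplacian_form2[OF A]]
          has_trace_cmul[OF laplacian_form3[OF A]]]] refl])
        (simp add: trace_proj_real trace_one_minus_proj_real trace_tan_cadjoint_commute
          algebra_simps power2_eq_square)
  qed
  moreover have "curvature_op (fs_metric A) (deform A \<gamma>) W v w
    = ?c1 * (- ?a * fs_metric A W v w + ?m * form1 A \<gamma> W v w)
      + (?c2 * (?a * fs_metric A W v w + ?n * form2 A \<gamma> W v w)
       + ?c3 * (?a * ((?n + ?m) * fs_metric A W v w)))"
    unfolding curvature_op_def
  proof (rule metric_trace_eq[OF A])
    show "has_trace W (\<lambda>a b. deform A \<gamma> W (riemann (fs_metric A) W a v w) b)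
     (?c1 * (- ?a * fs_metric A W v w + ?m * form1 A \<gamma> W v w)
      + (?c2 * (?a * fs_metric A W v w + ?n * form2 A \<gamma> W v w)
       + ?c3 * (?a * ((?n + ?m) * fs_metric A W v w))))"
      unfolding deform_def form3_def
      by (rule has_trace_cong[OF has_trace_add[OF has_trace_cmul[OF curvature_form1[OF A]]
        has_trace_add[OF has_trace_cmul[OF curvature_form2[OF A]]
          has_trace_cmul[OF has_trace_cmul[OF curvature_fs_metric[OF A]]]]] refl])
        (simp add: trace_proj_real trace_one_minus_proj_real trace_tan_cadjoint_commute
          form1_commute[OF \<gamma>, of A W w v] form2_commute[OF \<gamma>, of A W w v]
          fs_metric_commute[of A W w v] algebra_simps power2_eq_square)
  qed
  ultimately show ?thesis
    by (simp add: algebra_simps)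
qed

end

lemma fs_metric_bilinear: "bilinear (fs_metric A W)"
  by (rule bilinearI) (auto simp: fs_metric_def tan_op_linear matrix_mult_expand algebra_simps)

context
  fixes A :: "complex^('m::finite + 'n::finite)^('m + 'n)"
  assumes A: "unitary A"
begin

lemma fs_metric_positive:
  assumes "u \<noteq> 0"
  shows "fs_metric A W u u > 0"
proof -
  have "tan_op A W u \<noteq> 0"
    using frames_recover[OF A, of W u] assms by auto
  then show ?thesis
    by (simp add: fs_metric_def flip: inner_eq_reTr)
qed

lemma ricci_fs_metric: "ricci (fs_metric A) W u v = (real CARD('n) + real CARD('m)) * fs_metric A W u v"
proof -
  have "curvature_op (fs_metric A) (fs_metric A) W = ricci (fs_metric A) W"
    by (rule curvature_op_metric[OF fs_metric_bilinear fs_metric_positive])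
  then have "ricci (fs_metric A) W u v = curvature_op (fs_metric A) (fs_metric A) W u v"
    by simp
  also have "\<dots> = (real CARD('n) + real CARD('m)) * fs_metric A W u v"
    unfolding curvature_op_def by (rule metric_trace_eq[OF A curvature_fs_metric[OF A]])
  finally show ?thesis .
qed

end

section \<open>Orthonormal frames\<close>

definition orthonormal :: "(complex^'a::finite) set \<Rightarrow> bool" where
  "orthonormal B \<longleftrightarrow> (\<forall>x\<in>B. \<forall>y\<in>B. hinner x y = (if x = y then 1 else 0))"

lemma hinner_linear [simp]:
  "hinner (x + y) z = hinner x z + hinner y z" "hinner (x - y) z = hinner x z - hinner y z"
  "hinner (c *s x) z = c * hinner x z" "hinner 0 z = 0"
  by (simp_all add: hinner_def sum.distrib sum_subtractf algebra_simps sum_distrib_left)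

lemma hinner_sum: "hinner (sum f S) z = (\<Sum>x\<in>S. hinner (f x) z)"
  by (induction S rule: infinite_finite_induct) simp_all

lemma hinner_commute: "hinner x y = cnj (hinner y x)"
  by (simp add: hinner_def mult.commute)

lemma hinner_self: "hinner x x = of_real (\<Sum>k\<in>UNIV. (cmod (x $ k))\<^sup>2)"
  by (simp add: hinner_def complex_norm_square flip: of_real_power)

lemma hinner_self_eq_0_iff [simp]: "hinner x x = 0 \<longleftrightarrow> x = 0"
  unfolding hinner_self of_real_eq_0_iff by (simp add: sum_nonneg_eq_0_iff vec_eq_iff)

lemma orthonormal_independent:
  assumes "orthonormal B"
  shows "vec.independent B"
  unfolding vec.independent_explicit_finite_subsets
proof (intro allI impI ballI)
  fix S u v
  assume S: "S \<subseteq> B" "finite S" "(\<Sum>v\<in>S. u v *s v) = 0" "v \<in> S"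
  have "0 = hinner (\<Sum>x\<in>S. u x *s x) v"
    using S by simp
  also have "\<dots> = (\<Sum>x\<in>S. if x = v then u x else 0)"
    unfolding hinner_sum using S assms by (intro sum.cong) (auto simp: orthonormal_def subset_eq)
  finally show "u v = 0"
    using S by simp
qed

text \<open>An orthonormal subset of \<open>V\<close> of maximal cardinality spans \<open>V\<close>: otherwise the normalised
  component orthogonal to it of a vector outside the span could be added.\<close>

lemma orthonormal_extend:
  fixes V :: "(complex^'a::finite) set"
  assumes V: "vec.subspace V" and B: "orthonormal B" "B \<subseteq> V"
  obtains B' where "B \<subseteq> B'" "orthonormal B'" "B' \<subseteq> V" "vec.span B' = V"
proof -
  let ?P = "\<lambda>B'. B \<subseteq> B' \<and> orthonormal B' \<and> B' \<subseteq> V"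
  have "card B' < Suc (vec.dim V)" if "?P B'" for B'
    using vec.independent_card_le_dim[of B' V] that orthonormal_independent[of B'] by (simp add: less_Suc_eq_le)
  then obtain B' where P: "?P B'" and max: "\<And>B''. ?P B'' \<Longrightarrow> card B'' \<le> card B'"
    using ex_has_greatest_nat[of ?P B card "Suc (vec.dim V)"] B by auto
  have fin: "finite B'"
    using P orthonormal_independent vec.finiteI_independent by blast
  have "vec.span B' = V"
  proof (rule ccontr)
    assume "vec.span B' \<noteq> V"
    moreover have "vec.span B' \<subseteq> V"
      using P V vec.span_minimal by blast
    ultimately obtain x where x: "x \<in> V" "x \<notin> vec.span B'" by blast
    define y where "y = x - (\<Sum>b\<in>B'. hinner x b *s b)"
    have sp: "(\<Sum>b\<in>B'. hinner x b *s b) \<in> vec.span B'"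
      by (intro vec.span_sum vec.span_scale vec.span_base)
    have y0: "y \<noteq> 0"
      using sp x by (auto simp: y_def)
    have yV: "y \<in> V"
      unfolding y_def using sp x \<open>vec.span B' \<subseteq> V\<close> V by (intro vec.subspace_diff) auto
    have orth: "hinner y c = 0" if "c \<in> B'" for c
    proof -
      have "hinner (\<Sum>b\<in>B'. hinner x b *s b) c = (\<Sum>b\<in>B'. if b = c then hinner x c else 0)"
        unfolding hinner_sum using that P by (intro sum.cong) (auto simp: orthonormal_def)
      then show ?thesis
        using that fin by (simp add: y_def)
    qed
    define s where "s = (\<Sum>k\<in>UNIV. (cmod (y $ k))\<^sup>2)"
    have yy: "hinner y y = of_real s"
      by (simp add: hinner_self s_def)
    have "s > 0"
      using y0 yy hinner_self_eq_0_iff[of y] unfolding s_def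
      by (metis (no_types, lifting) of_real_0 order_le_less sum_nonneg zero_le_power2)
    define z where "z = of_real (1 / sqrt s) *s y"
    have zz: "hinner z z = 1"
    proof -
      have "hinner z z = of_real (1 / sqrt s) * cnj (of_real (1 / sqrt s) * hinner y y)"
        unfolding z_def hinner_linear by (subst hinner_commute) (simp add: z_def)
      also have "\<dots> = of_real ((1 / sqrt s) * ((1 / sqrt s) * s))"
        unfolding yy by (simp only: of_real_mult[symmetric] complex_cnj_complex_of_real)
      also have "(1 / sqrt s) * ((1 / sqrt s) * s) = 1"
        using \<open>s > 0\<close> by (simp add: field_simps)
      finally show ?thesis by simp
    qed
    have zo: "hinner z c = 0" "hinner c z = 0" if "c \<in> B'" for c
      using orth[OF that] hinner_commute[of c z] by (simp_all add: z_def)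
    have "z \<notin> B'"
      using zo(1)[of z] zz by auto
    moreover have "?P (insert z B')"
      using P zz zo \<open>z \<notin> B'\<close> vec.subspace_scale[OF V yV]
      by (auto simp: orthonormal_def z_def)
    ultimately show False
      using max[of "insert z B'"] fin by simp
  qed
  with P show ?thesis using that by blast
qed

lemma exists_orthonormal_frame:
  fixes V :: "(complex^'a::finite) set"
  assumes V: "vec.subspace V" and "vec.dim V = CARD('m::finite)"
  shows "\<exists>\<eta> :: 'm \<Rightarrow> complex^'a. is_orthonormal_frame V \<eta>"
proof -
  obtain B where B: "orthonormal B" "B \<subseteq> V" "vec.span B = V"
    using orthonormal_extend[OF V, of "{}"] by (auto simp: orthonormal_def)
  have ind: "vec.independent B"
    using B orthonormal_independent by blast
  then have "card B = CARD('m)" "finite B"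
    using B assms vec.dim_span_eq_card_independent vec.finiteI_independent by force+
  then obtain \<eta> :: "'m \<Rightarrow> complex^'a" where \<eta>: "bij_betw \<eta> UNIV B"
    using finite_same_card_bij[of "UNIV :: 'm set" B] by auto
  then have "hinner (\<eta> i) (\<eta> j) = (if i = j then 1 else 0)" for i j
    using B(1) by (auto simp: orthonormal_def bij_betw_def inj_on_def)
  moreover have "vec.span (range \<eta>) = V"
    using \<eta> B by (simp add: bij_betw_def)
  ultimately show ?thesis
    unfolding is_orthonormal_frame_def by blast
qed

section \<open>The tensor fields as matrix expressions\<close>

lemma hinner_eq_matrix: "hinner v w = (\<Sum>k\<in>UNIV. cnj (w $ k) * v $ k)"
  by (simp add: hinner_def mult.commute)

lemma hinner_columns: "hinner (column i X) (column j Y) = (cadjoint Y ** X) $ j $ i"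
  by (simp add: hinner_eq_matrix matrix_matrix_mult_def cadjoint_def column_def)

lemma frameC_column: "c_frame A W j = column j (frameC A W)"
proof -
  have "axis (Inl j) 1 + (\<Sum>r\<in>UNIV. W $ r $ j *s axis (Inr r) 1) = column j (vstack (mat 1) W)"
    by (auto simp: vec_eq_iff column_def vstack_def axis_def mat_def if_distrib cong: if_cong split: sum.split)
  then show ?thesis
    by (simp add: c_frame_def frameC_def vec_eq_iff column_def matrix_vector_mult_def matrix_matrix_mult_def)
qed

lemma frameK_column: "q_frame A W j = column j (frameK A W)"
proof -
  have "- (\<Sum>r\<in>UNIV. cnj (W $ j $ r) *s axis (Inl r) 1) + axis (Inr j) 1 = column j (vstack (- cadjoint W) (mat 1))"
    by (auto simp: vec_eq_iff column_def vstack_def axis_def mat_def cadjoint_def if_distrib cong: if_cong split: sum.split)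
  then show ?thesis
    by (simp add: q_frame_def frameK_def vec_eq_iff column_def matrix_vector_mult_def matrix_matrix_mult_def)
qed

lemma matrix_vector_mult_columns: "(M :: complex^'b^'a) *v z = (\<Sum>j\<in>UNIV. z $ j *s column j M)"
  by (simp add: vec_eq_iff matrix_vector_mult_def column_def mult.commute)

lemma span_columns: "vec.span (range (\<lambda>j. column j (M :: complex^'b^'a))) = range ((*v) M)"
proof
  have "vec.subspace (range ((*v) M))"
  proof (rule vec.subspaceI)
    show "0 \<in> range ((*v) M)" by (metis matrix_vector_mult_0_right rangeI)
    show "x + y \<in> range ((*v) M)" if "x \<in> range ((*v) M)" "y \<in> range ((*v) M)" for x y
      using that by (auto simp: matrix_vector_right_distrib[symmetric])
    show "c *s x \<in> range ((*v) M)" if "x \<in> range ((*v) M)" for c x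
      using that by (auto simp: vector_scalar_commute[symmetric])
  qed
  moreover have "column j M = M *v axis j 1" for j
    by (simp add: vec_eq_iff matrix_vector_mult_def column_def axis_def if_distrib cong: if_cong)
  ultimately show "vec.span (range (\<lambda>j. column j M)) \<subseteq> range ((*v) M)"
    by (intro vec.span_minimal) auto
  show "range ((*v) M) \<subseteq> vec.span (range (\<lambda>j. column j M))"
    unfolding matrix_vector_mult_columns
    by (intro image_subsetI vec.span_sum vec.span_scale vec.span_base rangeI)
qed

lemma plane_eq: "plane A W = range ((*v) (frameC A W))"
  unfolding plane_def frameC_column[abs_def] by (rule span_columns)

lemma subspace_plane: "vec.subspace (plane A W)"
  by (simp add: plane_def)

lemma riesz_vector_self:
  assumes "vec.subspace V" "w \<in> V"
  shows "riesz_vector V (\<lambda>v. hinner v w) = w"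
  unfolding riesz_vector_def
proof (rule the_equality)
  fix w'
  assume w': "w' \<in> V \<and> (\<forall>v\<in>V. hinner v w = hinner v w')"
  then have "w' - w \<in> V"
    using assms by (simp add: vec.subspace_diff)
  then have "hinner (w' - w) w = hinner (w' - w) w'"
    using w' by blast
  then have "hinner w (w' - w) = hinner w' (w' - w)"
    by (metis hinner_commute)
  then have "hinner (w' - w) (w' - w) = 0"
    by (simp only: hinner_linear(2) diff_self)
  then show "w' = w"
    unfolding hinner_self_eq_0_iff by simp
qed (use assms in simp)

lemma P_form_mat_1: "P_form (mat 1) = hinner"
  by (simp add: P_form_def fun_eq_iff)

lemma matrix_mult_vector: "(M ** N) *v x = M *v (N *v x)"
  by (simp add: matrix_vector_mul_assoc)

context
  fixes A :: "complex^('m::finite + 'n::finite)^('m + 'n)"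
  assumes A: "unitary A"
begin

lemma dualC_c_frame: "cadjoint (dualC A W) *v (frameC A W *v z) = z"
  by (simp add: matrix_vector_mul_assoc frame_dual[OF A])

lemma c_frame_axis: "cadjoint (dualC A W) *v c_frame A W j = axis j 1"
proof -
  have "c_frame A W j = frameC A W *v axis j 1"
    by (simp add: frameC_column vec_eq_iff matrix_vector_mult_def column_def axis_def if_distrib cong: if_cong)
  then show ?thesis by (simp add: dualC_c_frame)
qed

lemma inj_c_frame: "inj (c_frame A W)"
  by (rule injI) (metis c_frame_axis axis_eq_axis zero_neq_one)

lemma independent_c_frame: "vec.independent (range (c_frame A W))"
proof (rule vec.independent_if_scalars_zero)
  fix f x
  assume f: "(\<Sum>x\<in>range (c_frame A W). f x *s x) = 0" and "x \<in> range (c_frame A W)"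
  then obtain i where i: "x = c_frame A W i" by blast
  have "frameC A W *v (\<chi> j. f (c_frame A W j)) = 0"
    using f by (simp add: sum.reindex[OF inj_c_frame] matrix_vector_mult_columns frameC_column[symmetric])
  then have "(\<chi> j. f (c_frame A W j)) = 0"
    by (metis dualC_c_frame matrix_vector_mult_0_right)
  then show "f x = 0"
    unfolding i by (simp add: vec_eq_iff)
qed simp

lemma dim_plane: "vec.dim (plane A W) = CARD('m)"
  unfolding plane_def
  by (simp add: vec.dim_eq_card_independent[OF independent_c_frame] card_image[OF inj_c_frame])

lemma plane_in_grassmannian: "plane A W \<in> grassmannian"
  by (simp add: grassmannian_def subspace_plane dim_plane)

lemma c_coframe_eq:
  assumes "v \<in> plane A W"
  shows "c_coframe A W j v = (cadjoint (dualC A W) *v v) $ j"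
proof -
  obtain z where v: "v = frameC A W *v z"
    using assms by (auto simp: plane_eq)
  have "vec.representation (range (c_frame A W)) v
    = (\<lambda>b. \<Sum>i\<in>UNIV. z $ i * (if b = c_frame A W i then 1 else 0))"
    unfolding v matrix_vector_mult_columns frameC_column[symmetric]
    by (simp add: vec.representation_sum[OF independent_c_frame] vec.span_scale vec.span_base
      vec.representation_scale[OF independent_c_frame] vec.representation_basis[OF independent_c_frame])
  then have "c_coframe A W j v = (\<Sum>i\<in>UNIV. z $ i * (if j = i then 1 else 0))"
    by (simp add: c_coframe_def inj_eq[OF inj_c_frame])
  also have "\<dots> = (\<Sum>i\<in>UNIV. if i = j then z $ j else 0)"
    by (rule sum.cong) auto
  finally have "c_coframe A W j v = z $ j"
    by simp
  then show ?thesis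
    by (simp add: v dualC_c_frame)
qed

lemma matrix_inv_Q_gram: "matrix_inv (Q_gram A W) $ i $ k = gramK_inv W $ k $ i"
proof -
  have "Q_gram A W = transpose (mat 1 + W ** cadjoint W)"
    unfolding gram_frames(2)[OF A, symmetric]
    by (simp add: Q_gram_def vec_eq_iff transpose_def frameK_column column_def matrix_matrix_mult_def
        cadjoint_def hinner_eq_matrix)
  then have "Q_gram A W ** transpose (gramK_inv W) = transpose (gramK_inv W ** (mat 1 + W ** cadjoint W))"
    by (simp add: matrix_transpose_mul)
  also have "gramK_inv W ** (mat 1 + W ** cadjoint W) = mat 1"
    using gramK_inv_left[of W] by (simp add: matrix_mult_expand)
  finally have "matrix_inv (Q_gram A W) = transpose (gramK_inv W)"
    by (intro matrix_inv_unique) simp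
  then show ?thesis by (simp add: transpose_def)
qed

text \<open>Restricted to the plane, the tangent vectors of the tautological description are the matrices
\<open>T\<^sub>X\<close>.\<close>

lemma tangent_eq:
  assumes "v \<in> plane A W"
  shows "tangent A W u v = tan_op A W u *v v"
proof -
  have "(\<Sum>k\<in>UNIV. matrix_inv (Q_gram A W) $ i $ k *s q_frame A W k) = column i (dualK A W)" for i
    by (simp add: vec_eq_iff matrix_inv_Q_gram frameK_column column_def dualK_def matrix_matrix_mult_def mult.commute)
  then have "tangent A W u v = (\<Sum>i\<in>UNIV. (u *v (cadjoint (dualC A W) *v v)) $ i *s column i (dualK A W))"
    unfolding tangent_def c_coframe_eq[OF assms]
    by (simp add: vec_eq_iff sum_distrib_right matrix_vector_mult_def[of u])
  also have "\<dots> = tan_op A W u *v v"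
    by (simp add: matrix_vector_mult_columns[symmetric] tan_op_def matrix_vector_mul_assoc matrix_mul_assoc)
  finally show ?thesis .
qed

lemma is_orthonormal_frame_plane:
  "is_orthonormal_frame (plane A W) (orthonormal_frame (plane A W) :: 'm \<Rightarrow> _)"
  unfolding orthonormal_frame_def
  using exists_orthonormal_frame[OF subspace_plane dim_plane] by (rule someI_ex)

lemma orthonormal_frame_matrix:
  fixes \<eta> :: "'m \<Rightarrow> complex^('m + 'n)"
  assumes "is_orthonormal_frame (plane A W) \<eta>"
  defines "N \<equiv> (\<chi> k i. \<eta> i $ k)"
  shows "N ** cadjoint N = proj A W"
proof -
  have N: "column i N = \<eta> i" for i
    by (simp add: N_def column_def vec_eq_iff)
  have NN: "cadjoint N ** N = mat 1"
    using assms(1) unfolding is_orthonormal_frame_def hinner_eq_matrix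
    by (auto simp: vec_eq_iff matrix_matrix_mult_def cadjoint_def mat_def N_def)
  have rng: "range ((*v) N) = range ((*v) (frameC A W))"
    using assms(1) unfolding span_columns[symmetric] N plane_def[symmetric] frameC_column[symmetric]
    by (simp add: is_orthonormal_frame_def)
  have "N ** cadjoint N ** frameC A W = frameC A W"
  proof (subst matrix_eq, intro allI)
    fix z
    obtain y where "frameC A W *v z = N *v y"
      using rng by blast
    then show "N ** cadjoint N ** frameC A W *v z = frameC A W *v z"
      by (metis NN matrix_vector_mul_assoc matrix_vector_mul_lid)
  qed
  then have 1: "N ** cadjoint N ** proj A W = proj A W"
    by (simp add: proj_eq matrix_mul_assoc)
  have "proj A W ** N = N"
  proof (subst matrix_eq, intro allI)
    fix z
    obtain y where "N *v z = frameC A W *v y"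
      using rng by blast
    then show "proj A W ** N *v z = N *v z"
      by (metis proj_eq dualC_c_frame matrix_vector_mul_assoc)
  qed
  then have "cadjoint N ** proj A W = cadjoint N"
    by (metis cadjoint_mult cadjoint_proj)
  with 1 show ?thesis
    by (metis matrix_mul_assoc)
qed

text \<open>With the orthonormal frame as the columns of \<open>N\<close>, the double sum is the trace of a product of two
matrices of the form \<open>N\<^sup>* _ N\<close>, and \<open>N N\<^sup>*\<close> is the orthogonal projection whatever the frame.\<close>

lemma product_form_eq:
  "product_form (dual_form (P_form \<alpha>) (plane A W)) (P_form \<beta>) (plane A W) (tangent A W u) (tangent A W v)
    = trace (cadjoint (tan_op A W v) ** \<beta> ** tan_op A W u ** \<alpha>)"
proof -
  define \<eta> :: "'m \<Rightarrow> complex^('m + 'n)" where "\<eta> = orthonormal_frame (plane A W)"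
  define N where "N = (\<chi> k i. \<eta> i $ k)"
  have on: "is_orthonormal_frame (plane A W) \<eta>"
    unfolding \<eta>_def by (rule is_orthonormal_frame_plane)
  then have "plane A W = vec.span (range \<eta>)"
    by (simp add: is_orthonormal_frame_def)
  then have \<eta>: "\<eta> i \<in> plane A W" for i
    by (simp add: vec.span_base)
  let ?T = "tan_op A W"
  have P: "P_form M (X *v \<eta> i) (Y *v \<eta> j) = (cadjoint N ** (cadjoint Y ** M ** X) ** N) $ j $ i" for M X Y i j
  proof -
    have "X *v \<eta> i = column i (X ** N)" for X i
      by (simp add: vec_eq_iff column_def matrix_matrix_mult_def matrix_vector_mult_def N_def)
    then have "P_form M (X *v \<eta> i) (Y *v \<eta> j) = hinner (column i (M ** X ** N)) (column j (Y ** N))"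
      unfolding P_form_def by (metis matrix_vector_mul_assoc)
    also have "\<dots> = (cadjoint (Y ** N) ** (M ** X ** N)) $ j $ i"
      by (rule hinner_columns)
    finally show ?thesis
      by (simp add: cadjoint_mult matrix_mul_assoc)
  qed
  have "product_form (dual_form (P_form \<alpha>) (plane A W)) (P_form \<beta>) (plane A W) (tangent A W u) (tangent A W v)
    = (\<Sum>i\<in>UNIV. \<Sum>j\<in>UNIV. P_form \<alpha> (mat 1 *v \<eta> j) (mat 1 *v \<eta> i) * P_form \<beta> (?T u *v \<eta> i) (?T v *v \<eta> j))"
    unfolding product_form_def \<eta>_def[symmetric] Let_def dual_form_def
    by (simp add: riesz_vector_self[OF subspace_plane \<eta>] tangent_eq[OF \<eta>])
  also have "\<dots> = (\<Sum>i\<in>UNIV. \<Sum>j\<in>UNIV. (cadjoint N ** \<alpha> ** N) $ i $ j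
      * (cadjoint N ** (cadjoint (?T v) ** \<beta> ** ?T u) ** N) $ j $ i)"
    unfolding P by simp
  also have "\<dots> = trace (cadjoint N ** \<alpha> ** N ** (cadjoint N ** (cadjoint (?T v) ** \<beta> ** ?T u) ** N))"
    by (simp add: trace_def matrix_matrix_mult_def[of "cadjoint N ** \<alpha> ** N"])
  also have "\<dots> = trace (\<alpha> ** ((N ** cadjoint N) ** cadjoint (?T v)) ** \<beta> ** (?T u ** (N ** cadjoint N)))"
    by (simp only: matrix_mul_assoc[symmetric]) (subst trace_mul_sym, simp only: matrix_mul_assoc)
  also have "N ** cadjoint N = proj A W"
    unfolding N_def by (rule orthonormal_frame_matrix[OF on])
  also have "trace (\<alpha> ** (proj A W ** cadjoint (?T v)) ** \<beta> ** (?T u ** proj A W))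
     = trace (cadjoint (?T v) ** \<beta> ** ?T u ** \<alpha>)"
    unfolding proj_tan_op[OF A]
    by (simp only: matrix_mul_assoc[symmetric]) (subst trace_mul_sym, simp only: matrix_mul_assoc)
  finally show ?thesis .
qed

lemma f_fun_eq: "f_fun \<gamma> (plane A W) = trace (proj A W ** \<gamma>)"
proof -
  define \<eta> :: "'m \<Rightarrow> complex^('m + 'n)" where "\<eta> = orthonormal_frame (plane A W)"
  define N where "N = (\<chi> k i. \<eta> i $ k)"
  have "P_form \<gamma> (\<eta> i) (\<eta> i) = (cadjoint N ** (\<gamma> ** N)) $ i $ i" for i
    by (simp add: P_form_def hinner_eq_matrix cadjoint_def N_def matrix_matrix_mult_def matrix_vector_mult_def)
  then have "f_fun \<gamma> (plane A W) = trace (cadjoint N ** (\<gamma> ** N))"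
    by (simp add: f_fun_def \<eta>_def[symmetric] trace_def)
  also have "\<dots> = trace (\<gamma> ** (N ** cadjoint N))"
    by (subst trace_mul_sym) (simp add: matrix_mul_assoc)
  also have "N ** cadjoint N = proj A W"
    unfolding N_def \<eta>_def by (rule orthonormal_frame_matrix[OF is_orthonormal_frame_plane])
  finally show ?thesis
    by (simp add: trace_mul_sym[of \<gamma>])
qed

lemma fubini_study_eq:
  "fubini_study (plane A W) (tangent A W u) (tangent A W v) = trace (tan_op A W u ** cadjoint (tan_op A W v))"
  using product_form_eq[of "mat 1" W "mat 1" u v]
  by (simp add: P_form_mat_1 fubini_study_def) (subst trace_mul_sym, rule refl)

lemma real_tensor_fubini_study: "real_tensor fubini_study A = fs_metric A"
  by (simp add: fun_eq_iff real_tensor_def fubini_study_eq fs_metric_def reTr_def)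

lemma real_tensor_deformation:
  assumes "hermitian \<gamma>"
  shows "real_tensor (deformation \<gamma>) A = deform A \<gamma>"
proof (intro ext)
  fix W u v
  let ?m = "real CARD('m)" and ?n = "real CARD('n)"
  have 1: "h1 \<gamma> (plane A W) (tangent A W u) (tangent A W v) = trace (tan_op A W u ** cadjoint (tan_op A W v) ** \<gamma>)"
    using product_form_eq[of "mat 1" W \<gamma> u v]
    by (simp add: P_form_mat_1 h1_def) (subst trace_mul_sym, simp add: matrix_mul_assoc)
  have 2: "h2 \<gamma> (plane A W) (tangent A W u) (tangent A W v) = trace (cadjoint (tan_op A W v) ** tan_op A W u ** \<gamma>)"
    using product_form_eq[of \<gamma> W "mat 1" u v] by (simp add: P_form_mat_1 h2_def)
  have 3: "f_fun \<gamma> (plane A W) = of_real (reTr (proj A W ** \<gamma>))"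
    unfolding f_fun_eq reTr_def using assms by (intro hermitian_trace_mult) simp_all
  have c: "of_nat CARD('n) * (1 - (of_nat CARD('m))\<^sup>2) = complex_of_real (?n * (1 - ?m\<^sup>2))"
    "of_nat CARD('m) * (1 - (of_nat CARD('n))\<^sup>2) = complex_of_real (?m * (1 - ?n\<^sup>2))"
    "(of_nat CARD('n))\<^sup>2 - (of_nat CARD('m))\<^sup>2 = complex_of_real (?n\<^sup>2 - ?m\<^sup>2)"
    by simp_all
  show "real_tensor (deformation \<gamma>) A W u v = deform A \<gamma> W u v"
    unfolding real_tensor_def deformation_def Let_def c h3_def 1 2 3 fubini_study_eq
    by (simp add: deform_def form1_def form2_def form3_def fs_metric_def reTr_def algebra_simps
        del: of_real_mult of_real_diff of_real_power)
qed

end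

section \<open>Coordinate changes\<close>

lemma range_proj:
  assumes A: "unitary A"
  shows "range ((*v) (proj A W)) = plane A W"
proof -
  have "frameC A W *v z = proj A W *v (frameC A W *v z)" for z
    unfolding proj_eq by (simp only: matrix_mult_vector dualC_c_frame[OF A])
  moreover have "proj A W *v z = frameC A W *v (cadjoint (dualC A W) *v z)" for z
    unfolding proj_eq by (rule matrix_mult_vector)
  ultimately show ?thesis
    unfolding plane_eq by (metis (no_types, lifting) image_subsetI rangeI subset_antisym)
qed

text \<open>The orthogonal projection as a function of the plane alone, independent of charts.\<close>

definition orth_proj :: "(complex^('m::finite + 'n::finite)) set \<Rightarrow> complex^('m + 'n)^('m + 'n)" where
  "orth_proj V = (\<chi> k i. orthonormal_frame V (i::'m) $ k) ** cadjoint (\<chi> k i. orthonormal_frame V (i::'m) $ k)"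

lemma orth_proj_plane: "unitary A \<Longrightarrow> orth_proj (plane A W) = proj A W"
  unfolding orth_proj_def by (rule orthonormal_frame_matrix[OF _ is_orthonormal_frame_plane])

lemma plane_eq_iff:
  assumes "unitary A" "unitary B"
  shows "plane A W = plane B W' \<longleftrightarrow> proj A W = proj B W'"
  using assms by (metis orth_proj_plane range_proj)

lemma proj_frameC: "unitary A \<Longrightarrow> proj A W ** frameC A W = frameC A W"
  by (simp add: proj_eq frame_dual matrix_mul_assoc[symmetric])

text \<open>The frame of a plane in the chart \<open>A\<close>, expressed in the basis of the chart \<open>B\<close>. The plane lies in the
second chart exactly when the upper block is invertible, and its new coordinate is then the lower
block times the inverse of the upper one.\<close>

definition block :: "complex^('m + 'n)^('m + 'n) \<Rightarrow> complex^('m + 'n)^('m + 'n) \<Rightarrow> complex^'m^'n \<Rightarrow>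
    complex^'m::finite^('m + 'n::finite)" where
  "block A B W = cadjoint B ** frameC A W"

lemma plane_eq_imp:
  assumes A: "unitary A" and B: "unitary B" and eq: "plane A W = plane B W'"
  shows "det (upper (block A B W)) \<noteq> 0" and "lower (block A B W) = W' ** upper (block A B W)"
proof -
  \<comment> \<open>Both frames span the same plane; \<open>G\<close> and \<open>G'\<close> are the matrices of the change of frame.\<close>
  define G where "G = cadjoint (dualC B W') ** frameC A W"
  define G' where "G' = cadjoint (dualC A W) ** frameC B W'"
  have p: "proj A W = proj B W'"
    using eq plane_eq_iff[OF A B] by blast
  have 1: "frameC A W = frameC B W' ** G"
    using proj_frameC[OF A, of W] unfolding p by (simp add: proj_eq G_def matrix_mul_assoc)
  have 2: "frameC B W' = frameC A W ** G'"
    using proj_frameC[OF B, of W'] unfolding p[symmetric] by (simp add: proj_eq G'_def matrix_mul_assoc)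
  have "mat 1 = cadjoint (dualC A W) ** (frameC A W ** G' ** G)"
    using 1 2 by (simp add: frame_dual[OF A])
  also have "\<dots> = G' ** G"
    by (simp add: matrix_mul_assoc frame_dual[OF A])
  finally have "det G \<noteq> 0"
    using invertible_det_nz invertible_left_inverse by metis
  have "block A B W = (cadjoint B ** B) ** vstack (mat 1) W' ** G"
    unfolding block_def 1 by (simp add: frameC_def matrix_mul_assoc)
  also have "\<dots> = vstack G (W' ** G)"
    using B by (simp add: unitary_def vstack_mult)
  finally have "upper (block A B W) = G" "lower (block A B W) = W' ** G"
    by simp_all
  then show "det (upper (block A B W)) \<noteq> 0" "lower (block A B W) = W' ** upper (block A B W)"
    using \<open>det G \<noteq> 0\<close> by simp_all
qed

lemma plane_eqI:
  assumes A: "unitary A" and B: "unitary B" and nz: "det (upper (block A B W)) \<noteq> 0"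
  shows "plane A W = plane B (lower (block A B W) ** matrix_inv (upper (block A B W)))"
proof -
  define X Y where "X = upper (block A B W)" and "Y = lower (block A B W)"
  have inv: "matrix_inv X ** X = mat 1" "X ** matrix_inv X = mat 1"
    using nz by (simp_all add: X_def matrix_inv_left matrix_inv_right)
  have "frameC B (Y ** matrix_inv X) ** X = B ** vstack X Y"
    by (simp add: frameC_def matrix_mul_assoc[symmetric] vstack_mult inv)
  also have "\<dots> = (B ** cadjoint B) ** frameC A W"
    by (simp add: X_def Y_def vstack_upper_lower block_def matrix_mul_assoc)
  finally have 1: "frameC A W = frameC B (Y ** matrix_inv X) ** X"
    by (simp add: unitary_right[OF B])
  then have 2: "frameC B (Y ** matrix_inv X) = frameC A W ** matrix_inv X"
    by (simp add: inv matrix_mul_assoc[symmetric])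
  have "plane A W \<subseteq> plane B (Y ** matrix_inv X)"
    unfolding plane_eq by (subst 1) (auto simp: matrix_mult_vector)
  moreover have "plane B (Y ** matrix_inv X) \<subseteq> plane A W"
    unfolding plane_eq by (subst 2) (auto simp: matrix_mult_vector)
  ultimately show ?thesis
    unfolding X_def Y_def by blast
qed

lemma inj_plane:
  assumes A: "unitary A"
  shows "inj (plane A)"
proof (rule injI)
  fix W W'
  assume "plane A W = plane A W'"
  from plane_eq_imp(2)[OF A A this] have "lower (block A A W) = W' ** upper (block A A W)" .
  moreover have "block A A W = vstack (mat 1) W"
    using A by (simp add: block_def frameC_def matrix_mul_assoc unitary_def)
  ultimately show "W = W'" by simp
qed

lemma overlap_eq:
  assumes A: "unitary A" and B: "unitary B"
  shows "overlap (\<lambda>_. UNIV) plane A B = {W. det (upper (block A B W)) \<noteq> 0}"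
  unfolding overlap_def using plane_eq_imp(1)[OF A B] plane_eqI[OF A B] by (auto simp: image_iff)

lemma transition_eq:
  assumes A: "unitary A" and B: "unitary B" and nz: "det (upper (block A B W)) \<noteq> 0"
  shows "transition (\<lambda>_. UNIV) plane A B W = lower (block A B W) ** matrix_inv (upper (block A B W))"
  unfolding transition_def plane_eqI[OF A B nz] by (rule inv_into_f_f[OF inj_plane[OF B]]) simp

lemma bounded_linear_mult_right: "bounded_linear (\<lambda>X :: complex^'c^'b. (M :: complex^'b^'a) ** X)"
  by (rule bounded_bilinear.bounded_linear_right[OF bounded_bilinear_matrix_mult])

lemma frameC_affine: "frameC A W = A ** vstack (mat 1) 0 + A ** vstack 0 W"
  by (simp add: frameC_def vstack_add flip: matrix_mult_right_distrib)

lemma smooth_frameC: "smooth_on (frameC A) UNIV"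
proof -
  have "smooth_on (\<lambda>W. A ** vstack (mat 1) 0 + A ** vstack 0 W) UNIV"
    by (intro smooth_on_add smooth_on_const open_UNIV smooth_on_ident
      smooth_on_bounded_linear[OF bounded_linear_compose[OF bounded_linear_mult_right bounded_linear_vstack_0(1)]])
  then show ?thesis
    by (simp add: frameC_affine[abs_def])
qed

lemma smooth_on_subset: "smooth_on f S \<Longrightarrow> T \<subseteq> S \<Longrightarrow> smooth_on f T"
proof -
  have "Ck_on k f S \<Longrightarrow> T \<subseteq> S \<Longrightarrow> Ck_on k f T" for k
    by (induction k arbitrary: f) (auto intro: continuous_on_subset)
  then show "smooth_on f S \<Longrightarrow> T \<subseteq> S \<Longrightarrow> smooth_on f T"
    by (auto simp: smooth_on_def)
qed

lemma smooth_on_imp_continuous_on: "smooth_on f S \<Longrightarrow> continuous_on S f"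
  unfolding smooth_on_def by (metis Ck_on.simps(1))

lemma smooth_block: "smooth_on (block A B) UNIV"
  unfolding block_def[abs_def]
  by (rule smooth_on_bounded_linear[OF bounded_linear_mult_right open_UNIV smooth_frameC])

lemma open_overlap:
  assumes "unitary A" "unitary B"
  shows "open (overlap (\<lambda>_. UNIV) plane A B)"
proof -
  have "continuous_on UNIV (\<lambda>W. upper (block A B W))"
    by (intro smooth_on_imp_continuous_on smooth_on_bounded_linear[OF bounded_linear_upper] smooth_block open_UNIV)
  from open_vimage[OF open_det_nonzero this] show ?thesis
    by (simp add: overlap_eq[OF assms] vimage_def)
qed

lemma smooth_transition:
  assumes "unitary A" "unitary B"
  shows "smooth_on (transition (\<lambda>_. UNIV) plane A B) (overlap (\<lambda>_. UNIV) plane A B)"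
proof (rule smooth_on_cong[OF open_overlap[OF assms]])
  let ?S = "overlap (\<lambda>_. UNIV) plane A B"
  have S: "open ?S" "smooth_on (block A B) ?S"
    using open_overlap[OF assms] smooth_on_subset[OF smooth_block] by auto
  then show "smooth_on (\<lambda>W. lower (block A B W) ** matrix_inv (upper (block A B W))) ?S"
    by (intro smooth_on_matrix_mult smooth_on_matrix_inv smooth_on_bounded_linear[OF bounded_linear_upper]
        smooth_on_bounded_linear[OF bounded_linear_lower]) (auto simp: overlap_eq[OF assms])
qed (auto simp: overlap_eq[OF assms] transition_eq[OF assms])

lemma plane_transition:
  assumes "W \<in> overlap (\<lambda>_. UNIV) plane A B"
  shows "plane B (transition (\<lambda>_. UNIV) plane A B W) = plane A W"
  using assms unfolding transition_def overlap_def by (simp add: f_inv_into_f)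

text \<open>Both sides are the off-diagonal part of the derivative of the orthogonal projection, which
  does not depend on the chart.\<close>

lemma tan_op_transition:
  assumes A: "unitary A" and B: "unitary B" and W: "W \<in> overlap (\<lambda>_. UNIV) plane A B"
  shows "tan_op B (transition (\<lambda>_. UNIV) plane A B W) (dir_deriv (transition (\<lambda>_. UNIV) plane A B) u W)
    = tan_op A W u"
proof -
  let ?t = "transition (\<lambda>_. UNIV) plane A B" and ?S = "overlap (\<lambda>_. UNIV) plane A B"
  have proj: "proj A y = proj B (?t y)" if "y \<in> ?S" for y
    using plane_transition[OF that] plane_eq_iff[OF A B] by metis
  have "(?t has_derivative frechet_derivative ?t (at W)) (at W)"
    using smooth_transition[OF A B] W smooth_on_iff[of ?t ?S] by (simp add: frechet_derivative_works[symmetric])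
  from has_derivative_compose[OF this has_derivative_proj[OF B]]
  have "((\<lambda>y. proj B (?t y)) has_derivative (\<lambda>u. tan_op B (?t W) (dir_deriv ?t u W)
      + cadjoint (tan_op B (?t W) (dir_deriv ?t u W)))) (at W)" .
  then have "(proj A has_derivative (\<lambda>u. tan_op B (?t W) (dir_deriv ?t u W)
      + cadjoint (tan_op B (?t W) (dir_deriv ?t u W)))) (at W)"
    by (rule has_derivative_transform_within_open[OF _ open_overlap[OF A B] W]) (simp add: proj)
  from has_derivative_unique[OF this has_derivative_proj[OF A]]
  have "tan_op B (?t W) (dir_deriv ?t u W) + cadjoint (tan_op B (?t W) (dir_deriv ?t u W))
    = tan_op A W u + cadjoint (tan_op A W u)"
    by metis
  \<comment> \<open>Multiplication by the projection keeps \<open>T\<close> and kills \<open>T\<^sup>*\<close>.\<close>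
  then have "(tan_op B (?t W) (dir_deriv ?t u W) + cadjoint (tan_op B (?t W) (dir_deriv ?t u W))) ** proj B (?t W)
    = (tan_op A W u + cadjoint (tan_op A W u)) ** proj A W"
    by (simp only: proj[OF W])
  then show ?thesis
    by (simp only: matrix_mult_left_distrib proj_tan_op[OF A] proj_tan_op[OF B]) simp
qed

section \<open>The Grassmannian as a closed manifold\<close>

text \<open>An orthonormal basis of the plane is completed to one of the whole space; the basis vectors are the
columns of the unitary matrix.\<close>

lemma exists_unitary_plane:
  fixes V :: "(complex^('m::finite + 'n::finite)) set"
  assumes "V \<in> grassmannian"
  shows "\<exists>A :: complex^('m + 'n)^('m + 'n). unitary A \<and> plane A 0 = V"
proof -
  have V: "vec.subspace V" "vec.dim V = CARD('m)"
    using assms by (auto simp: grassmannian_def)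
  obtain B where B: "orthonormal B" "B \<subseteq> V" "vec.span B = V"
    using orthonormal_extend[OF V(1), of "{}"] by (auto simp: orthonormal_def)
  obtain B' where B': "B \<subseteq> B'" "orthonormal B'" "vec.span B' = UNIV"
    using orthonormal_extend[OF vec.subspace_UNIV B(1)] by auto
  have "vec.independent B" "vec.independent B'"
    using B B' orthonormal_independent by auto
  moreover from this have "card B = CARD('m)"
    using vec.dim_eq_card[of B V] B V by (simp add: vec.span_eq_iff[THEN iffD2])
  moreover have "card B' = vec.dim (UNIV :: (complex^('m + 'n)) set)"
    using vec.dim_eq_card[of B' UNIV] B' \<open>vec.independent B'\<close> by (metis vec.span_UNIV)
  then have "card B' = CARD('m) + CARD('n)"
    unfolding vec_dim_card by simp
  ultimately have fin: "finite B" "finite B'" and card: "card B = CARD('m)" "card (B' - B) = CARD('n)"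
    using B'(1) vec.finiteI_independent[of B] vec.finiteI_independent[of B'] by (auto simp: card_Diff_subset)
  obtain f :: "'m \<Rightarrow> complex^('m + 'n)" where f: "bij_betw f UNIV B"
    using finite_same_card_bij[of "UNIV :: 'm set" B] fin card by auto
  obtain g :: "'n \<Rightarrow> complex^('m + 'n)" where g: "bij_betw g UNIV (B' - B)"
    using finite_same_card_bij[of "UNIV :: 'n set" "B' - B"] fin card by auto
  define A :: "complex^('m + 'n)^('m + 'n)" where
    "A = (\<chi> k i. (case i of Inl a \<Rightarrow> f a | Inr b \<Rightarrow> g b) $ k)"
  have col: "column (Inl a) A = f a" "column (Inr b) A = g b" for a b
    by (simp_all add: A_def column_def vec_eq_iff)
  have mem: "f a \<in> B'" "g b \<in> B'" "f a \<noteq> g b" "g b \<noteq> f a" for a b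
    using f g B'(1) by (force simp: bij_betw_def)+
  have inj: "f a = f a' \<longleftrightarrow> a = a'" "g b = g b' \<longleftrightarrow> b = b'" for a a' b b'
    using f g by (auto simp: bij_betw_def inj_on_def)
  have on: "hinner x y = (if x = y then 1 else 0)" if "x \<in> B'" "y \<in> B'" for x y
    using B'(2) that by (simp add: orthonormal_def)
  have "hinner (column i A) (column j A) = (if j = i then 1 else 0)" for i j
    by (cases i; cases j) (simp_all add: col on mem inj)
  then have "unitary A"
    by (auto simp: unitary_def vec_eq_iff mat_def hinner_columns)
  moreover have "c_frame A 0 a = f a" for a
    by (simp add: c_frame_def col[symmetric] vec_eq_iff matrix_vector_mult_def axis_def column_def if_distrib cong: if_cong)
  then have "plane A 0 = V"
    using f B by (simp add: plane_def bij_betw_def)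
  ultimately show ?thesis by blast
qed

lemma smooth_atlas_grassmannian:
  "smooth_atlas (grassmannian :: (complex^('m::finite + 'n::finite)) set set) {A. unitary A} (\<lambda>_. UNIV) plane"
  unfolding smooth_atlas_def
proof (intro conjI ballI)
  show "(\<Union>A\<in>{A. unitary A}. range (plane A)) = (grassmannian :: (complex^('m + 'n)) set set)"
    using exists_unitary_plane plane_in_grassmannian by fastforce
qed (auto intro: inj_plane open_overlap smooth_transition)

lemma openin_atlas_topology:
  assumes "\<And>a. a \<in> I \<Longrightarrow> open (D a)"
  shows "openin (atlas_topology M I D \<phi>) S \<longleftrightarrow> S \<subseteq> M \<and> (\<forall>a\<in>I. open {x \<in> D a. \<phi> a x \<in> S})"
proof -
  have "istopology (\<lambda>S. S \<subseteq> M \<and> (\<forall>a\<in>I. open {x \<in> D a. \<phi> a x \<in> S}))"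
    unfolding istopology_def
  proof (intro conjI allI impI ballI)
    fix S T a
    assume "S \<subseteq> M \<and> (\<forall>a\<in>I. open {x \<in> D a. \<phi> a x \<in> S})" "T \<subseteq> M \<and> (\<forall>a\<in>I. open {x \<in> D a. \<phi> a x \<in> T})" "a \<in> I"
    then have "open ({x \<in> D a. \<phi> a x \<in> S} \<inter> {x \<in> D a. \<phi> a x \<in> T})"
      by auto
    moreover have "{x \<in> D a. \<phi> a x \<in> S} \<inter> {x \<in> D a. \<phi> a x \<in> T} = {x \<in> D a. \<phi> a x \<in> S \<inter> T}"
      by auto
    ultimately show "open {x \<in> D a. \<phi> a x \<in> S \<inter> T}" by simp
  next
    fix K a
    assume "\<forall>S\<in>K. S \<subseteq> M \<and> (\<forall>a\<in>I. open {x \<in> D a. \<phi> a x \<in> S})" "a \<in> I"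
    then have "open (\<Union>S\<in>K. {x \<in> D a. \<phi> a x \<in> S})"
      by (intro open_UN) auto
    moreover have "(\<Union>S\<in>K. {x \<in> D a. \<phi> a x \<in> S}) = {x \<in> D a. \<phi> a x \<in> \<Union>K}"
      by auto
    ultimately show "open {x \<in> D a. \<phi> a x \<in> \<Union>K}" by simp
  qed auto
  then show ?thesis
    unfolding atlas_topology_def by (simp add: topology_inverse')
qed

abbreviation grassmannian_topology :: "(complex^('m::finite + 'n::finite)) set topology" where
  "grassmannian_topology \<equiv> atlas_topology grassmannian {A. unitary A} (\<lambda>_. UNIV) plane"

lemma openin_grassmannian:
  "openin grassmannian_topology S \<longleftrightarrow> S \<subseteq> grassmannian \<and> (\<forall>A. unitary A \<longrightarrow> open {W. plane A W \<in> S})"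
  by (subst openin_atlas_topology) auto

lemma topspace_grassmannian:
  "topspace (grassmannian_topology :: (complex^('m::finite + 'n::finite)) set topology) = grassmannian"
proof
  show "topspace grassmannian_topology \<subseteq> (grassmannian :: (complex^('m + 'n)) set set)"
    using openin_topspace openin_grassmannian by blast
  have "openin grassmannian_topology (grassmannian :: (complex^('m + 'n)) set set)"
    by (simp add: openin_grassmannian plane_in_grassmannian)
  then show "(grassmannian :: (complex^('m + 'n)) set set) \<subseteq> topspace grassmannian_topology"
    by (rule openin_subset)
qed

text \<open>Distinct planes have distinct projections, and the projection depends continuously on the
coordinates, so disjoint neighbourhoods are pulled back from the space of matrices.\<close>

lemma Hausdorff_grassmannian:
  "Hausdorff_space (grassmannian_topology :: (complex^('m::finite + 'n::finite)) set topology)"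
  unfolding Hausdorff_space_def topspace_grassmannian
proof (intro allI impI)
  fix V V' :: "(complex^('m + 'n)) set"
  assume VV: "V \<in> grassmannian \<and> V' \<in> grassmannian \<and> V \<noteq> V'"
  then obtain A B :: "complex^('m + 'n)^('m + 'n)" where
    AB: "unitary A" "V = plane A 0" "unitary B" "V' = plane B 0"
    using exists_unitary_plane by metis
  then have "orth_proj V \<noteq> orth_proj V'"
    using VV plane_eq_iff[of A B] by (auto simp: orth_proj_plane)
  then obtain X Y where XY: "open X" "open Y" "orth_proj V \<in> X" "orth_proj V' \<in> Y" "X \<inter> Y = {}"
    using hausdorff[of "orth_proj V" "orth_proj V'"] by metis
  have op: "openin grassmannian_topology {V \<in> grassmannian. orth_proj V \<in> X}"
    if "open X" for X :: "(complex^('m + 'n)^('m + 'n)) set"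
    unfolding openin_grassmannian
  proof (intro conjI allI impI)
    fix C :: "complex^('m + 'n)^('m + 'n)"
    assume C: "unitary C"
    have "continuous_on UNIV (proj C)"
      by (intro continuous_at_imp_continuous_on ballI has_derivative_continuous[OF has_derivative_proj[OF C]])
    from open_vimage[OF that this] show "open {W. plane C W \<in> {V \<in> grassmannian. orth_proj V \<in> X}}"
      by (simp add: plane_in_grassmannian[OF C] orth_proj_plane[OF C] vimage_def)
  qed auto
  show "\<exists>S T. openin grassmannian_topology S \<and> openin grassmannian_topology T \<and> V \<in> S \<and> V' \<in> T \<and> disjnt S T"
    by (rule exI[of _ "{V \<in> grassmannian. orth_proj V \<in> X}"], rule exI[of _ "{V \<in> grassmannian. orth_proj V \<in> Y}"])
      (use VV XY op in \<open>auto simp: disjnt_def\<close>)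
qed

lemma compact_unitary: "compact {A :: complex^'a::finite^'a. unitary A}"
proof -
  have "continuous_on UNIV (\<lambda>A :: complex^'a^'a. cadjoint A ** A)"
    by (intro bounded_bilinear.continuous_on[OF bounded_bilinear_matrix_mult]
        bounded_linear.continuous_on[OF bounded_linear_cadjoint] continuous_on_id)
  from closed_vimage[OF closed_singleton[of "mat 1"] this]
  have "closed {A :: complex^'a^'a. unitary A}"
    by (simp add: unitary_def vimage_def)
  moreover have "norm A \<le> sqrt (real CARD('a))" if "unitary A" for A :: "complex^'a^'a"
  proof -
    have "A \<bullet> A = real CARD('a)"
      using that by (simp add: inner_eq_reTr unitary_right reTr_def trace_I)
    then show ?thesis by (simp add: norm_eq_sqrt_inner)
  qed
  then have "bounded {A :: complex^'a^'a. unitary A}"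
    by (auto simp: bounded_iff)
  ultimately show ?thesis
    by (simp add: compact_eq_bounded_closed)
qed

text \<open>The Grassmannian is the image of the compact unitary group. For continuity near \<open>A\<close> the plane of a
nearby \<open>B\<close> is followed in the chart of \<open>A\<close>.\<close>

lemma compact_grassmannian:
  "compact_space (grassmannian_topology :: (complex^('m::finite + 'n::finite)) set topology)"
proof -
  let ?U = "{A :: complex^('m + 'n)^('m + 'n). unitary A}"
  let ?f = "\<lambda>A :: complex^('m + 'n)^('m + 'n). plane A 0"
  have "continuous_map (top_of_set ?U) grassmannian_topology ?f"
    unfolding continuous_map topspace_grassmannian
  proof (intro conjI allI impI)
    show "?f ` topspace (top_of_set ?U) \<subseteq> grassmannian"
      using plane_in_grassmannian by auto
    fix S :: "(complex^('m + 'n)) set set"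
    assume S: "openin grassmannian_topology S"
    show "openin (top_of_set ?U) {A \<in> topspace (top_of_set ?U). ?f A \<in> S}"
    proof (subst openin_subopen, intro ballI)
      fix A
      assume "A \<in> {A \<in> topspace (top_of_set ?U). ?f A \<in> S}"
      then have A: "unitary A" "plane A 0 \<in> S" by auto
      define F :: "complex^('m + 'n)^('m + 'n) \<Rightarrow> complex^'m^('m + 'n)" where
        "F B = cadjoint A ** (B ** vstack (mat 1) 0)" for B
      define G where "G = {B. det (upper (F B)) \<noteq> 0}"
      define c where "c B = lower (F B) ** matrix_inv (upper (F B))" for B
      have F: "F B = block B A 0" for B
        by (simp add: F_def block_def frameC_def)
      have contF: "continuous_on T F" for T
        unfolding F_def[abs_def]
        by (intro bounded_bilinear.continuous_on[OF bounded_bilinear_matrix_mult] continuous_intros)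
      have "continuous_on UNIV (\<lambda>B. upper (F B))"
        by (intro bounded_linear.continuous_on[OF bounded_linear_upper] contF)
      from open_vimage[OF open_det_nonzero this] have "open G"
        by (simp add: G_def vimage_def)
      moreover have "continuous_on G c"
        unfolding c_def[abs_def]
        by (intro bounded_bilinear.continuous_on[OF bounded_bilinear_matrix_mult] continuous_on_matrix_inv
            bounded_linear.continuous_on[OF bounded_linear_upper]
            bounded_linear.continuous_on[OF bounded_linear_lower] contF) (simp add: G_def)
      moreover have "open {W. plane A W \<in> S}"
        using S A by (simp add: openin_grassmannian)
      ultimately have op: "open (c -` {W. plane A W \<in> S} \<inter> G)"
        by (metis continuous_on_open_vimage)
      have FA: "F A = vstack (mat 1) 0"
        using A by (simp add: F_def matrix_mul_assoc unitary_def)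
      have "A \<in> c -` {W. plane A W \<in> S} \<inter> G"
        using A by (simp add: c_def G_def FA)
      moreover have "?f B \<in> S" if "B \<in> c -` {W. plane A W \<in> S} \<inter> G" "unitary B" for B
        using that plane_eqI[OF that(2) A(1), of 0] by (simp add: c_def G_def F)
      ultimately show "\<exists>T. openin (top_of_set ?U) T \<and> A \<in> T \<and> T \<subseteq> {A \<in> topspace (top_of_set ?U). ?f A \<in> S}"
        using A openin_open_Int[OF op, of ?U]
        by (intro exI[of _ "?U \<inter> (c -` {W. plane A W \<in> S} \<inter> G)"]) auto
    qed
  qed
  moreover have "compactin (top_of_set ?U) ?U"
    using compact_unitary by (simp add: compactin_subtopology)
  ultimately have "compactin grassmannian_topology (?f ` ?U)"
    by (rule image_compactin[rotated])
  moreover have "?f ` ?U = grassmannian"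
    using exists_unitary_plane plane_in_grassmannian by fastforce
  ultimately show ?thesis
    by (simp add: compact_space_def topspace_grassmannian)
qed

section \<open>The tensor fields on the Grassmannian\<close>

lemma smooth_gramC_inv: "smooth_on (gramC_inv :: complex^'m^'n \<Rightarrow> _) UNIV"
  unfolding gramC_inv_def[abs_def]
  by (intro smooth_on_matrix_inv smooth_on_add smooth_on_matrix_mult smooth_on_cadjoint smooth_on_const
      smooth_on_ident open_UNIV) (rule det_one_plus_cadjoint_mult)

lemma smooth_gramK_inv: "smooth_on (gramK_inv :: complex^'m^'n \<Rightarrow> _) UNIV"
  unfolding gramK_inv_def[abs_def]
  by (intro smooth_on_matrix_inv smooth_on_add smooth_on_matrix_mult smooth_on_cadjoint smooth_on_const
      smooth_on_ident open_UNIV) (use det_one_plus_cadjoint_mult[of "cadjoint _"] in simp)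

lemma smooth_dualC: "smooth_on (dualC A) UNIV"
  unfolding dualC_def[abs_def]
  by (intro smooth_on_matrix_mult smooth_frameC smooth_gramC_inv open_UNIV)

lemma smooth_dualK: "smooth_on (dualK A) UNIV"
proof -
  have "frameK A = (\<lambda>W. A ** vstack 0 (mat 1) + A ** vstack (cadjoint (- W)) 0)"
    by (simp add: fun_eq_iff frameK_def vstack_add flip: matrix_mult_right_distrib)
  moreover have "smooth_on (\<lambda>W. A ** vstack 0 (mat 1) + A ** vstack (cadjoint (- W)) 0) UNIV"
    by (intro smooth_on_add smooth_on_const open_UNIV smooth_on_ident smooth_on_cadjoint
      smooth_on_bounded_linear[OF bounded_linear_compose[OF bounded_linear_mult_right bounded_linear_vstack_0(2)]]
      smooth_on_bounded_linear[OF bounded_linear_minus[OF bounded_linear_ident]])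
  ultimately show ?thesis
    unfolding dualK_def[abs_def]
    by (intro smooth_on_matrix_mult smooth_gramK_inv open_UNIV) simp
qed

lemma smooth_tan_op: "smooth_on (\<lambda>W. tan_op A W u) UNIV"
  unfolding tan_op_def
  by (intro smooth_on_matrix_mult smooth_dualC smooth_dualK smooth_on_cadjoint smooth_on_const open_UNIV)

lemma smooth_proj: "smooth_on (proj A) UNIV"
  unfolding proj_def[abs_def]
  by (intro smooth_on_matrix_mult smooth_dualC smooth_frameC smooth_on_cadjoint open_UNIV)

lemmas smooth_on_reTr = smooth_on_bounded_linear[OF bounded_linear_reTr]
lemmas smooth_on_times = smooth_on_bounded_bilinear[OF bounded_bilinear_mult]

lemma smooth_fs_metric: "smooth_on (\<lambda>W. fs_metric A W u v) UNIV"
  unfolding fs_metric_def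
  by (intro smooth_on_times smooth_on_const smooth_on_reTr smooth_on_matrix_mult smooth_on_cadjoint
      smooth_tan_op open_UNIV)

lemma smooth_deform: "smooth_on (\<lambda>W. deform A \<gamma> W u v) UNIV"
  unfolding deform_def form1_def form2_def form3_def
  by (intro smooth_on_add smooth_on_times smooth_on_const smooth_on_reTr smooth_on_matrix_mult
      smooth_on_cadjoint smooth_tan_op smooth_proj smooth_fs_metric open_UNIV)

lemma deform_bilinear: "bilinear (deform A \<gamma> W)"
  by (rule bilinearI)
    (auto simp: deform_def form1_def form2_def form3_def fs_metric_def tan_op_linear matrix_mult_expand algebra_simps)

lemma deform_commute:
  assumes "hermitian \<gamma>"
  shows "deform A \<gamma> W u v = deform A \<gamma> W v u"
  by (simp add: deform_def form1_commute[OF assms, of A W u] form2_commute[OF assms, of A W u]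
      form3_def fs_metric_commute[of A W u])

lemma symmetric_tensor_field_fs_metric:
  "symmetric_tensor_field {A :: complex^('m::finite + 'n::finite)^('m + 'n). unitary A} (\<lambda>_. UNIV) plane fs_metric"
  unfolding symmetric_tensor_field_def
  by (auto intro: fs_metric_bilinear fs_metric_commute smooth_fs_metric)
    (simp add: fs_metric_def tan_op_transition)

lemma symmetric_tensor_field_deform:
  fixes \<gamma> :: "complex^('m::finite + 'n::finite)^('m + 'n)"
  assumes "hermitian \<gamma>"
  shows "symmetric_tensor_field {A. unitary A} (\<lambda>_. UNIV) plane (\<lambda>A. deform A \<gamma>)"
proof -
  have "deform A \<gamma> W u v = deform B \<gamma> (transition (\<lambda>_. UNIV) plane A B W)
      (dir_deriv (transition (\<lambda>_. UNIV) plane A B) u W) (dir_deriv (transition (\<lambda>_. UNIV) plane A B) v W)"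
    if AB: "unitary A" "unitary B" and W: "W \<in> overlap (\<lambda>_. UNIV) plane A B" for A B W u v
  proof -
    have "proj B (transition (\<lambda>_. UNIV) plane A B W) = proj A W"
      using plane_transition[OF W] plane_eq_iff[OF AB] by metis
    then show ?thesis
      by (simp add: deform_def form1_def form2_def form3_def fs_metric_def tan_op_transition[OF AB W])
  qed
  then show ?thesis
    unfolding symmetric_tensor_field_def
    using deform_bilinear deform_commute[OF assms] smooth_deform by auto
qed

theorem theorem2:
  fixes \<gamma> :: "complex^('m::finite + 'n::finite)^('m + 'n)"
  assumes "CARD('m) \<ge> 2" and "CARD('n) \<ge> 2"
    and "hermitian \<gamma>" and "trace \<gamma> = 0"
  shows "infinitesimal_einstein_deformation
           (grassmannian :: (complex^('m + 'n)) set set)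
           {A. unitary A} (\<lambda>_. UNIV) plane
           (real_tensor fubini_study) (real_tensor (deformation \<gamma>))"
proof -
  \<comment> \<open>The chart index set consists of the unitary matrices, and the matrix expressions are compared with
    the given tensor fields over these charts only.\<close>
  have congr: "symmetric_tensor_field {A. unitary A} (\<lambda>_. UNIV) plane h"
    if "symmetric_tensor_field {A. unitary A} (\<lambda>_. UNIV) plane h'" "\<And>A. unitary A \<Longrightarrow> h A = h' A"
    for h h' :: "complex^('m + 'n)^('m + 'n) \<Rightarrow> (complex^'m^'n) tensor2"
    using that unfolding symmetric_tensor_field_def by simp
  have "closed_einstein_manifold (grassmannian :: (complex^('m + 'n)) set set) {A. unitary A} (\<lambda>_. UNIV) plane
      (real_tensor fubini_study) (real CARD('n) + real CARD('m))"
    unfolding closed_einstein_manifold_def closed_manifold_def riemannian_metric_def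
    using smooth_atlas_grassmannian Hausdorff_grassmannian compact_grassmannian
      congr[OF symmetric_tensor_field_fs_metric real_tensor_fubini_study]
    by (auto simp: real_tensor_fubini_study fs_metric_positive ricci_fs_metric)
  moreover have "real CARD('n) + real CARD('m) > 0"
    using assms by simp
  ultimately have "\<exists>l>0. closed_einstein_manifold (grassmannian :: (complex^('m + 'n)) set set)
      {A. unitary A} (\<lambda>_. UNIV) plane (real_tensor fubini_study) l"
    by blast
  moreover have "symmetric_tensor_field {A. unitary A} (\<lambda>_. UNIV) plane (real_tensor (deformation \<gamma>))"
    by (rule congr[OF symmetric_tensor_field_deform real_tensor_deformation]) (use assms in auto)
  ultimately show ?thesis
    unfolding infinitesimal_einstein_deformation_def using assms
    by (auto simp: real_tensor_fubini_study real_tensor_deformation metric_trace_deform divergence_deform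
        laplacian_deform)
qed

end
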